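(* Let $\mathcal{C}$ be a rigid C*-tensor category with simple unit object, $(\mathbf{F},\eta):\mathcal{C}\to\mathsf{Hilb}_{\mathrm{f.d.}}$ a dagger tensor functor, $\mathbb{G}$ the corresponding discrete quantum group with Hopf $*$-algebra $\mathbb{C}[\mathbb{G}]$, and $\mathbf{G}\in\mathsf{Vec}(\mathcal{C})$ the associated connected W*-algebra object. Let $\Phi:\mathbf{G}\Rightarrow\mathbf{G}$ be a natural transformation and let $\phi:\mathbb{C}[\mathbb{G}]\to\mathbb{C}$ be the linear functional corresponding to $\Phi$. Then $\Phi$ is ucp if and only if $\phi$ is a state on $\mathbb{C}[\mathbb{G}]$.
   Context: **Category.** $\mathcal{C}$ is a rigid C*-tensor category with simple unit $1_{\mathcal{C}}$, admitting finite direct sums and subobjects (associators suppressed); $\mathrm{Irr}(\mathcal{C})$ is a set of representatives of simple objects. Each $a$ has a conjugate $\overline a$ and standard duality maps $\mathrm{ev}_a:\overline a\otimes a\to1_{\mathcal{C}}$, $\mathrm{ev}_{\overline a}:a\otimes\overline a\to1_{\mathcal{C}}$ (identifying $\overline{\overline a}=a$), with $\mathrm{coev}_a=\mathrm{ev}_{\overline a}^*$; $d_a$ is the quantum dimension. $\mathrm{ONB}(a\otimes b,c)$ is an orthonormal basis of $\mathcal{C}(a\otimes b,c)$ for $\langle\psi|\phi\rangle=$ categorical trace of $\psi^*\phi$. $\mathsf{Hilb}_{\mathrm{f.d.}}$ is the category of finite dimensional Hilbert spaces, and $\mathbf{F}(1_{\mathcal{C}})$ is identified with $\mathbb{C}$.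 **The $*$-algebra $\mathbb{C}[\mathbb{G}]$.** For $c\in\mathcal{C}$, $H_c=\mathrm{Hom}(\mathbb{C},\mathbf{F}(c))\cong\mathbf{F}(c)$ and $H_c^*=\mathrm{Hom}(\mathbf{F}(c),\mathbb{C})$. For $\alpha\in\mathcal{C}(a\otimes b,c)$, $\hat\alpha=\mathbf{F}(\alpha)\circ\eta_{a,b}:\mathbf{F}(a)\otimes\mathbf{F}(b)\to\mathbf{F}(c)$; in particular $\widehat{\mathrm{ev}}_a:\mathbf{F}(\overline a)\otimes\mathbf{F}(a)\to\mathbb{C}$ and $\widehat{\mathrm{ev}}_{\overline a}:\mathbf{F}(a)\otimes\mathbf{F}(\overline a)\to\mathbb{C}$. As a vector space $\mathbb{C}[\mathbb{G}]=\bigoplus_{a\in\mathrm{Irr}(\mathcal{C})}H_a^*\otimes H_a$ (algebraic direct sum). For $x_{(1)}\otimes x_{(2)}\in H_a^*\otimes H_a$ and $y_{(1)}\otimes y_{(2)}\in H_b^*\otimes H_b$, $$xy=\sum_{c\in\mathrm{Irr}(\mathcal{C})}\sum_{\alpha\in\mathrm{ONB}(a\otimes b,c)}d_c\,\big((x_{(1)}\otimes y_{(1)})\circ\hat\alpha^*\big)\otimes\big(\hat\alpha\circ(x_{(2)}\otimes y_{(2)})\big).$$ The antipode is $S(x_{(1)}\otimes x_{(2)})=\big(\widehat{\mathrm{ev}}_a\circ(\mathrm{id}_{\mathbf{F}(\overline a)}\otimes x_{(2)})\big)\otimes\big((x_{(1)}\otimes\mathrm{id}_{\mathbf{F}(\overline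 a)})\circ\widehat{\mathrm{ev}}_{\overline a}^*\big)$, the map $j$ is $j(x_{(1)}\otimes x_{(2)})=x_{(2)}^*\otimes x_{(1)}^*$, and the involution is $x^{\#}=S(j(x))$. The unit $1_{\mathbb{C}[\mathbb{G}]}$ is the canonical element $1\otimes1\in H_{1_{\mathcal{C}}}^*\otimes H_{1_{\mathcal{C}}}$. A *state* on $\mathbb{C}[\mathbb{G}]$ is a linear functional $\phi$ with $\phi(1_{\mathbb{C}[\mathbb{G}]})=1$ and $\phi(x^{\#}x)\ge0$ for all $x$. **The algebra object $\mathbf{G}$.** $\mathsf{Vec}(\mathcal{C})$ is the category of linear functors $\mathcal{C}^{\rm op}\to\mathsf{Vec}$. $\mathbf{G}(a)=\mathrm{Hom}(\mathbf{F}(a),\mathbb{C})=H_a^*$, with multiplication $\mathbf{G}(a)\otimes\mathbf{G}(b)\to\mathbf{G}(a\otimes b)$, $f\otimes g\mapsto(f\otimes g)\circ\eta_{a,b}^{-1}$, unit $1\in\mathbf{G}(1_{\mathcal{C}})$, and $*$-structure $j_a(f)=\widehat{\mathrm{ev}}_a\circ(\mathrm{id}_{\mathbf{F}(\overline a)}\otimes f^* )\in\mathbf{G}(\overline a)$. For $c\in\mathcal{C}$, $\mathbf{G}(\overline c\otimes c)$ is identified with the C*-algebra $B(\mathbf{F}(c))$ via $f\in B(\mathbf{F}(c))\mapsto\widehat{\mathrm{ev}}_c\circ(\mathrm{id}_{\mathbf{F}(\overline c)}\otimes f)$ (precomposed with $\eta^{-1}$). A natural transformation $\Phi:\mathbf{G}\Rightarrow\mathbf{G}$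 is *ucp* if it commutes with the $j_a$, fixes the unit, and for all $c\in\mathcal{C}$ the map $\Phi_{\overline c\otimes c}$ on $\mathbf{G}(\overline c\otimes c)\cong B(\mathbf{F}(c))$ maps positive elements to positive elements. **Correspondence.** A natural transformation $\Phi:\mathbf{G}\Rightarrow\mathbf{G}$ is the same as a family of operators $\Phi_a\in B(H_a)$, $a\in\mathrm{Irr}(\mathcal{C})$, acting on $H_a^*=\mathbf{G}(a)$ by precomposition, $x\mapsto x\circ\Phi_a$. The corresponding functional on $\mathbb{C}[\mathbb{G}]$ is $\phi(x_{(1)}\otimes x_{(2)})=x_{(1)}(\Phi_a(x_{(2)}))$ for $x_{(1)}\otimes x_{(2)}\in H_a^*\otimes H_a$. *)

theory Defs
  imports Complex_Main "HOL-Library.Function_Algebras"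
begin

section \<open>Rigid C*-tensor categories\<close>

text \<open>
  Objects are the elements of the type \<open>'o\<close>.  The morphism spaces \<open>hom C a b\<close> are linear
  subspaces of one complex vector space \<open>'m\<close> (for a given category one may take the algebraic
  direct sum of all its morphism spaces), so that finite sums of morphisms are ordinary sums.
  \<open>g \<cdot> f\<close> is the composite ``first f, then g''.

  The data include the choices the constructions refer to: the conjugates with their
  duality maps and the set of representatives of the simple objects.  \<open>ev C a\<close> has
  type \<open>bar a \<otimes> a \<rightarrow> 1\<close>, and \<open>evb C a : a \<otimes> bar a \<rightarrow> 1\<close> is the map written
  ``ev at bar a'' when the double conjugate of \<open>a\<close> is identified with \<open>a\<close>;
  carrying it separately avoids demanding a literal equality \<open>bar (bar a) = a\<close>.
\<close>

record ('o, 'm) tensor_cat =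
  hom :: "'o \<Rightarrow> 'o \<Rightarrow> 'm set"
  idm :: "'o \<Rightarrow> 'm"
  cmp :: "'m \<Rightarrow> 'm \<Rightarrow> 'm" (infixl "\<cdot>\<index>" 70)
  scl :: "complex \<Rightarrow> 'm \<Rightarrow> 'm"
  dag :: "'m \<Rightarrow> 'm"
  nrm :: "'m \<Rightarrow> real"
  tobj :: "'o \<Rightarrow> 'o \<Rightarrow> 'o" (infixr "\<otimes>\<index>" 75)
  tmor :: "'m \<Rightarrow> 'm \<Rightarrow> 'm" (infixr "\<boxtimes>\<index>" 75)
  unt :: "'o"
  assc :: "'o \<Rightarrow> 'o \<Rightarrow> 'o \<Rightarrow> 'm"
  lunit :: "'o \<Rightarrow> 'm"
  runit :: "'o \<Rightarrow> 'm"
  bar :: "'o \<Rightarrow> 'o"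
  ev :: "'o \<Rightarrow> 'm"
  evb :: "'o \<Rightarrow> 'm"
  irr :: "'o set"

definition unitary_mor :: "('o, 'm) tensor_cat \<Rightarrow> 'o \<Rightarrow> 'o \<Rightarrow> 'm \<Rightarrow> bool" where
  "unitary_mor C a b u \<longleftrightarrow> u \<in> hom C a b \<and>
     dag C u \<cdot>\<^bsub>C\<^esub> u = idm C a \<and> u \<cdot>\<^bsub>C\<^esub> dag C u = idm C b"

definition iso_obj :: "('o, 'm) tensor_cat \<Rightarrow> 'o \<Rightarrow> 'o \<Rightarrow> bool" where
  "iso_obj C a b \<longleftrightarrow> (\<exists>f \<in> hom C a b. \<exists>g \<in> hom C b a.
     g \<cdot>\<^bsub>C\<^esub> f = idm C a \<and> f \<cdot>\<^bsub>C\<^esub> g = idm C b)"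

definition simple_obj :: "('o, 'm::ab_group_add) tensor_cat \<Rightarrow> 'o \<Rightarrow> bool" where
  "simple_obj C a \<longleftrightarrow> idm C a \<noteq> 0 \<and> hom C a a = range (\<lambda>z. scl C z (idm C a))"

locale cstar_category = vector_space "scl C"
  for C :: "('o, 'm::ab_group_add) tensor_cat" (structure) +
  assumes hom_subspace: "subspace (hom C a b)"
    and id_hom: "idm C a \<in> hom C a a"
    and comp_hom: "\<lbrakk>f \<in> hom C a b; g \<in> hom C b c\<rbrakk> \<Longrightarrow> g \<cdot> f \<in> hom C a c"
    and comp_assoc: "\<lbrakk>f \<in> hom C a b; g \<in> hom C b c; h \<in> hom C c d\<rbrakk>
        \<Longrightarrow> (h \<cdot> g) \<cdot> f = h \<cdot> (g \<cdot> f)"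
    and id_left: "f \<in> hom C a b \<Longrightarrow> idm C b \<cdot> f = f"
    and id_right: "f \<in> hom C a b \<Longrightarrow> f \<cdot> idm C a = f"
    and comp_add_left: "\<lbrakk>f \<in> hom C a b; g \<in> hom C b c; g' \<in> hom C b c\<rbrakk>
        \<Longrightarrow> (g + g') \<cdot> f = g \<cdot> f + g' \<cdot> f"
    and comp_add_right: "\<lbrakk>f \<in> hom C a b; f' \<in> hom C a b; g \<in> hom C b c\<rbrakk>
        \<Longrightarrow> g \<cdot> (f + f') = g \<cdot> f + g \<cdot> f'"
    and comp_scl_left: "\<lbrakk>f \<in> hom C a b; g \<in> hom C b c\<rbrakk>
        \<Longrightarrow> scl C z g \<cdot> f = scl C z (g \<cdot> f)"
    and comp_scl_right: "\<lbrakk>f \<in> hom C a b; g \<in> hom C b c\<rbrakk>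
        \<Longrightarrow> g \<cdot> scl C z f = scl C z (g \<cdot> f)"
    and dag_hom: "f \<in> hom C a b \<Longrightarrow> dag C f \<in> hom C b a"
    and dag_dag: "f \<in> hom C a b \<Longrightarrow> dag C (dag C f) = f"
    and dag_comp: "\<lbrakk>f \<in> hom C a b; g \<in> hom C b c\<rbrakk>
        \<Longrightarrow> dag C (g \<cdot> f) = dag C f \<cdot> dag C g"
    and dag_add: "\<lbrakk>f \<in> hom C a b; f' \<in> hom C a b\<rbrakk> \<Longrightarrow> dag C (f + f') = dag C f + dag C f'"
    and dag_scl: "f \<in> hom C a b \<Longrightarrow> dag C (scl C z f) = scl C (cnj z) (dag C f)"
    and norm_eq_0: "f \<in> hom C a b \<Longrightarrow> nrm C f = 0 \<longleftrightarrow> f = 0"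
    and norm_triangle: "\<lbrakk>f \<in> hom C a b; f' \<in> hom C a b\<rbrakk> \<Longrightarrow> nrm C (f + f') \<le> nrm C f + nrm C f'"
    and norm_scl: "f \<in> hom C a b \<Longrightarrow> nrm C (scl C z f) = cmod z * nrm C f"
    and norm_comp: "\<lbrakk>f \<in> hom C a b; g \<in> hom C b c\<rbrakk> \<Longrightarrow> nrm C (g \<cdot> f) \<le> nrm C g * nrm C f"
    and norm_cstar: "f \<in> hom C a b \<Longrightarrow> nrm C (dag C f \<cdot> f) = (nrm C f)\<^sup>2"
    and norm_complete: "\<lbrakk>\<And>n. X n \<in> hom C a b;
          \<And>e. e > 0 \<Longrightarrow> \<exists>N. \<forall>m\<ge>N. \<forall>n\<ge>N. nrm C (X m - X n) < e\<rbrakk>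
        \<Longrightarrow> \<exists>L \<in> hom C a b. (\<lambda>n. nrm C (X n - L)) \<longlonglongrightarrow> 0"
    and dag_positive: "f \<in> hom C a b \<Longrightarrow> \<exists>h \<in> hom C a a. dag C f \<cdot> f = dag C h \<cdot> h"

text \<open>
  Associators and unitors are kept explicit.  The existence of a zero object (the empty direct sum)
  is contained in \<open>subobjects\<close>, applied to \<open>p = 0\<close>.
\<close>

locale cstar_tensor_category = cstar_category C
  for C :: "('o, 'm::ab_group_add) tensor_cat" (structure) +
  assumes tmor_hom: "\<lbrakk>f \<in> hom C a b; g \<in> hom C a' b'\<rbrakk> \<Longrightarrow> f \<boxtimes> g \<in> hom C (a \<otimes> a') (b \<otimes> b')"
    and tmor_id: "idm C a \<boxtimes> idm C b = idm C (a \<otimes> b)"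
    and tmor_comp: "\<lbrakk>f \<in> hom C a b; g \<in> hom C b c; f' \<in> hom C a' b'; g' \<in> hom C b' c'\<rbrakk>
        \<Longrightarrow> (g \<cdot> f) \<boxtimes> (g' \<cdot> f') = (g \<boxtimes> g') \<cdot> (f \<boxtimes> f')"
    and tmor_add_left: "\<lbrakk>f \<in> hom C a b; f' \<in> hom C a b; g \<in> hom C a' b'\<rbrakk>
        \<Longrightarrow> (f + f') \<boxtimes> g = f \<boxtimes> g + f' \<boxtimes> g"
    and tmor_add_right: "\<lbrakk>f \<in> hom C a b; g \<in> hom C a' b'; g' \<in> hom C a' b'\<rbrakk>
        \<Longrightarrow> f \<boxtimes> (g + g') = f \<boxtimes> g + f \<boxtimes> g'"
    and tmor_scl_left: "\<lbrakk>f \<in> hom C a b; g \<in> hom C a' b'\<rbrakk>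
        \<Longrightarrow> scl C z f \<boxtimes> g = scl C z (f \<boxtimes> g)"
    and tmor_scl_right: "\<lbrakk>f \<in> hom C a b; g \<in> hom C a' b'\<rbrakk>
        \<Longrightarrow> f \<boxtimes> scl C z g = scl C z (f \<boxtimes> g)"
    and tmor_dag: "\<lbrakk>f \<in> hom C a b; g \<in> hom C a' b'\<rbrakk>
        \<Longrightarrow> dag C (f \<boxtimes> g) = dag C f \<boxtimes> dag C g"
    and assc_unitary: "unitary_mor C ((a \<otimes> b) \<otimes> c) (a \<otimes> (b \<otimes> c)) (assc C a b c)"
    and assc_natural: "\<lbrakk>f \<in> hom C a a'; g \<in> hom C b b'; h \<in> hom C c c'\<rbrakk>
        \<Longrightarrow> assc C a' b' c' \<cdot> ((f \<boxtimes> g) \<boxtimes> h) = (f \<boxtimes> (g \<boxtimes> h)) \<cdot> assc C a b c"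
    and lunit_unitary: "unitary_mor C (unt C \<otimes> a) a (lunit C a)"
    and lunit_natural: "f \<in> hom C a b \<Longrightarrow> lunit C b \<cdot> (idm C (unt C) \<boxtimes> f) = f \<cdot> lunit C a"
    and runit_unitary: "unitary_mor C (a \<otimes> unt C) a (runit C a)"
    and runit_natural: "f \<in> hom C a b \<Longrightarrow> runit C b \<cdot> (f \<boxtimes> idm C (unt C)) = f \<cdot> runit C a"
    and pentagon: "assc C a b (c \<otimes> d) \<cdot> assc C (a \<otimes> b) c d =
        (idm C a \<boxtimes> assc C b c d) \<cdot> assc C a (b \<otimes> c) d \<cdot> (assc C a b c \<boxtimes> idm C d)"
    and triangle: "(idm C a \<boxtimes> lunit C b) \<cdot> assc C a (unt C) b = runit C a \<boxtimes> idm C b"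
    and direct_sums: "\<exists>c. \<exists>u \<in> hom C a c. \<exists>v \<in> hom C b c.
        dag C u \<cdot> u = idm C a \<and> dag C v \<cdot> v = idm C b \<and>
        u \<cdot> dag C u + v \<cdot> dag C v = idm C c"
    and subobjects: "\<lbrakk>p \<in> hom C a a; p \<cdot> p = p; dag C p = p\<rbrakk>
        \<Longrightarrow> \<exists>b. \<exists>v \<in> hom C b a. dag C v \<cdot> v = idm C b \<and> v \<cdot> dag C v = p"
    and unit_simple: "simple_obj C (unt C)"

text \<open>
  The duality maps solve the conjugate equations (with \<open>coev a = dag (evb a)\<close>), and they are
  standard: the left and right traces they define on \<open>End(a)\<close> agree.
\<close>

locale rigid_cstar_tensor_category = cstar_tensor_category C
  for C :: "('o, 'm::ab_group_add) tensor_cat" (structure) +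
  assumes ev_hom: "ev C a \<in> hom C (bar C a \<otimes> a) (unt C)"
    and evb_hom: "evb C a \<in> hom C (a \<otimes> bar C a) (unt C)"
    and conj_eq: "runit C a \<cdot> (idm C a \<boxtimes> ev C a) \<cdot> assc C a (bar C a) a \<cdot>
        (dag C (evb C a) \<boxtimes> idm C a) \<cdot> dag C (lunit C a) = idm C a"
    and conj_eq_bar: "lunit C (bar C a) \<cdot> (ev C a \<boxtimes> idm C (bar C a)) \<cdot>
        dag C (assc C (bar C a) a (bar C a)) \<cdot>
        (idm C (bar C a) \<boxtimes> dag C (evb C a)) \<cdot> dag C (runit C (bar C a)) = idm C (bar C a)"
    and standard: "f \<in> hom C a a \<Longrightarrow>
        ev C a \<cdot> (idm C (bar C a) \<boxtimes> f) \<cdot> dag C (ev C a) =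
        evb C a \<cdot> (f \<boxtimes> idm C (bar C a)) \<cdot> dag C (evb C a)"
    and irr_simple: "a \<in> irr C \<Longrightarrow> simple_obj C a"
    and irr_representatives: "simple_obj C a \<Longrightarrow> \<exists>!b. b \<in> irr C \<and> iso_obj C a b"

definition cat_trace :: "('o, 'm) tensor_cat \<Rightarrow> 'o \<Rightarrow> 'm \<Rightarrow> complex" where
  "cat_trace C a f = (THE z. ev C a \<cdot>\<^bsub>C\<^esub> (idm C (bar C a) \<boxtimes>\<^bsub>C\<^esub> f) \<cdot>\<^bsub>C\<^esub> dag C (ev C a)
     = scl C z (idm C (unt C)))"

definition qdim :: "('o, 'm) tensor_cat \<Rightarrow> 'o \<Rightarrow> complex" where
  "qdim C a = cat_trace C a (idm C a)"

text \<open>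
  Orthonormal for the trace inner product.  The sums over \<open>onb C a c\<close> below do not depend on the
  basis that is chosen.
\<close>

definition is_onb :: "('o, 'm::ab_group_add) tensor_cat \<Rightarrow> 'o \<Rightarrow> 'o \<Rightarrow> 'm set \<Rightarrow> bool" where
  "is_onb C a c B \<longleftrightarrow> finite B \<and> B \<subseteq> hom C a c \<and> module.span (scl C) B = hom C a c \<and>
     (\<forall>\<psi> \<in> B. \<forall>\<phi> \<in> B. cat_trace C a (dag C \<psi> \<cdot>\<^bsub>C\<^esub> \<phi>) = (if \<psi> = \<phi> then 1 else 0))"

definition onb :: "('o, 'm::ab_group_add) tensor_cat \<Rightarrow> 'o \<Rightarrow> 'o \<Rightarrow> 'm set" where
  "onb C a c = (SOME B. is_onb C a c B)"

section \<open>Finite dimensional Hilbert spaces\<close>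

text \<open>
  A Hilbert space is a subspace \<open>hcar H\<close> of a complex vector space \<open>'v\<close>, with an inner product
  that is linear in the second argument.  Linear maps out of \<open>H\<close> are normalised to be \<open>0\<close>
  outside \<open>hcar H\<close>, so that they are determined by their restrictions and compose with \<open>\<circ>\<close>.
\<close>

record 'v hilb =
  hcar :: "'v set"
  hsc :: "complex \<Rightarrow> 'v \<Rightarrow> 'v"
  hip :: "'v \<Rightarrow> 'v \<Rightarrow> complex"

locale fd_hilbert_space = vector_space "hsc H"
  for H :: "'v::ab_group_add hilb" +
  assumes carrier_subspace: "subspace (hcar H)"
    and finite_dim: "\<exists>B. finite B \<and> span B = hcar H"
    and ip_add: "\<lbrakk>x \<in> hcar H; y \<in> hcar H; z \<in> hcar H\<rbrakk> \<Longrightarrow> hip H x (y + z) = hip H x y + hip H x z"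
    and ip_scale: "\<lbrakk>x \<in> hcar H; y \<in> hcar H\<rbrakk> \<Longrightarrow> hip H x (hsc H c y) = c * hip H x y"
    and ip_cnj: "\<lbrakk>x \<in> hcar H; y \<in> hcar H\<rbrakk> \<Longrightarrow> hip H y x = cnj (hip H x y)"
    and ip_pos: "\<lbrakk>x \<in> hcar H; x \<noteq> 0\<rbrakk> \<Longrightarrow> Re (hip H x x) > 0"

definition lin_on :: "'v::ab_group_add hilb \<Rightarrow> (complex \<Rightarrow> 'w \<Rightarrow> 'w) \<Rightarrow> ('v \<Rightarrow> 'w::ab_group_add) \<Rightarrow> bool"
  where "lin_on H s h \<longleftrightarrow>
    (\<forall>x \<in> hcar H. \<forall>y \<in> hcar H. h (x + y) = h x + h y) \<and>
    (\<forall>c. \<forall>x \<in> hcar H. h (hsc H c x) = s c (h x)) \<and>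
    (\<forall>x. x \<notin> hcar H \<longrightarrow> h x = 0)"

definition hhom :: "'v::ab_group_add hilb \<Rightarrow> 'w::ab_group_add hilb \<Rightarrow> ('v \<Rightarrow> 'w) set" where
  "hhom H K = {h. lin_on H (hsc K) h \<and> h ` hcar H \<subseteq> hcar K}"

definition hid :: "'v::zero hilb \<Rightarrow> 'v \<Rightarrow> 'v" where
  "hid H = (\<lambda>x. if x \<in> hcar H then x else 0)"

definition hadj :: "'v::ab_group_add hilb \<Rightarrow> 'w::ab_group_add hilb \<Rightarrow> ('v \<Rightarrow> 'w) \<Rightarrow> 'w \<Rightarrow> 'v" where
  "hadj H K f = (THE g. g \<in> hhom K H \<and>
     (\<forall>x \<in> hcar H. \<forall>y \<in> hcar K. hip K (f x) y = hip H x (g y)))"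

definition hunitary :: "'v::ab_group_add hilb \<Rightarrow> 'w::ab_group_add hilb \<Rightarrow> ('v \<Rightarrow> 'w) \<Rightarrow> bool" where
  "hunitary H K u \<longleftrightarrow> u \<in> hhom H K \<and> hadj H K u \<circ> u = hid H \<and> u \<circ> hadj H K u = hid K"

definition hbasis :: "'v::ab_group_add hilb \<Rightarrow> 'v set" where
  "hbasis H = (SOME B. finite B \<and> B \<subseteq> hcar H \<and> module.span (hsc H) B = hcar H \<and>
     (\<forall>e \<in> B. \<forall>f \<in> B. hip H e f = (if e = f then 1 else 0)))"

definition hcomplex :: "complex hilb" where
  "hcomplex = \<lparr>hcar = UNIV, hsc = (*), hip = (\<lambda>x y. cnj x * y)\<rparr>"

definition hdual :: "'v::ab_group_add hilb \<Rightarrow> ('v \<Rightarrow> complex) hilb" where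
  "hdual H = \<lparr>hcar = hhom H hcomplex, hsc = (\<lambda>c f v. c * f v),
     hip = (\<lambda>f g. \<Sum>e \<in> hbasis H. cnj (f e) * g e)\<rparr>"

text \<open>The adjoints of a vector \<open>x\<close> (as a map from the scalars to \<open>H\<close>) and of a functional on \<open>H\<close>.\<close>

definition bra :: "'v hilb \<Rightarrow> 'v \<Rightarrow> 'v \<Rightarrow> complex" where
  "bra H x = (\<lambda>v. if v \<in> hcar H then hip H x v else 0)"

definition ket :: "'v::ab_group_add hilb \<Rightarrow> ('v \<Rightarrow> complex) \<Rightarrow> 'v" where
  "ket H f = hadj H hcomplex f 1"

text \<open>
  The Hilbert space tensor product, realised inside the space of functions of two vector arguments:
  \<open>x \<otimes> y\<close> is \<open>(v, w) \<mapsto> \<langle>v|x\<rangle> \<langle>w|y\<rangle>\<close>.  The inner product below is the one with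
  \<open>\<langle>x \<otimes> y|x' \<otimes> y'\<rangle> = \<langle>x|x'\<rangle> \<langle>y|y'\<rangle>\<close>; it does not depend on the chosen bases.
\<close>

definition tens :: "'v hilb \<Rightarrow> 'w hilb \<Rightarrow> 'v \<Rightarrow> 'w \<Rightarrow> 'v \<Rightarrow> 'w \<Rightarrow> complex" where
  "tens H K x y = (\<lambda>v w. if v \<in> hcar H \<and> w \<in> hcar K then hip H v x * hip K w y else 0)"

definition htens :: "'v::ab_group_add hilb \<Rightarrow> 'w::ab_group_add hilb \<Rightarrow> ('v \<Rightarrow> 'w \<Rightarrow> complex) hilb" where
  "htens H K = \<lparr>
     hcar = module.span (\<lambda>c T v w. c * T v w) {tens H K x y | x y. x \<in> hcar H \<and> y \<in> hcar K},
     hsc = (\<lambda>c T v w. c * T v w),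
     hip = (\<lambda>S T. \<Sum>e \<in> hbasis H. \<Sum>f \<in> hbasis K. cnj (S e f) * T e f)\<rparr>"

text \<open>
  The linear map on \<open>H \<otimes> K\<close>, into a vector space with scalar multiplication \<open>s\<close>, that is
  given on elementary tensors by the bilinear map \<open>\<beta>\<close>.
\<close>

definition tens_ext :: "(complex \<Rightarrow> 'u \<Rightarrow> 'u) \<Rightarrow> 'v::ab_group_add hilb \<Rightarrow> 'w::ab_group_add hilb \<Rightarrow>
    ('v \<Rightarrow> 'w \<Rightarrow> 'u::ab_group_add) \<Rightarrow> ('v \<Rightarrow> 'w \<Rightarrow> complex) \<Rightarrow> 'u" where
  "tens_ext s H K \<beta> = (THE h. lin_on (htens H K) s h \<and>
     (\<forall>x \<in> hcar H. \<forall>y \<in> hcar K. h (tens H K x y) = \<beta> x y))"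

section \<open>Dagger tensor functors to finite dimensional Hilbert spaces\<close>

text \<open>
  \<open>feta F a b : F(a) \<otimes> F(b) \<rightarrow> F(a \<otimes> b)\<close> is the tensorator and
  \<open>fone F : F(1) \<rightarrow> \<complex>\<close> the identification of \<open>F(1)\<close> with the scalars.
\<close>

record ('o, 'm, 'v) hfunctor =
  fob :: "'o \<Rightarrow> 'v hilb"
  fmor :: "'m \<Rightarrow> 'v \<Rightarrow> 'v"
  feta :: "'o \<Rightarrow> 'o \<Rightarrow> ('v \<Rightarrow> 'v \<Rightarrow> complex) \<Rightarrow> 'v"
  fone :: "'v \<Rightarrow> complex"

locale dagger_tensor_functor = rigid_cstar_tensor_category C
  for C :: "('o, 'm::ab_group_add) tensor_cat" (structure)
    and F :: "('o, 'm, 'v::ab_group_add) hfunctor" +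
  assumes fob_hilbert: "fd_hilbert_space (fob F a)"
    and fmor_hom: "f \<in> hom C a b \<Longrightarrow> fmor F f \<in> hhom (fob F a) (fob F b)"
    and fmor_id: "fmor F (idm C a) = hid (fob F a)"
    and fmor_comp: "\<lbrakk>f \<in> hom C a b; g \<in> hom C b c\<rbrakk> \<Longrightarrow> fmor F (g \<cdot> f) = fmor F g \<circ> fmor F f"
    and fmor_add: "\<lbrakk>f \<in> hom C a b; g \<in> hom C a b; x \<in> hcar (fob F a)\<rbrakk>
        \<Longrightarrow> fmor F (f + g) x = fmor F f x + fmor F g x"
    and fmor_scl: "\<lbrakk>f \<in> hom C a b; x \<in> hcar (fob F a)\<rbrakk>
        \<Longrightarrow> fmor F (scl C z f) x = hsc (fob F b) z (fmor F f x)"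
    and fmor_dag: "f \<in> hom C a b \<Longrightarrow> fmor F (dag C f) = hadj (fob F a) (fob F b) (fmor F f)"
    and eta_unitary: "hunitary (htens (fob F a) (fob F b)) (fob F (a \<otimes> b)) (feta F a b)"
    and eta_natural: "\<lbrakk>f \<in> hom C a a'; g \<in> hom C b b'; x \<in> hcar (fob F a); y \<in> hcar (fob F b)\<rbrakk>
        \<Longrightarrow> fmor F (f \<boxtimes> g) (feta F a b (tens (fob F a) (fob F b) x y)) =
            feta F a' b' (tens (fob F a') (fob F b') (fmor F f x) (fmor F g y))"
    and eta_assoc: "\<lbrakk>x \<in> hcar (fob F a); y \<in> hcar (fob F b); w \<in> hcar (fob F c)\<rbrakk>
        \<Longrightarrow> fmor F (assc C a b c) (feta F (a \<otimes> b) c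
              (tens (fob F (a \<otimes> b)) (fob F c) (feta F a b (tens (fob F a) (fob F b) x y)) w)) =
            feta F a (b \<otimes> c)
              (tens (fob F a) (fob F (b \<otimes> c)) x (feta F b c (tens (fob F b) (fob F c) y w)))"
    and one_unitary: "hunitary (fob F (unt C)) hcomplex (fone F)"
    and eta_lunit: "\<lbrakk>u \<in> hcar (fob F (unt C)); x \<in> hcar (fob F a)\<rbrakk>
        \<Longrightarrow> fmor F (lunit C a) (feta F (unt C) a (tens (fob F (unt C)) (fob F a) u x)) =
            hsc (fob F a) (fone F u) x"
    and eta_runit: "\<lbrakk>u \<in> hcar (fob F (unt C)); x \<in> hcar (fob F a)\<rbrakk>
        \<Longrightarrow> fmor F (runit C a) (feta F a (unt C) (tens (fob F a) (fob F (unt C)) x u)) =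
            hsc (fob F a) (fone F u) x"

definition hat :: "('o, 'm, 'v) hfunctor \<Rightarrow> 'o \<Rightarrow> 'o \<Rightarrow> 'm \<Rightarrow> ('v \<Rightarrow> 'v \<Rightarrow> complex) \<Rightarrow> 'v" where
  "hat F a b \<alpha> = fmor F \<alpha> \<circ> feta F a b"

definition ev_hat :: "('o, 'm) tensor_cat \<Rightarrow> ('o, 'm, 'v) hfunctor \<Rightarrow> 'o \<Rightarrow> ('v \<Rightarrow> 'v \<Rightarrow> complex) \<Rightarrow> complex" where
  "ev_hat C F a = fone F \<circ> hat F (bar C a) a (ev C a)"

definition evb_hat :: "('o, 'm) tensor_cat \<Rightarrow> ('o, 'm, 'v) hfunctor \<Rightarrow> 'o \<Rightarrow> ('v \<Rightarrow> 'v \<Rightarrow> complex) \<Rightarrow> complex" where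
  "evb_hat C F a = fone F \<circ> hat F a (bar C a) (evb C a)"

section \<open>The Hopf *-algebra\<close>

text \<open>
  \<open>H_a\<close> is identified with \<open>F(a)\<close>.  An element of the algebra is a finitely supported family of
  tensors in \<open>H_a\<^sup>* \<otimes> H_a\<close>, indexed by the objects and supported in \<open>irr C\<close>.
\<close>

type_synonym 'v dtens = "('v \<Rightarrow> complex) \<Rightarrow> 'v \<Rightarrow> complex"

definition dtens :: "'v::ab_group_add hilb \<Rightarrow> ('v \<Rightarrow> complex) \<Rightarrow> 'v \<Rightarrow> 'v dtens" where
  "dtens H = tens (hdual H) H"

definition dual_tens :: "'v::ab_group_add hilb \<Rightarrow> 'v dtens hilb" where
  "dual_tens H = htens (hdual H) H"

definition dtens_scale :: "complex \<Rightarrow> 'v dtens \<Rightarrow> 'v dtens" where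
  "dtens_scale c T = (\<lambda>f v. c * T f v)"

definition cg_scale :: "complex \<Rightarrow> ('o \<Rightarrow> 'v dtens) \<Rightarrow> 'o \<Rightarrow> 'v dtens" where
  "cg_scale c X = (\<lambda>a. dtens_scale c (X a))"

definition cg_support :: "('o \<Rightarrow> 'v dtens) \<Rightarrow> 'o set" where
  "cg_support X = {a. X a \<noteq> 0}"

definition cg_carrier :: "('o, 'm) tensor_cat \<Rightarrow> ('o, 'm, 'v::ab_group_add) hfunctor \<Rightarrow> ('o \<Rightarrow> 'v dtens) set" where
  "cg_carrier C F = {X. finite (cg_support X) \<and> cg_support X \<subseteq> irr C \<and>
     (\<forall>a. X a \<in> hcar (dual_tens (fob F a)))}"

text \<open>
  The conjugate of an element of \<open>irr C\<close> need not itself be in \<open>irr C\<close>, and neither need the unit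
  object.  For an arbitrary object \<open>c\<close>, a tensor \<open>f \<otimes> v\<close> with \<open>f \<in> H_c\<^sup>*\<close>, \<open>v \<in> H_c\<close> is read as an
  element of the algebra by decomposing \<open>c\<close> into simple objects exactly as in the
  multiplication formula.  If \<open>c \<in> irr C\<close> this is \<open>f \<otimes> v\<close> in the summand of \<open>c\<close>.
\<close>

definition cg_elem :: "('o, 'm::ab_group_add) tensor_cat \<Rightarrow> ('o, 'm, 'v::ab_group_add) hfunctor \<Rightarrow>
    'o \<Rightarrow> ('v \<Rightarrow> complex) \<Rightarrow> 'v \<Rightarrow> 'o \<Rightarrow> 'v dtens" where
  "cg_elem C F c f v = (\<lambda>b. if b \<in> irr C then
     \<Sum>\<alpha> \<in> onb C c b. dtens_scale (qdim C b)
       (dtens (fob F b) (f \<circ> hadj (fob F c) (fob F b) (fmor F \<alpha>)) (fmor F \<alpha> v)) else 0)"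

definition cg_one :: "('o, 'm::ab_group_add) tensor_cat \<Rightarrow> ('o, 'm, 'v::ab_group_add) hfunctor \<Rightarrow>
    'o \<Rightarrow> 'v dtens" where
  "cg_one C F = cg_elem C F (unt C) (fone F) (hadj (fob F (unt C)) hcomplex (fone F) 1)"

definition cg_mult_elem :: "('o, 'm::ab_group_add) tensor_cat \<Rightarrow> ('o, 'm, 'v::ab_group_add) hfunctor \<Rightarrow>
    'o \<Rightarrow> 'o \<Rightarrow> ('v \<Rightarrow> complex) \<Rightarrow> 'v \<Rightarrow> ('v \<Rightarrow> complex) \<Rightarrow> 'v \<Rightarrow> 'o \<Rightarrow> 'v dtens" where
  "cg_mult_elem C F a b x1 x2 y1 y2 = (let A = fob F a; B = fob F b in
     (\<lambda>c. if c \<in> irr C then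
       \<Sum>\<alpha> \<in> onb C (a \<otimes>\<^bsub>C\<^esub> b) c. dtens_scale (qdim C c)
         (dtens (fob F c)
           (tens_ext (*) A B (\<lambda>v w. x1 v * y1 w) \<circ> hadj (htens A B) (fob F c) (hat F a b \<alpha>))
           (hat F a b \<alpha> (tens A B x2 y2)))
      else 0))"

definition cg_mult :: "('o, 'm::ab_group_add) tensor_cat \<Rightarrow> ('o, 'm, 'v::ab_group_add) hfunctor \<Rightarrow>
    ('o \<Rightarrow> 'v dtens) \<Rightarrow> ('o \<Rightarrow> 'v dtens) \<Rightarrow> 'o \<Rightarrow> 'v dtens" where
  "cg_mult C F X Y = (\<Sum>a \<in> cg_support X. \<Sum>b \<in> cg_support Y.
     tens_ext cg_scale (hdual (fob F a)) (fob F a) (\<lambda>x1 x2.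
       tens_ext cg_scale (hdual (fob F b)) (fob F b) (\<lambda>y1 y2.
         cg_mult_elem C F a b x1 x2 y1 y2) (Y b)) (X a))"

definition cg_antipode_elem :: "('o, 'm::ab_group_add) tensor_cat \<Rightarrow> ('o, 'm, 'v::ab_group_add) hfunctor \<Rightarrow>
    'o \<Rightarrow> ('v \<Rightarrow> complex) \<Rightarrow> 'v \<Rightarrow> 'o \<Rightarrow> 'v dtens" where
  "cg_antipode_elem C F a x1 x2 = (let A = fob F a; A' = fob F (bar C a) in
     cg_elem C F (bar C a)
       (\<lambda>v. if v \<in> hcar A' then ev_hat C F a (tens A' A v x2) else 0)
       (tens_ext (hsc A') A A' (\<lambda>v w. hsc A' (x1 v) w)
         (hadj (htens A A') hcomplex (evb_hat C F a) 1)))"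

definition cg_antipode :: "('o, 'm::ab_group_add) tensor_cat \<Rightarrow> ('o, 'm, 'v::ab_group_add) hfunctor \<Rightarrow>
    ('o \<Rightarrow> 'v dtens) \<Rightarrow> 'o \<Rightarrow> 'v dtens" where
  "cg_antipode C F X = (\<Sum>a \<in> cg_support X.
     tens_ext cg_scale (hdual (fob F a)) (fob F a) (cg_antipode_elem C F a) (X a))"

text \<open>\<open>cg_j\<close> is antilinear, hence the conjugated scalar multiplication.\<close>

definition cg_j :: "('o, 'm, 'v::ab_group_add) hfunctor \<Rightarrow> ('o \<Rightarrow> 'v dtens) \<Rightarrow> 'o \<Rightarrow> 'v dtens" where
  "cg_j F X = (\<lambda>a. tens_ext (\<lambda>c. dtens_scale (cnj c)) (hdual (fob F a)) (fob F a)
     (\<lambda>x1 x2. dtens (fob F a) (bra (fob F a) x2) (ket (fob F a) x1)) (X a))"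

definition cg_star :: "('o, 'm::ab_group_add) tensor_cat \<Rightarrow> ('o, 'm, 'v::ab_group_add) hfunctor \<Rightarrow>
    ('o \<Rightarrow> 'v dtens) \<Rightarrow> 'o \<Rightarrow> 'v dtens" where
  "cg_star C F X = cg_antipode C F (cg_j F X)"

definition cg_state :: "('o, 'm::ab_group_add) tensor_cat \<Rightarrow> ('o, 'm, 'v::ab_group_add) hfunctor \<Rightarrow>
    (('o \<Rightarrow> 'v dtens) \<Rightarrow> complex) \<Rightarrow> bool" where
  "cg_state C F \<phi> \<longleftrightarrow>
     (\<forall>X \<in> cg_carrier C F. \<forall>Y \<in> cg_carrier C F. \<phi> (X + Y) = \<phi> X + \<phi> Y) \<and>
     (\<forall>c. \<forall>X \<in> cg_carrier C F. \<phi> (cg_scale c X) = c * \<phi> X) \<and>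
     \<phi> (cg_one C F) = 1 \<and>
     (\<forall>X \<in> cg_carrier C F. Im (\<phi> (cg_mult C F (cg_star C F X) X)) = 0 \<and>
                            Re (\<phi> (cg_mult C F (cg_star C F X) X)) \<ge> 0)"

section \<open>The algebra object\<close>

definition gob :: "('o, 'm, 'v::ab_group_add) hfunctor \<Rightarrow> 'o \<Rightarrow> ('v \<Rightarrow> complex) hilb" where
  "gob F a = hdual (fob F a)"

definition gj :: "('o, 'm) tensor_cat \<Rightarrow> ('o, 'm, 'v::ab_group_add) hfunctor \<Rightarrow> 'o \<Rightarrow> ('v \<Rightarrow> complex) \<Rightarrow> 'v \<Rightarrow> complex" where
  "gj C F a f = (\<lambda>v. if v \<in> hcar (fob F (bar C a))
     then ev_hat C F a (tens (fob F (bar C a)) (fob F a) v (ket (fob F a) f)) else 0)"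

text \<open>
  A natural transformation of the contravariant functor \<open>a \<mapsto> G(a)\<close>, which sends
  \<open>f : a \<rightarrow> b\<close> to precomposition with \<open>F(f)\<close>.
\<close>

definition nat_trans :: "('o, 'm) tensor_cat \<Rightarrow> ('o, 'm, 'v::ab_group_add) hfunctor \<Rightarrow>
    ('o \<Rightarrow> ('v \<Rightarrow> complex) \<Rightarrow> ('v \<Rightarrow> complex)) \<Rightarrow> bool" where
  "nat_trans C F \<Phi> \<longleftrightarrow> (\<forall>a. \<Phi> a \<in> hhom (gob F a) (gob F a)) \<and>
     (\<forall>a b. \<forall>f \<in> hom C a b. \<forall>x \<in> hcar (gob F b). \<Phi> a (x \<circ> fmor F f) = \<Phi> b x \<circ> fmor F f)"

text \<open>
  The identification of \<open>B(F(c))\<close> with \<open>G(bar c \<otimes> c)\<close>,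
  \<open>f \<mapsto> ev_hat c \<circ> (id \<otimes> f) \<circ> \<eta>\<inverse>\<close>; the unitary \<open>\<eta>\<close> is inverted by its adjoint.
\<close>

definition g_of_op :: "('o, 'm) tensor_cat \<Rightarrow> ('o, 'm, 'v::ab_group_add) hfunctor \<Rightarrow>
    'o \<Rightarrow> ('v \<Rightarrow> 'v) \<Rightarrow> ('v \<Rightarrow> complex)" where
  "g_of_op C F c f = (let A = fob F c; A' = fob F (bar C c) in
     ev_hat C F c \<circ> tens_ext (hsc (htens A' A)) A' A (\<lambda>v w. tens A' A v (f w)) \<circ>
     hadj (htens A' A) (fob F (bar C c \<otimes>\<^bsub>C\<^esub> c)) (feta F (bar C c) c))"

definition positive_ops :: "'v::ab_group_add hilb \<Rightarrow> ('v \<Rightarrow> 'v) set" where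
  "positive_ops H = {hadj H H g \<circ> g | g. g \<in> hhom H H}"

definition ucp :: "('o, 'm) tensor_cat \<Rightarrow> ('o, 'm, 'v::ab_group_add) hfunctor \<Rightarrow>
    ('o \<Rightarrow> ('v \<Rightarrow> complex) \<Rightarrow> ('v \<Rightarrow> complex)) \<Rightarrow> bool" where
  "ucp C F \<Phi> \<longleftrightarrow>
     (\<forall>a. \<forall>f \<in> hcar (gob F a). \<Phi> (bar C a) (gj C F a f) = gj C F a (\<Phi> a f)) \<and>
     \<Phi> (unt C) (fone F) = fone F \<and>
     (\<forall>c. \<Phi> (bar C c \<otimes>\<^bsub>C\<^esub> c) ` (g_of_op C F c ` positive_ops (fob F c))
            \<subseteq> g_of_op C F c ` positive_ops (fob F c))"

section \<open>The correspondence\<close>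

definition corr_op :: "('o, 'm, 'v::ab_group_add) hfunctor \<Rightarrow>
    ('o \<Rightarrow> ('v \<Rightarrow> complex) \<Rightarrow> ('v \<Rightarrow> complex)) \<Rightarrow> 'o \<Rightarrow> 'v \<Rightarrow> 'v" where
  "corr_op F \<Phi> a = (THE T. T \<in> hhom (fob F a) (fob F a) \<and> (\<forall>x \<in> hcar (gob F a). \<Phi> a x = x \<circ> T))"

definition corr_functional :: "('o, 'm, 'v::ab_group_add) hfunctor \<Rightarrow>
    ('o \<Rightarrow> ('v \<Rightarrow> complex) \<Rightarrow> ('v \<Rightarrow> complex)) \<Rightarrow> ('o \<Rightarrow> 'v dtens) \<Rightarrow> complex" where
  "corr_functional F \<Phi> X = (\<Sum>a \<in> cg_support X.
     tens_ext (*) (hdual (fob F a)) (fob F a) (\<lambda>x1 x2. x1 (corr_op F \<Phi> a x2)) (X a))"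

end

theory Submission
  imports Defs "HOL-Computational_Algebra.Fundamental_Theorem_Algebra"
begin

text \<open>
  Write \<open>T\<^sub>a\<close> for the operators of \<open>\<Phi>\<close>, so that \<open>\<Phi>\<^sub>a(x) = x \<circ> T\<^sub>a\<close>; naturality of \<open>\<Phi>\<close> says that
  \<open>F(u) T\<^sub>a = T\<^sub>b F(u)\<close> for \<open>u : a \<rightarrow> b\<close>.  The equivalence rests on a single family of numbers,
  attached to a functional \<open>f\<close> and a vector \<open>v\<close> of \<open>F(c)\<close>, for an arbitrary object \<open>c\<close>:
  \<open>D\<^sub>c(f, v) = (j\<^sub>c(f) \<otimes> f) (\<eta>\<inverse> T \<eta> (v\<^sup>\<sharp> \<otimes> v))\<close>  with  \<open>T = T\<^sub>b\<close>  for  \<open>b = bar c \<otimes> c\<close>,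
  where \<open>v\<^sup>\<sharp> \<in> F(bar c)\<close> is the vector with \<open>ev\<^sub>c(v\<^sup>\<sharp> \<otimes> w) = \<langle>v|w\<rangle>\<close>.

  On the side of the algebra, \<open>D\<^sub>c(f, v) = \<phi>(X\<^sup># X)\<close> when \<open>X\<close> is the matrix coefficient \<open>f \<otimes> v\<close> of \<open>c\<close>
  (lemma \<open>cg_ext_star_mult\<close>).  These \<open>X\<close> are all elements of the algebra: the category has direct sums,
  and a sum of coefficients of \<open>a\<close> and \<open>b\<close> is a coefficient of \<open>a \<oplus> b\<close> (lemma \<open>single_coefficient\<close>).
  On the side of the algebra object, \<open>D\<^sub>c(f, v)\<close> is the value at \<open>v\<close> of the quadratic form of the
  operator to which \<open>\<Phi>\<close> sends the rank one operator \<open>|f\<^sup>*\<rangle>f\<close> on \<open>F(c)\<close>; positive operators are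
  sums of such operators (lemma \<open>preserves_positive_iff\<close>).  So positivity of \<open>\<phi>\<close> and preservation of
  positive elements by \<open>\<Phi>\<close> at all objects both say that all \<open>D\<^sub>c(f, v)\<close> are nonnegative.  The passage
  to direct sums is what makes positivity at all objects as strong as complete positivity.

  The normalisations correspond because \<open>F(1)\<close> is one dimensional.  That \<open>\<Phi>\<close> commutes with \<open>j\<close> follows
  from positivity: a positive sesquilinear form is hermitian, so \<open>\<phi>(X\<^sup>#)\<close> is the conjugate of
  \<open>\<phi>(X)\<close> (lemma \<open>commutes_with_gj\<close>).

  To evaluate \<open>\<phi>\<close> on products and adjoints one has to know that the matrix coefficients of an arbitrary
  object, which the definitions decompose along orthonormal bases of morphisms into simple objects,
  behave naturally.  This comes down to \<open>\<Sum>\<^sub>b d\<^sub>b \<Sum>\<^sub>\<alpha> \<alpha>\<^sup>* \<alpha> = id\<^sub>c\<close> (lemma \<open>onb_complete\<close>), and it needs two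
  facts about the category.  It is semisimple (lemma \<open>identity_factors\<close>), because \<open>F\<close> embeds its
  morphism spaces faithfully into finite dimensional matrix spaces.  And the categorical trace is
  tracial (lemma \<open>trace_commute\<close>), which is derived from the equality of the left and the right trace.
\<close>

section \<open>Finite dimensional Hilbert spaces\<close>

lemma sum_fun_apply: "(\<Sum>i\<in>I. f i) x = (\<Sum>i\<in>I. f i x)"
  by (induction I rule: infinite_finite_induct) auto

lemma (in vector_space) finite_span_if_separated:
  assumes "finite I" "subspace V"
    and "\<And>i x y. i \<in> I \<Longrightarrow> x \<in> V \<Longrightarrow> y \<in> V \<Longrightarrow> \<phi> i (x + y) = \<phi> i x + (\<phi> i y :: 'a)"
    and "\<And>i c x. i \<in> I \<Longrightarrow> x \<in> V \<Longrightarrow> \<phi> i (scale c x) = c * \<phi> i x"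
    and "\<And>x. x \<in> V \<Longrightarrow> (\<And>i. i \<in> I \<Longrightarrow> \<phi> i x = 0) \<Longrightarrow> x = 0"
  shows "\<exists>B. finite B \<and> span B = V"
  using assms
proof (induction I arbitrary: V rule: finite_induct)
  case empty
  then have "V = {0}" using subspace_0[of V] by auto
  then show ?case by (intro exI[of _ "{}"]) simp
next
  case (insert i I)
  note lin = insert.prems(2,3)[of i, OF insertI1]
  let ?V = "{x \<in> V. \<phi> i x = 0}"
  have sub: "subspace ?V"
  proof (rule subspaceI)
    show "0 \<in> ?V" using lin(2)[of 0 0] subspace_0[OF insert.prems(1)] by simp
  qed (use insert.prems(1) lin in \<open>auto intro: subspace_add subspace_scale\<close>)
  have "\<exists>B. finite B \<and> span B = ?V"
  proof (rule insert.IH[OF sub])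
    show "x = 0" if "x \<in> ?V" "\<And>j. j \<in> I \<Longrightarrow> \<phi> j x = 0" for x
      using insert.prems(4)[of x] that by auto
  qed (use insert.prems(2,3) in auto)
  then obtain B where B: "finite B" "span B = ?V" by auto
  show ?case
  proof (cases "?V = V")
    case True then show ?thesis using B by auto
  next
    case False
    then obtain x0 where x0: "x0 \<in> V" "\<phi> i x0 \<noteq> 0" by auto
    have "x \<in> span (insert x0 B)" if "x \<in> V" for x
    proof -
      let ?c = "\<phi> i x / \<phi> i x0"
      have d: "x - scale ?c x0 \<in> V" "scale ?c x0 \<in> V"
        using that x0 insert.prems(1) by (auto intro: subspace_diff subspace_scale)
      have "\<phi> i (x - scale ?c x0 + scale ?c x0) = \<phi> i (x - scale ?c x0) + \<phi> i (scale ?c x0)"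
        by (rule lin(1)) (use d in auto)
      then have "\<phi> i (x - scale ?c x0) = 0" using lin(2)[of x0 ?c] x0 by simp
      then have "x - scale ?c x0 \<in> span B" using d B by simp
      then show ?thesis by (auto simp: span_insert)
    qed
    moreover have "span (insert x0 B) \<subseteq> V"
      using B x0 span_superset[of B] insert.prems(1) by (intro span_minimal) auto
    ultimately show ?thesis using B by (intro exI[of _ "insert x0 B"]) auto
  qed
qed

context fd_hilbert_space
begin

lemmas carr_0 [simp, intro] = subspace_0[OF carrier_subspace]
lemmas carr_add [simp, intro] = subspace_add[OF carrier_subspace]
lemmas carr_scale [simp, intro] = subspace_scale[OF carrier_subspace]
lemmas carr_diff [simp, intro] = subspace_diff[OF carrier_subspace]
lemmas carr_sum [intro] = subspace_sum[OF carrier_subspace]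

lemma ip_add_left:
  assumes "x \<in> hcar H" "y \<in> hcar H" "z \<in> hcar H"
  shows "hip H (x + y) z = hip H x z + hip H y z"
  using assms ip_cnj[of z "x + y"] ip_cnj[of z x] ip_cnj[of z y] by (simp add: ip_add)

lemma ip_scale_left:
  assumes "x \<in> hcar H" "z \<in> hcar H"
  shows "hip H (hsc H c x) z = cnj c * hip H x z"
  using assms ip_cnj[of z "hsc H c x"] ip_cnj[of z x] by (simp add: ip_scale)

lemma ip_0 [simp]: "x \<in> hcar H \<Longrightarrow> hip H x 0 = 0" "x \<in> hcar H \<Longrightarrow> hip H 0 x = 0"
  using ip_scale[of x 0 0] ip_scale_left[of 0 x 0] by auto

lemma ip_diff:
  assumes "x \<in> hcar H" "y \<in> hcar H" "z \<in> hcar H"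
  shows "hip H x (y - z) = hip H x y - hip H x z"
  using ip_add[of x "y - z" z] assms by simp

lemma ip_diff_left:
  assumes "x \<in> hcar H" "y \<in> hcar H" "z \<in> hcar H"
  shows "hip H (x - y) z = hip H x z - hip H y z"
  using ip_add_left[of "x - y" y z] assms by simp

lemma ip_sum:
  assumes "x \<in> hcar H" "\<And>i. i \<in> I \<Longrightarrow> g i \<in> hcar H"
  shows "hip H x (\<Sum>i\<in>I. g i) = (\<Sum>i\<in>I. hip H x (g i))"
  using assms(2)
proof (induction I rule: infinite_finite_induct)
  case (insert i I)
  then show ?case using assms(1) by (simp add: ip_add carr_sum)
qed (use assms in auto)

lemma ip_sum_left:
  assumes "x \<in> hcar H" "\<And>i. i \<in> I \<Longrightarrow> g i \<in> hcar H"
  shows "hip H (\<Sum>i\<in>I. g i) x = (\<Sum>i\<in>I. hip H (g i) x)"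
  using assms(2)
proof (induction I rule: infinite_finite_induct)
  case (insert i I)
  then show ?case using assms(1) by (simp add: ip_add_left carr_sum)
qed (use assms in auto)

lemma ip_self_real: "x \<in> hcar H \<Longrightarrow> hip H x x = of_real (Re (hip H x x))"
  using ip_cnj[of x x] by (simp add: complex_eq_iff)

lemma ip_self_nonneg: "x \<in> hcar H \<Longrightarrow> Re (hip H x x) \<ge> 0"
  using ip_pos[of x] by (cases "x = 0") auto

lemma ip_self_0: "x \<in> hcar H \<Longrightarrow> hip H x x = 0 \<Longrightarrow> x = 0"
  using ip_pos[of x] by force

lemma ip_ext:
  assumes "x \<in> hcar H" "y \<in> hcar H" "\<And>z. z \<in> hcar H \<Longrightarrow> hip H z x = hip H z y"
  shows "x = y"
  using ip_self_0[of "x - y"] assms by (simp add: ip_diff)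

lemma gram_schmidt:
  assumes "finite B" "B \<subseteq> hcar H"
  shows "\<exists>E. finite E \<and> E \<subseteq> hcar H \<and> span E = span B \<and>
    (\<forall>e\<in>E. \<forall>f\<in>E. hip H e f = (if e = f then 1 else 0))"
  using assms
proof (induction B rule: finite_induct)
  case (insert x B)
  then obtain E where E: "finite E" "E \<subseteq> hcar H" "span E = span B"
    and orth: "\<And>e f. e \<in> E \<Longrightarrow> f \<in> E \<Longrightarrow> hip H e f = (if e = f then 1 else 0)"
    by auto
  have x: "x \<in> hcar H" using insert by auto
  define p where "p = (\<Sum>e\<in>E. hsc H (hip H e x) e)"
  define y where "y = x - p"
  have pE: "p \<in> span E" unfolding p_def by (intro span_sum span_scale span_base)
  have p: "p \<in> hcar H" unfolding p_def using E by (intro carr_sum carr_scale) auto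
  have y: "y \<in> hcar H" unfolding y_def using x p by auto
  have ip_y: "hip H e y = 0" if "e \<in> E" for e
  proof -
    have "hip H e p = (\<Sum>f\<in>E. hip H f x * hip H e f)"
      unfolding p_def using that E by (subst ip_sum) (auto intro!: sum.cong simp: ip_scale subset_iff)
    also have "\<dots> = (\<Sum>f\<in>E. if f = e then hip H f x else 0)"
      using that by (intro sum.cong) (auto simp: orth)
    also have "\<dots> = hip H e x" using that E by simp
    finally show ?thesis using that E x p by (auto simp: y_def ip_diff)
  qed
  have xy: "span (insert x B) = span (insert y E)"
  proof -
    have "x \<in> span (insert y E)"
    proof -
      have "x = y + p" by (simp add: y_def)
      moreover have "y \<in> span (insert y E)" by (simp add: span_base)
      moreover have "p \<in> span (insert y E)"
        using pE span_mono[of E "insert y E"] by auto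
      ultimately show ?thesis using span_add by metis
    qed
    moreover have "B \<subseteq> span (insert y E)"
      using E(3) span_superset[of B] span_mono[of E "insert y E"] by auto
    moreover have "y \<in> span (insert x B)"
      unfolding y_def using pE E(3) span_mono[of B "insert x B"]
      by (intro span_diff) (auto simp: span_base)
    moreover have "E \<subseteq> span (insert x B)"
      using E(3) span_superset[of E] span_mono[of B "insert x B"] by auto
    ultimately show ?thesis by (auto simp: span_eq)
  qed
  show ?case
  proof (cases "y = 0")
    case True
    then have "span (insert x B) = span E" using xy by simp
    then show ?thesis using E orth by auto
  next
    case False
    define r where "r = Re (hip H y y)"
    have r: "r > 0" "hip H y y = of_real r"
      using ip_pos[OF y False] ip_self_real[OF y] by (auto simp: r_def)
    define z where "z = hsc H (of_real (1 / sqrt r)) y"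
    have z: "z \<in> hcar H" unfolding z_def using y by auto
    have "hip H z z = of_real (1 / sqrt r) * (of_real (1 / sqrt r) * of_real r)"
      using y r by (simp add: z_def ip_scale ip_scale_left)
    also have "\<dots> = of_real ((1 / sqrt r) * (1 / sqrt r) * r)" by (simp only: of_real_mult mult.assoc)
    also have "(1 / sqrt r) * (1 / sqrt r) * r = 1" using r by simp
    finally have zz: "hip H z z = 1" by simp
    have ez: "hip H e z = 0" if "e \<in> E" for e
      using that E y ip_y by (auto simp: z_def ip_scale)
    have ze: "hip H z e = 0" if "e \<in> E" for e
      using ez[OF that] ip_cnj[of e z] that E z by auto
    have "span (insert z E) = span (insert y E)"
    proof -
      have "y = hsc H (of_real (sqrt r)) z"
        using r by (simp add: z_def flip: of_real_mult)
      then have "y \<in> span (insert z E)" by (metis insertI1 span_base span_scale)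
      moreover have "z \<in> span (insert y E)" unfolding z_def by (simp add: span_base span_scale)
      ultimately show ?thesis
        using span_superset[of "insert z E"] span_superset[of "insert y E"] by (auto simp: span_eq)
    qed
    with xy have "span (insert z E) = span (insert x B)" by simp
    moreover have "z \<notin> E" using ez[of z] zz by auto
    then have "\<forall>e\<in>insert z E. \<forall>f\<in>insert z E. hip H e f = (if e = f then 1 else 0)"
      using zz ez ze orth by auto
    ultimately show ?thesis using E z by (intro exI[of _ "insert z E"]) auto
  qed
qed (auto intro!: exI[of _ "{}"])

lemma hbasis:
  "finite (hbasis H) \<and> hbasis H \<subseteq> hcar H \<and> span (hbasis H) = hcar H \<and>
     (\<forall>e \<in> hbasis H. \<forall>f \<in> hbasis H. hip H e f = (if e = f then 1 else 0))"
proof -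
  obtain B where B: "finite B" "span B = hcar H" using finite_dim by auto
  then have "B \<subseteq> hcar H" using span_superset[of B] by auto
  from gram_schmidt[OF B(1) this] obtain E where
    "finite E \<and> E \<subseteq> hcar H \<and> span E = hcar H \<and>
      (\<forall>e\<in>E. \<forall>f\<in>E. hip H e f = (if e = f then 1 else 0))"
    unfolding B(2) by blast
  then show ?thesis unfolding hbasis_def by (rule someI)
qed

lemma hbasis_finite [simp]: "finite (hbasis H)"
  and hbasis_carr [simp, intro]: "e \<in> hbasis H \<Longrightarrow> e \<in> hcar H"
  and hbasis_orth: "e \<in> hbasis H \<Longrightarrow> f \<in> hbasis H \<Longrightarrow> hip H e f = (if e = f then 1 else 0)"
  using hbasis by auto

lemma orthonormal_expand:
  assumes "finite B" "B \<subseteq> hcar H" "\<And>e f. e \<in> B \<Longrightarrow> f \<in> B \<Longrightarrow> hip H e f = (if e = f then 1 else 0)"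
    and "x \<in> span B"
  shows "x = (\<Sum>e\<in>B. hsc H (hip H e x) e)"
proof -
  obtain u where u: "x = (\<Sum>e\<in>B. hsc H (u e) e)"
    using assms(4) span_finite[OF assms(1)] by auto
  have "hip H e x = u e" if "e \<in> B" for e
  proof -
    have "hip H e x = (\<Sum>f\<in>B. u f * hip H e f)"
      unfolding u using that assms(2) by (subst ip_sum) (auto simp: ip_scale subset_iff intro!: sum.cong)
    also have "\<dots> = (\<Sum>f\<in>B. if f = e then u f else 0)"
      using that by (intro sum.cong) (auto simp: assms(3))
    also have "\<dots> = u e" using that assms(1) by simp
    finally show ?thesis .
  qed
  then show ?thesis using u by simp
qed

lemma expand: "x \<in> hcar H \<Longrightarrow> x = (\<Sum>e\<in>hbasis H. hsc H (hip H e x) e)"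
  using orthonormal_expand[of "hbasis H" x] hbasis by auto

lemma hbasis_sum: "e \<in> hbasis H \<Longrightarrow> (\<Sum>f\<in>hbasis H. hip H f e * g f) = (g e :: complex)"
  "e \<in> hbasis H \<Longrightarrow> (\<Sum>f\<in>hbasis H. hip H e f * g f) = (g e :: complex)"
proof -
  assume e: "e \<in> hbasis H"
  have "(\<Sum>f\<in>hbasis H. hip H f e * g f) = (\<Sum>f\<in>hbasis H. if f = e then g f else 0)"
    "(\<Sum>f\<in>hbasis H. hip H e f * g f) = (\<Sum>f\<in>hbasis H. if f = e then g f else 0)"
    by (rule sum.cong[OF refl], simp add: hbasis_orth e)+
  then show "(\<Sum>f\<in>hbasis H. hip H f e * g f) = g e" "(\<Sum>f\<in>hbasis H. hip H e f * g f) = g e"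
    using e by simp_all
qed

end

lemma lin_onI:
  assumes "\<And>x y. x \<in> hcar H \<Longrightarrow> y \<in> hcar H \<Longrightarrow> h (x + y) = h x + h y"
    and "\<And>c x. x \<in> hcar H \<Longrightarrow> h (hsc H c x) = s c (h x)"
    and "\<And>x. x \<notin> hcar H \<Longrightarrow> h x = 0"
  shows "lin_on H s h"
  using assms unfolding lin_on_def by blast

lemma lin_onD:
  assumes "lin_on H s h"
  shows "x \<in> hcar H \<Longrightarrow> y \<in> hcar H \<Longrightarrow> h (x + y) = h x + h y"
    and "x \<in> hcar H \<Longrightarrow> h (hsc H c x) = s c (h x)"
    and "x \<notin> hcar H \<Longrightarrow> h x = 0"
  using assms unfolding lin_on_def by auto

lemma hhomI:
  assumes "\<And>x y. x \<in> hcar H \<Longrightarrow> y \<in> hcar H \<Longrightarrow> h (x + y) = h x + h y"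
    and "\<And>c x. x \<in> hcar H \<Longrightarrow> h (hsc H c x) = hsc K c (h x)"
    and "\<And>x. x \<notin> hcar H \<Longrightarrow> h x = 0" and "\<And>x. x \<in> hcar H \<Longrightarrow> h x \<in> hcar K"
  shows "h \<in> hhom H K"
  using assms unfolding hhom_def lin_on_def by blast

lemma hhomD:
  assumes "h \<in> hhom H K"
  shows "lin_on H (hsc K) h"
    and "x \<in> hcar H \<Longrightarrow> y \<in> hcar H \<Longrightarrow> h (x + y) = h x + h y"
    and "x \<in> hcar H \<Longrightarrow> h (hsc H c x) = hsc K c (h x)"
    and "x \<notin> hcar H \<Longrightarrow> h x = 0"
    and "x \<in> hcar H \<Longrightarrow> h x \<in> hcar K"
  using assms unfolding hhom_def lin_on_def by auto

context fd_hilbert_space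
begin

lemma lin_on_0: "lin_on H s h \<Longrightarrow> h 0 = 0"
  using lin_onD(1)[of H s h 0 0] by simp

lemma lin_on_sum:
  assumes "lin_on H s h" "\<And>i. i \<in> I \<Longrightarrow> g i \<in> hcar H"
  shows "h (\<Sum>i\<in>I. g i) = (\<Sum>i\<in>I. h (g i))"
  using assms(2)
proof (induction I rule: infinite_finite_induct)
  case (insert i I)
  then show ?case by (simp add: lin_onD(1)[OF assms(1)] carr_sum)
qed (use lin_on_0[OF assms(1)] in auto)

lemma lin_on_diff:
  assumes "lin_on H s h" "x \<in> hcar H" "y \<in> hcar H"
  shows "h (x - y) = h x - h y"
  using lin_onD(1)[OF assms(1), of "x - y" y] assms by simp

lemma lin_on_expand:
  assumes "lin_on H s h" "x \<in> hcar H"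
  shows "h x = (\<Sum>e\<in>hbasis H. s (hip H e x) (h e))"
proof -
  have "h x = h (\<Sum>e\<in>hbasis H. hsc H (hip H e x) e)" using expand[OF assms(2)] by simp
  also have "\<dots> = (\<Sum>e\<in>hbasis H. h (hsc H (hip H e x) e))"
    by (intro lin_on_sum[OF assms(1)]) auto
  also have "\<dots> = (\<Sum>e\<in>hbasis H. s (hip H e x) (h e))"
    by (intro sum.cong) (auto simp: lin_onD(2)[OF assms(1)])
  finally show ?thesis .
qed

lemma lin_on_eqI:
  assumes "lin_on H s h" "lin_on H s h'" "\<And>x. x \<in> hcar H \<Longrightarrow> h x = h' x"
  shows "h = h'"
  using assms lin_onD(3) by (metis ext)

end

lemma vector_space_mult: "vector_space ((*) :: complex \<Rightarrow> complex \<Rightarrow> complex)"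
  by unfold_locales (auto simp: algebra_simps)

lemma hcomplex_simps [simp]:
  "hcar hcomplex = UNIV" "hsc hcomplex = (*)" "hip hcomplex x y = cnj x * y"
  by (auto simp: hcomplex_def)

lemma hcomplex_hilbert: "fd_hilbert_space hcomplex"
proof (intro fd_hilbert_space.intro fd_hilbert_space_axioms.intro)
  interpret vector_space "(*) :: complex \<Rightarrow> complex \<Rightarrow> complex" by (rule vector_space_mult)
  show "vector_space (hsc hcomplex)" by (simp add: vector_space_mult)
  show "module.subspace (hsc hcomplex) (hcar hcomplex)" by (simp add: subspace_UNIV)
  have "span {1} = UNIV" by (auto simp: span_singleton)
  then show "\<exists>B. finite B \<and> module.span (hsc hcomplex) B = hcar hcomplex"
    by (intro exI[of _ "{1}"]) simp
  fix x y z c :: complex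
  show "hip hcomplex x (y + z) = hip hcomplex x y + hip hcomplex x z"
    by (simp add: distrib_left)
  show "hip hcomplex x (hsc hcomplex c y) = c * hip hcomplex x y" by simp
  show "hip hcomplex y x = cnj (hip hcomplex x y)" by simp
  assume "x \<noteq> 0"
  moreover have "hip hcomplex x x = of_real ((cmod x)\<^sup>2)"
    unfolding complex_norm_square hcomplex_simps by (rule mult.commute)
  ultimately show "Re (hip hcomplex x x) > 0" by (simp del: hcomplex_simps)
qed

section \<open>Adjoints\<close>

locale hilbert_pair = HH: fd_hilbert_space H + KK: fd_hilbert_space K
  for H :: "'v::ab_group_add hilb" and K :: "'w::ab_group_add hilb"
begin

lemma adjoint_unique:
  assumes "g \<in> hhom K H" "g' \<in> hhom K H"
    and "\<And>x y. x \<in> hcar H \<Longrightarrow> y \<in> hcar K \<Longrightarrow> hip H x (g y) = hip H x (g' y)"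
  shows "g = g'"
proof (rule KK.lin_on_eqI)
  show "lin_on K (hsc H) g" "lin_on K (hsc H) g'" by (rule hhomD(1)[OF assms(1)], rule hhomD(1)[OF assms(2)])
  show "g y = g' y" if "y \<in> hcar K" for y
    using that assms(3) by (intro HH.ip_ext) (simp_all add: hhomD(5)[OF assms(1)] hhomD(5)[OF assms(2)])
qed

lemma hadj_exists:
  assumes "f \<in> hhom H K"
  shows "\<exists>g \<in> hhom K H. \<forall>x \<in> hcar H. \<forall>y \<in> hcar K. hip K (f x) y = hip H x (g y)"
proof
  let ?g = "\<lambda>y. if y \<in> hcar K then \<Sum>e\<in>hbasis H. hsc H (hip K (f e) y) e else 0"
  have fe: "f e \<in> hcar K" if "e \<in> hbasis H" for e
    using that by (simp add: hhomD(5)[OF assms])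
  show "?g \<in> hhom K H"
    by (rule hhomI)
      (auto simp: fe KK.ip_add KK.ip_scale HH.scale_left_distrib sum.distrib
        HH.scale_sum_right intro!: sum.cong HH.carr_sum)
  show "\<forall>x \<in> hcar H. \<forall>y \<in> hcar K. hip K (f x) y = hip H x (?g y)"
  proof (intro ballI)
    fix x y assume xy: "x \<in> hcar H" "y \<in> hcar K"
    have "hip K (f x) y = hip K (\<Sum>e\<in>hbasis H. hsc K (hip H e x) (f e)) y"
      using HH.lin_on_expand[OF hhomD(1)[OF assms] xy(1)] by simp
    also have "\<dots> = (\<Sum>e\<in>hbasis H. hip H x e * hip K (f e) y)"
      using xy fe by (subst KK.ip_sum_left)
        (auto simp: KK.ip_scale_left HH.ip_cnj[OF xy(1)] intro!: sum.cong)
    also have "\<dots> = hip H x (?g y)"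
      using xy by (auto simp: HH.ip_sum HH.ip_scale mult.commute)
    finally show "hip K (f x) y = hip H x (?g y)" .
  qed
qed

lemma hadj:
  assumes "f \<in> hhom H K"
  shows "hadj H K f \<in> hhom K H \<and> (\<forall>x \<in> hcar H. \<forall>y \<in> hcar K. hip K (f x) y = hip H x (hadj H K f y))"
proof -
  have "\<exists>!g. g \<in> hhom K H \<and> (\<forall>x \<in> hcar H. \<forall>y \<in> hcar K. hip K (f x) y = hip H x (g y))"
    using hadj_exists[OF assms] by (auto intro!: adjoint_unique ex_ex1I)
  then show ?thesis unfolding hadj_def by (rule theI')
qed

lemma hadj_hhom: "f \<in> hhom H K \<Longrightarrow> hadj H K f \<in> hhom K H"
  and hadj_ip: "\<lbrakk>f \<in> hhom H K; x \<in> hcar H; y \<in> hcar K\<rbrakk> \<Longrightarrow> hip K (f x) y = hip H x (hadj H K f y)"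
  using hadj by auto

lemma hadj_carr: "f \<in> hhom H K \<Longrightarrow> y \<in> hcar K \<Longrightarrow> hadj H K f y \<in> hcar H"
  by (rule hhomD(5)[OF hadj_hhom])

lemma hadj_ip':
  assumes "f \<in> hhom H K" "x \<in> hcar H" "y \<in> hcar K"
  shows "hip K y (f x) = hip H (hadj H K f y) x"
  using hadj_ip[OF assms] HH.ip_cnj[of x "hadj H K f y"] KK.ip_cnj[of "f x" y] assms
    hadj_carr hhomD(5)[OF assms(1)] by auto

lemma hadj_eqI:
  assumes "f \<in> hhom H K" "g \<in> hhom K H"
    and "\<And>x y. x \<in> hcar H \<Longrightarrow> y \<in> hcar K \<Longrightarrow> hip K (f x) y = hip H x (g y)"
  shows "hadj H K f = g"
  using assms by (intro adjoint_unique) (auto simp: hadj_hhom hadj_ip[symmetric])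

end

lemma hilbert_pairI: "fd_hilbert_space H \<Longrightarrow> fd_hilbert_space K \<Longrightarrow> hilbert_pair H K"
  by (simp add: hilbert_pair_def)

lemma hhom_comp:
  assumes "f \<in> hhom H K" "g \<in> hhom K L" "fd_hilbert_space K"
  shows "g \<circ> f \<in> hhom H L"
  using assms fd_hilbert_space.lin_on_0[OF assms(3) hhomD(1)[OF assms(2)]]
  by (intro hhomI) (auto simp: hhomD)

lemma hadj_comp:
  assumes "fd_hilbert_space H" "fd_hilbert_space K" "fd_hilbert_space L" "f \<in> hhom H K" "g \<in> hhom K L"
  shows "hadj H L (g \<circ> f) = hadj H K f \<circ> hadj K L g"
proof -
  interpret HK: hilbert_pair H K using assms by (intro hilbert_pairI)
  interpret KL: hilbert_pair K L using assms by (intro hilbert_pairI)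
  interpret HL: hilbert_pair H L using assms by (intro hilbert_pairI)
  show ?thesis
  proof (rule HL.hadj_eqI)
    show "g \<circ> f \<in> hhom H L" by (rule hhom_comp[OF assms(4,5,2)])
    show "hadj H K f \<circ> hadj K L g \<in> hhom L H"
      by (rule hhom_comp[OF KL.hadj_hhom[OF assms(5)] HK.hadj_hhom[OF assms(4)] assms(2)])
    show "hip L ((g \<circ> f) x) y = hip H x ((hadj H K f \<circ> hadj K L g) y)" if "x \<in> hcar H" "y \<in> hcar L" for x y
      using that KL.hadj_ip[OF assms(5), of "f x" y] HK.hadj_ip[OF assms(4), of x "hadj K L g y"]
        hhomD(5)[OF assms(4)] KL.hadj_carr[OF assms(5)] by simp
  qed
qed

text \<open>
  This is \<open>tr(\<beta> A) = tr(A \<beta>)\<close> for a form \<open>\<beta>\<close> that is linear in one and conjugate linear in the other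
  variable; \<open>B\<close> is the adjoint of \<open>A\<close>.  In this form it applies to the conjugate linear maps below.
\<close>

lemma (in hilbert_pair) trace_swap:
  assumes A: "\<And>x. x \<in> hcar H \<Longrightarrow> A x \<in> hcar K" and B: "\<And>y. y \<in> hcar K \<Longrightarrow> B y \<in> hcar H"
    and adj: "\<And>x y. x \<in> hcar H \<Longrightarrow> y \<in> hcar K \<Longrightarrow> hip H (B y) x = hip K y (A x)"
    and l: "\<And>x. x \<in> hcar H \<Longrightarrow> lin_on K (*) (\<lambda>y. if y \<in> hcar K then \<beta> y x else 0)"
    and al: "\<And>y. y \<in> hcar K \<Longrightarrow> lin_on H (\<lambda>c. (*) (cnj c)) (\<lambda>x. if x \<in> hcar H then \<beta> y x else 0)"
  shows "(\<Sum>x\<in>hbasis H. \<beta> (A x) x) = (\<Sum>y\<in>hbasis K. \<beta> y (B y))"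
proof -
  have "(\<Sum>x\<in>hbasis H. \<beta> (A x) x) = (\<Sum>x\<in>hbasis H. \<Sum>y\<in>hbasis K. hip K y (A x) * \<beta> y x)"
  proof (rule sum.cong[OF refl])
    fix x assume "x \<in> hbasis H"
    then have x: "x \<in> hcar H" by simp
    show "\<beta> (A x) x = (\<Sum>y\<in>hbasis K. hip K y (A x) * \<beta> y x)"
      using KK.lin_on_expand[OF l[OF x] A[OF x]] by (simp only: A[OF x] KK.hbasis_carr if_True cong: sum.cong)
  qed
  also have "\<dots> = (\<Sum>y\<in>hbasis K. \<Sum>x\<in>hbasis H. cnj (hip H x (B y)) * \<beta> y x)"
  proof (subst sum.swap, intro sum.cong refl)
    fix x y assume "x \<in> hbasis H" "y \<in> hbasis K"
    then have xy: "x \<in> hcar H" "y \<in> hcar K" by auto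
    show "hip K y (A x) * \<beta> y x = cnj (hip H x (B y)) * \<beta> y x"
      using adj[OF xy] HH.ip_cnj[OF xy(1) B[OF xy(2)]] by simp
  qed
  also have "\<dots> = (\<Sum>y\<in>hbasis K. \<beta> y (B y))"
  proof (rule sum.cong[OF refl])
    fix y assume "y \<in> hbasis K"
    then have y: "y \<in> hcar K" by simp
    show "(\<Sum>x\<in>hbasis H. cnj (hip H x (B y)) * \<beta> y x) = \<beta> y (B y)"
      using HH.lin_on_expand[OF al[OF y] B[OF y]] by (simp only: B[OF y] HH.hbasis_carr if_True cong: sum.cong)
  qed
  finally show ?thesis .
qed

context fd_hilbert_space
begin

interpretation pair_complex: hilbert_pair H hcomplex
  by (intro hilbert_pairI hcomplex_hilbert) unfold_locales

lemma bra_hhom: "x \<in> hcar H \<Longrightarrow> bra H x \<in> hhom H hcomplex"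
  by (intro hhomI) (auto simp: bra_def ip_add ip_scale)

lemma ket_carr: "f \<in> hhom H hcomplex \<Longrightarrow> ket H f \<in> hcar H"
  unfolding ket_def by (intro pair_complex.hadj_carr) auto

lemma ket_ip: "f \<in> hhom H hcomplex \<Longrightarrow> x \<in> hcar H \<Longrightarrow> hip H (ket H f) x = f x"
  using pair_complex.hadj_ip'[of f x 1] by (simp add: ket_def)

lemma functional_eqI:
  assumes "f \<in> hhom H hcomplex" "g \<in> hhom H hcomplex" "\<And>x. x \<in> hcar H \<Longrightarrow> f x = g x"
  shows "f = g"
  using assms by (intro lin_on_eqI[of "(*)"]) (auto simp: hhom_def)

lemma bra_apply: "x \<in> hcar H \<Longrightarrow> bra H y x = hip H y x"
  by (simp add: bra_def)

lemma ket_unique: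
  assumes "f \<in> hhom H hcomplex" "y \<in> hcar H" "\<And>x. x \<in> hcar H \<Longrightarrow> hip H y x = f x"
  shows "ket H f = y"
proof (rule ip_ext)
  fix z assume z: "z \<in> hcar H"
  show "hip H z (ket H f) = hip H z y"
    using ip_cnj[of "ket H f" z] ip_cnj[of y z] z assms by (simp add: ket_carr ket_ip)
qed (use assms ket_carr in auto)

lemma ket_bra: "x \<in> hcar H \<Longrightarrow> ket H (bra H x) = x"
  by (rule ket_unique) (auto simp: bra_hhom bra_apply)

lemma bra_ket: "f \<in> hhom H hcomplex \<Longrightarrow> bra H (ket H f) = f"
  by (rule functional_eqI) (auto simp: bra_hhom ket_carr bra_apply ket_ip)

lemma bra_add: "x \<in> hcar H \<Longrightarrow> y \<in> hcar H \<Longrightarrow> bra H (x + y) = bra H x + bra H y"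
  by (auto simp: bra_def fun_eq_iff ip_add_left)

lemma bra_scale: "x \<in> hcar H \<Longrightarrow> bra H (hsc H c x) = (\<lambda>v. cnj c * bra H x v)"
  by (auto simp: bra_def fun_eq_iff ip_scale_left)

end

section \<open>The dual space\<close>

lemma hdual_simps [simp]:
  "hcar (hdual H) = hhom H hcomplex" "hsc (hdual H) = (\<lambda>c f v. c * f v)"
  by (auto simp: hdual_def)

lemma vector_space_fun: "vector_space (\<lambda>c (f :: 'v \<Rightarrow> complex) v. c * f v)"
  by unfold_locales (auto simp: algebra_simps fun_eq_iff)

lemma vector_space_fun2: "vector_space (\<lambda>c (T :: 'v \<Rightarrow> 'w \<Rightarrow> complex) v w. c * T v w)"
  by unfold_locales (auto simp: algebra_simps fun_eq_iff)

lemma vector_space_cg: "vector_space (cg_scale :: complex \<Rightarrow> ('o \<Rightarrow> 'v dtens) \<Rightarrow> 'o \<Rightarrow> 'v dtens)"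
  by unfold_locales (auto simp: cg_scale_def dtens_scale_def fun_eq_iff algebra_simps)

lemma vector_space_dtens_cnj: "vector_space (\<lambda>c. dtens_scale (cnj c))"
  by unfold_locales (auto simp: dtens_scale_def fun_eq_iff algebra_simps)

context fd_hilbert_space
begin

lemma functional_add: "f \<in> hhom H hcomplex \<Longrightarrow> g \<in> hhom H hcomplex \<Longrightarrow> f + g \<in> hhom H hcomplex"
  by (intro hhomI) (auto simp: hhomD algebra_simps)

lemma functional_scale: "f \<in> hhom H hcomplex \<Longrightarrow> (\<lambda>v. c * f v) \<in> hhom H hcomplex"
  by (intro hhomI) (auto simp: hhomD algebra_simps)

lemma functional_0: "0 \<in> hhom H hcomplex" "(\<lambda>v. 0) \<in> hhom H hcomplex"
  by (auto intro!: hhomI)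

lemma functional_expand:
  assumes "f \<in> hhom H hcomplex"
  shows "f = (\<Sum>e\<in>hbasis H. (\<lambda>v. f e * bra H e v))"
proof
  fix v
  show "f v = (\<Sum>e\<in>hbasis H. (\<lambda>v. f e * bra H e v)) v"
  proof (cases "v \<in> hcar H")
    case True
    have "f v = (\<Sum>e\<in>hbasis H. hip H e v * f e)"
      using lin_on_expand[OF hhomD(1)[OF assms] True] by simp
    then show ?thesis using True by (simp add: sum_fun_apply bra_apply mult.commute)
  qed (simp add: sum_fun_apply bra_def hhomD(4)[OF assms])
qed

end

text \<open>
  Dual spaces and tensor products carry inner products that are given by coordinates with respect to
  bases; that these are Hilbert spaces amounts to the coordinates separating the vectors.
\<close>

lemma coordinate_hilbert:
  assumes v: "vector_space (hsc H)" and V: "module.subspace (hsc H) (hcar H)" and I: "finite I"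
    and ip: "\<And>x y. hip H x y = (\<Sum>i\<in>I. cnj (\<phi> i x) * \<phi> i y)"
    and add: "\<And>i x y. x \<in> hcar H \<Longrightarrow> y \<in> hcar H \<Longrightarrow> \<phi> i (x + y) = \<phi> i x + \<phi> i y"
    and scale: "\<And>i c x. x \<in> hcar H \<Longrightarrow> \<phi> i (hsc H c x) = c * \<phi> i x"
    and sep: "\<And>x. x \<in> hcar H \<Longrightarrow> (\<And>i. i \<in> I \<Longrightarrow> \<phi> i x = 0) \<Longrightarrow> x = 0"
  shows "fd_hilbert_space H"
proof (intro fd_hilbert_space.intro fd_hilbert_space_axioms.intro v V)
  interpret vector_space "hsc H" by (rule v)
  show "\<exists>B. finite B \<and> span B = hcar H"
    by (rule finite_span_if_separated[OF I V, of \<phi>]) (use add scale sep in auto)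
  fix x y z c assume x: "x \<in> hcar H"
  show "x \<noteq> 0 \<Longrightarrow> Re (hip H x x) > 0"
  proof -
    assume "x \<noteq> 0"
    then obtain i where i: "i \<in> I" "\<phi> i x \<noteq> 0" using sep[OF x] by blast
    have "Re (cnj w * w) = (cmod w)\<^sup>2" for w
      unfolding cmod_power2 by (simp add: power2_eq_square)
    then have "Re (hip H x x) = (\<Sum>i\<in>I. (cmod (\<phi> i x))\<^sup>2)"
      unfolding ip Re_sum by simp
    also have "\<dots> > 0" using i I by (intro sum_pos2[of _ i]) auto
    finally show ?thesis .
  qed
  assume y: "y \<in> hcar H"
  show "hip H x (hsc H c y) = c * hip H x y"
    by (simp add: ip scale[OF y] sum_distrib_left mult.left_commute)
  show "hip H y x = cnj (hip H x y)" by (simp add: ip mult.commute)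
  assume "z \<in> hcar H"
  then show "hip H x (y + z) = hip H x y + hip H x z"
    by (simp add: ip add[OF y] distrib_left sum.distrib)
qed

lemma hdual_hilbert:
  fixes H :: "'v::ab_group_add hilb"
  assumes "fd_hilbert_space H"
  shows "fd_hilbert_space (hdual H)"
proof -
  interpret fd_hilbert_space H by (rule assms)
  interpret D: vector_space "\<lambda>c (f :: 'v \<Rightarrow> complex) v. c * f v" by (rule vector_space_fun)
  show ?thesis
  proof (rule coordinate_hilbert[where I = "hbasis H" and \<phi> = "\<lambda>e f. f e"])
    show "module.subspace (hsc (hdual H)) (hcar (hdual H))"
      unfolding hdual_simps
      by (rule D.subspaceI) (rule functional_0 functional_add functional_scale; assumption?)+
    show "f = 0" if f: "f \<in> hcar (hdual H)" and 0: "\<And>e. e \<in> hbasis H \<Longrightarrow> f e = 0" for f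
    proof
      fix v
      have "f v = (\<Sum>e\<in>hbasis H. (\<lambda>v. f e * bra H e v)) v"
        using functional_expand[of f] f by (metis hdual_simps(1))
      then show "f v = 0 v" by (simp add: sum_fun_apply 0)
    qed
  qed (simp_all add: vector_space_fun hdual_def)
qed

section \<open>Tensor products and bilinear extension\<close>

definition bilin_on :: "'v::ab_group_add hilb \<Rightarrow> 'w::ab_group_add hilb \<Rightarrow> (complex \<Rightarrow> 'u \<Rightarrow> 'u) \<Rightarrow>
    ('v \<Rightarrow> 'w \<Rightarrow> 'u::ab_group_add) \<Rightarrow> bool" where
  "bilin_on H K s \<beta> \<longleftrightarrow>
    (\<forall>x\<in>hcar H. \<forall>x'\<in>hcar H. \<forall>y\<in>hcar K. \<beta> (x + x') y = \<beta> x y + \<beta> x' y) \<and>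
    (\<forall>c. \<forall>x\<in>hcar H. \<forall>y\<in>hcar K. \<beta> (hsc H c x) y = s c (\<beta> x y)) \<and>
    (\<forall>x\<in>hcar H. \<forall>y\<in>hcar K. \<forall>y'\<in>hcar K. \<beta> x (y + y') = \<beta> x y + \<beta> x y') \<and>
    (\<forall>c. \<forall>x\<in>hcar H. \<forall>y\<in>hcar K. \<beta> x (hsc K c y) = s c (\<beta> x y))"

lemma bilin_onI:
  assumes "\<And>x x' y. x \<in> hcar H \<Longrightarrow> x' \<in> hcar H \<Longrightarrow> y \<in> hcar K \<Longrightarrow> \<beta> (x + x') y = \<beta> x y + \<beta> x' y"
    and "\<And>c x y. x \<in> hcar H \<Longrightarrow> y \<in> hcar K \<Longrightarrow> \<beta> (hsc H c x) y = s c (\<beta> x y)"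
    and "\<And>x y y'. x \<in> hcar H \<Longrightarrow> y \<in> hcar K \<Longrightarrow> y' \<in> hcar K \<Longrightarrow> \<beta> x (y + y') = \<beta> x y + \<beta> x y'"
    and "\<And>c x y. x \<in> hcar H \<Longrightarrow> y \<in> hcar K \<Longrightarrow> \<beta> x (hsc K c y) = s c (\<beta> x y)"
  shows "bilin_on H K s \<beta>"
  using assms unfolding bilin_on_def by blast

lemma bilin_onD:
  assumes "bilin_on H K s \<beta>"
  shows "x \<in> hcar H \<Longrightarrow> x' \<in> hcar H \<Longrightarrow> y \<in> hcar K \<Longrightarrow> \<beta> (x + x') y = \<beta> x y + \<beta> x' y"
    and "x \<in> hcar H \<Longrightarrow> y \<in> hcar K \<Longrightarrow> \<beta> (hsc H c x) y = s c (\<beta> x y)"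
    and "x \<in> hcar H \<Longrightarrow> y \<in> hcar K \<Longrightarrow> y' \<in> hcar K \<Longrightarrow> \<beta> x (y + y') = \<beta> x y + \<beta> x y'"
    and "x \<in> hcar H \<Longrightarrow> y \<in> hcar K \<Longrightarrow> \<beta> x (hsc K c y) = s c (\<beta> x y)"
  using assms unfolding bilin_on_def by blast+

lemma htens_simps [simp]: "hsc (htens H K) = (\<lambda>c T v w. c * T v w)"
  by (auto simp: htens_def)

context hilbert_pair
begin

interpretation T: vector_space "\<lambda>c (T :: 'v \<Rightarrow> 'w \<Rightarrow> complex) v w. c * T v w"
  by (rule vector_space_fun2)

lemma bilin_on_sum_left:
  assumes "bilin_on H K s \<beta>" "\<And>i. i \<in> I \<Longrightarrow> g i \<in> hcar H" "y \<in> hcar K"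
  shows "\<beta> (\<Sum>i\<in>I. g i) y = (\<Sum>i\<in>I. \<beta> (g i) y)"
  using assms(2)
proof (induction I rule: infinite_finite_induct)
  case (insert i I)
  then show ?case using assms(3) by (simp add: bilin_onD(1)[OF assms(1)] HH.carr_sum)
qed (use bilin_onD(1)[OF assms(1), of 0 0 y] assms(3) in auto)

lemma bilin_on_sum_right:
  assumes "bilin_on H K s \<beta>" "\<And>i. i \<in> I \<Longrightarrow> g i \<in> hcar K" "x \<in> hcar H"
  shows "\<beta> x (\<Sum>i\<in>I. g i) = (\<Sum>i\<in>I. \<beta> x (g i))"
  using assms(2)
proof (induction I rule: infinite_finite_induct)
  case (insert i I)
  then show ?case using assms(3) by (simp add: bilin_onD(3)[OF assms(1)] KK.carr_sum)
qed (use bilin_onD(3)[OF assms(1), of x 0 0] assms(3) in auto)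

lemma bilin_on_expand:
  assumes "bilin_on H K s \<beta>" "x \<in> hcar H" "y \<in> hcar K"
  shows "\<beta> x y = (\<Sum>e\<in>hbasis H. \<Sum>f\<in>hbasis K. s (hip H e x) (s (hip K f y) (\<beta> e f)))"
proof -
  have x: "x = (\<Sum>e\<in>hbasis H. hsc H (hip H e x) e)" by (rule HH.expand[OF assms(2)])
  have y: "y = (\<Sum>f\<in>hbasis K. hsc K (hip K f y) f)" by (rule KK.expand[OF assms(3)])
  have "\<beta> x y = (\<Sum>e\<in>hbasis H. \<beta> (hsc H (hip H e x) e) y)"
    using bilin_on_sum_left[OF assms(1) _ assms(3), of "hbasis H" "\<lambda>e. hsc H (hip H e x) e"] x by simp
  also have "\<dots> = (\<Sum>e\<in>hbasis H. \<Sum>f\<in>hbasis K. \<beta> (hsc H (hip H e x) e) (hsc K (hip K f y) f))"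
  proof (rule sum.cong[OF refl])
    fix e assume "e \<in> hbasis H"
    then show "\<beta> (hsc H (hip H e x) e) y = (\<Sum>f\<in>hbasis K. \<beta> (hsc H (hip H e x) e) (hsc K (hip K f y) f))"
      using bilin_on_sum_right[OF assms(1), of "hbasis K" "\<lambda>f. hsc K (hip K f y) f" "hsc H (hip H e x) e"] y
      by simp
  qed
  also have "\<dots> = (\<Sum>e\<in>hbasis H. \<Sum>f\<in>hbasis K. s (hip H e x) (s (hip K f y) (\<beta> e f)))"
    by (intro sum.cong refl) (simp add: bilin_onD(2)[OF assms(1)], simp add: bilin_onD(4)[OF assms(1)])
  finally show ?thesis .
qed

text \<open>
  The elements of the tensor product are exactly the functions that are conjugate linear in each of the
  two vectors.  This description replaces the span of the elementary tensors in the proofs.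
\<close>

definition conj_bilin :: "('v \<Rightarrow> 'w \<Rightarrow> complex) \<Rightarrow> bool" where
  "conj_bilin T \<longleftrightarrow> bilin_on H K (\<lambda>c. (*) (cnj c)) T \<and> (\<forall>v w. v \<notin> hcar H \<or> w \<notin> hcar K \<longrightarrow> T v w = 0)"

lemma conj_bilin_tens: "x \<in> hcar H \<Longrightarrow> y \<in> hcar K \<Longrightarrow> conj_bilin (tens H K x y)"
  unfolding conj_bilin_def
  by (auto intro!: bilin_onI simp: tens_def HH.ip_add_left KK.ip_add_left HH.ip_scale_left
      KK.ip_scale_left algebra_simps)

lemma conj_bilin_subspace: "T.subspace {T. conj_bilin T}"
proof (rule T.subspaceI)
  show "0 \<in> {T. conj_bilin T}" by (auto simp: conj_bilin_def intro!: bilin_onI)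
  show "S + T \<in> {T. conj_bilin T}" if "S \<in> {T. conj_bilin T}" "T \<in> {T. conj_bilin T}" for S T
    using that unfolding conj_bilin_def mem_Collect_eq
    by (auto intro!: bilin_onI simp: bilin_onD algebra_simps)
  show "(\<lambda>v w. c * T v w) \<in> {T. conj_bilin T}" if "T \<in> {T. conj_bilin T}" for c T
    using that unfolding conj_bilin_def mem_Collect_eq
    by (auto intro!: bilin_onI simp: bilin_onD algebra_simps)
qed

lemma conj_bilin_expand:
  assumes "conj_bilin T"
  shows "T = (\<Sum>e\<in>hbasis H. \<Sum>f\<in>hbasis K. (\<lambda>v w. T e f * tens H K e f v w))"
proof (intro ext)
  fix v w
  show "T v w = (\<Sum>e\<in>hbasis H. \<Sum>f\<in>hbasis K. (\<lambda>v w. T e f * tens H K e f v w)) v w"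
  proof (cases "v \<in> hcar H \<and> w \<in> hcar K")
    case True
    have "T v w = (\<Sum>e\<in>hbasis H. \<Sum>f\<in>hbasis K. cnj (hip H e v) * (cnj (hip K f w) * T e f))"
      using True assms by (intro bilin_on_expand) (auto simp: conj_bilin_def)
    also have "\<dots> = (\<Sum>e\<in>hbasis H. \<Sum>f\<in>hbasis K. T e f * tens H K e f v w)"
      using True HH.ip_cnj[of _ v] KK.ip_cnj[of _ w]
      by (intro sum.cong refl) (simp add: tens_def)
    finally show ?thesis by (simp add: sum_fun_apply)
  next
    case False
    then have "T v w = 0" "tens H K e f v w = 0" for e f
      using assms by (auto simp: conj_bilin_def tens_def)
    then show ?thesis by (simp add: sum_fun_apply)
  qed
qed

lemma htens_carrier: "hcar (htens H K) = {T. conj_bilin T}"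
proof
  have "hcar (htens H K) = T.span {tens H K x y | x y. x \<in> hcar H \<and> y \<in> hcar K}"
    by (simp add: htens_def)
  moreover have "T.span {tens H K x y | x y. x \<in> hcar H \<and> y \<in> hcar K} \<subseteq> {T. conj_bilin T}"
    by (rule T.span_minimal[OF _ conj_bilin_subspace]) (auto simp: conj_bilin_tens)
  moreover have "T \<in> T.span {tens H K x y | x y. x \<in> hcar H \<and> y \<in> hcar K}" if "conj_bilin T" for T
    by (subst conj_bilin_expand[OF that]) (intro T.span_sum T.span_scale T.span_base, auto)
  ultimately show "hcar (htens H K) \<subseteq> {T. conj_bilin T}" "{T. conj_bilin T} \<subseteq> hcar (htens H K)"
    by auto
qed

lemma tens_carr: "x \<in> hcar H \<Longrightarrow> y \<in> hcar K \<Longrightarrow> tens H K x y \<in> hcar (htens H K)"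
  by (simp add: htens_carrier conj_bilin_tens)

lemma tens_bilin: "bilin_on H K (\<lambda>c T v w. c * T v w) (tens H K)"
  by (rule bilin_onI)
    (auto simp: tens_def fun_eq_iff HH.ip_add HH.ip_scale KK.ip_add KK.ip_scale algebra_simps)

lemma hip_htens: "hip (htens H K) S T = (\<Sum>e\<in>hbasis H. \<Sum>f\<in>hbasis K. cnj (S e f) * T e f)"
  by (simp add: htens_def)

lemma hip_tens_basis:
  assumes "e \<in> hbasis H" "f \<in> hbasis K"
  shows "hip (htens H K) (tens H K e f) T = T e f"
proof -
  have "hip (htens H K) (tens H K e f) T =
      (\<Sum>e'\<in>hbasis H. \<Sum>f'\<in>hbasis K. hip H e e' * (hip K f f' * T e' f'))"
    unfolding hip_htens using assms HH.ip_cnj[of e] KK.ip_cnj[of f]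
    by (intro sum.cong refl) (simp add: tens_def)
  also have "\<dots> = T e f"
    using assms by (simp add: sum_distrib_left[symmetric] HH.hbasis_sum KK.hbasis_sum)
  finally show ?thesis .
qed

lemma htens_hilbert: "fd_hilbert_space (htens H K)"
proof (rule coordinate_hilbert[where I = "hbasis H \<times> hbasis K" and \<phi> = "\<lambda>(e, f) T. T e f"])
  show "vector_space (hsc (htens H K))" by (simp add: vector_space_fun2)
  show "module.subspace (hsc (htens H K)) (hcar (htens H K))"
    by (simp add: htens_carrier conj_bilin_subspace)
  show "T = 0" if T: "T \<in> hcar (htens H K)"
    and 0: "\<And>p. p \<in> hbasis H \<times> hbasis K \<Longrightarrow> (case p of (e, f) \<Rightarrow> \<lambda>T. T e f) T = 0" for T
  proof (intro ext)
    fix v w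
    have T0: "T e f = 0" if "e \<in> hbasis H" "f \<in> hbasis K" for e f
      using 0[of "(e, f)"] that by simp
    have "conj_bilin T" using T by (simp add: htens_carrier)
    then have "T v w = (\<Sum>e\<in>hbasis H. \<Sum>f\<in>hbasis K. (\<lambda>v w. T e f * tens H K e f v w)) v w"
      by (rule fun_cong[OF fun_cong[OF conj_bilin_expand]])
    then show "T v w = 0 v w" by (simp add: sum_fun_apply T0)
  qed
qed (auto simp: hip_htens sum.cartesian_product split_def)

text \<open>
  An explicit sum over basis vectors has the two properties that characterise the extension.  The third
  claim is the one used later: it turns all operations on the algebra into finite sums.
\<close>

lemma tens_ext:
  assumes s: "vector_space s" and \<beta>: "bilin_on H K s \<beta>"
  shows "lin_on (htens H K) s (tens_ext s H K \<beta>)"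
    and "\<And>x y. x \<in> hcar H \<Longrightarrow> y \<in> hcar K \<Longrightarrow> tens_ext s H K \<beta> (tens H K x y) = \<beta> x y"
    and "\<And>T. T \<in> hcar (htens H K) \<Longrightarrow>
      tens_ext s H K \<beta> T = (\<Sum>e\<in>hbasis H. \<Sum>f\<in>hbasis K. s (T e f) (\<beta> e f))"
proof -
  interpret S: vector_space s by (rule s)
  interpret HK: fd_hilbert_space "htens H K" by (rule htens_hilbert)
  let ?h = "\<lambda>T. if T \<in> hcar (htens H K) then \<Sum>e\<in>hbasis H. \<Sum>f\<in>hbasis K. s (T e f) (\<beta> e f) else 0"
  let ?P = "\<lambda>h. lin_on (htens H K) s h \<and> (\<forall>x \<in> hcar H. \<forall>y \<in> hcar K. h (tens H K x y) = \<beta> x y)"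
  have lin: "lin_on (htens H K) s ?h"
    using HK.carr_add HK.carr_scale
    by (intro lin_onI)
      (simp_all add: S.scale_left_distrib sum.distrib S.scale_sum_right)
  have val: "?h (tens H K x y) = \<beta> x y" if xy: "x \<in> hcar H" "y \<in> hcar K" for x y
    using xy by (simp add: tens_carr bilin_on_expand[OF \<beta> xy]) (simp add: tens_def)
  have ex: "?P ?h" using lin val by blast
  have uni: "h = ?h" if "?P h" for h
  proof (rule HK.lin_on_eqI[of s])
    show "lin_on (htens H K) s h" "lin_on (htens H K) s ?h" using that lin by auto
    fix T assume T: "T \<in> hcar (htens H K)"
    have h: "lin_on (htens H K) s h" using that by blast
    have t: "(\<lambda>v w. T e f * tens H K e f v w) \<in> hcar (htens H K)" if "e \<in> hbasis H" "f \<in> hbasis K" for e f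
      using HK.carr_scale[of "tens H K e f" "T e f"] tens_carr that by simp
    have "h T = h (\<Sum>e\<in>hbasis H. \<Sum>f\<in>hbasis K. (\<lambda>v w. T e f * tens H K e f v w))"
      using conj_bilin_expand[of T] T htens_carrier by simp
    also have "\<dots> = (\<Sum>e\<in>hbasis H. \<Sum>f\<in>hbasis K. h (\<lambda>v w. T e f * tens H K e f v w))"
      using t by (simp add: HK.lin_on_sum[OF h] HK.carr_sum)
    also have "\<dots> = (\<Sum>e\<in>hbasis H. \<Sum>f\<in>hbasis K. s (T e f) (\<beta> e f))"
      using lin_onD(2)[OF h] that tens_carr by (intro sum.cong refl) simp
    finally show "h T = ?h T" using T by simp
  qed
  have "?P (tens_ext s H K \<beta>)"
    unfolding tens_ext_def by (rule theI[of ?P, OF ex uni])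
  then have eq: "tens_ext s H K \<beta> = ?h" by (rule uni)
  show "lin_on (htens H K) s (tens_ext s H K \<beta>)" unfolding eq by (rule lin)
  show "tens_ext s H K \<beta> (tens H K x y) = \<beta> x y" if "x \<in> hcar H" "y \<in> hcar K" for x y
    using val[OF that] unfolding eq .
  show "tens_ext s H K \<beta> T = (\<Sum>e\<in>hbasis H. \<Sum>f\<in>hbasis K. s (T e f) (\<beta> e f))"
    if "T \<in> hcar (htens H K)" for T using that unfolding eq by simp
qed

end

section \<open>Positive operators and eigenvectors\<close>

context fd_hilbert_space
begin

definition psd :: "('v \<Rightarrow> 'v) \<Rightarrow> bool" where
  "psd P \<longleftrightarrow> P \<in> hhom H H \<and> (\<forall>x\<in>hcar H. Im (hip H x (P x)) = 0 \<and> Re (hip H x (P x)) \<ge> 0)"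

end

lemma conjugate_by_polarisation:
  fixes B C :: complex
  assumes "Im (B + C) = 0" "Im (\<i> * B + cnj \<i> * C) = 0"
  shows "C = cnj B"
  using assms by (simp add: complex_eq_iff)

context fd_hilbert_space
begin

interpretation HH: hilbert_pair H H by unfold_locales

lemma psd_hermitian:
  assumes P: "psd P" and x: "x \<in> hcar H" and y: "y \<in> hcar H"
  shows "hip H y (P x) = cnj (hip H x (P y))"
proof (rule conjugate_by_polarisation)
  have lin: "P \<in> hhom H H" using P by (simp add: psd_def)
  have Im0: "Im (hip H z (P z)) = 0" if "z \<in> hcar H" for z using P that by (auto simp: psd_def)
  have "Im (hip H x (P y) + hip H y (P x)) = 0 \<and> Im (\<i> * hip H x (P y) + cnj \<i> * hip H y (P x)) = 0"
    using Im0[of "x + y"] Im0[of "x + hsc H \<i> y"] Im0[OF x] Im0[OF y] x y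
    by (simp add: hhomD[OF lin] ip_add ip_add_left ip_scale ip_scale_left)
  then show "Im (hip H x (P y) + hip H y (P x)) = 0"
    "Im (\<i> * hip H x (P y) + cnj \<i> * hip H y (P x)) = 0" by auto
qed

text \<open>
  Were \<open>P x \<noteq> 0\<close>, then \<open>\<langle>w|P w\<rangle>\<close> would be negative at \<open>w = x - t P x\<close> for small \<open>t > 0\<close>.
\<close>

lemma psd_kernel:
  assumes P: "psd P" and x: "x \<in> hcar H" and "hip H x (P x) = 0"
  shows "P x = 0"
proof -
  have lin: "P \<in> hhom H H" using P by (simp add: psd_def)
  have y: "P x \<in> hcar H" using lin x by (simp add: hhomD)
  define a where "a = Re (hip H (P x) (P x))"
  define b where "b = Re (hip H (P x) (P (P x)))"
  have a: "hip H (P x) (P x) = of_real a" "a \<ge> 0"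
    using ip_self_real[OF y] ip_self_nonneg[OF y] by (auto simp: a_def)
  have b: "b \<ge> 0" using P y by (auto simp: psd_def b_def)
  have "hip H x (P (P x)) = of_real a"
    using psd_hermitian[OF P y x] a by simp
  have *: "- 2 * t * a + t\<^sup>2 * b \<ge> 0" for t
  proof -
    let ?w = "x - hsc H (of_real t) (P x)"
    have w: "?w \<in> hcar H" using x y by auto
    have Pw: "P ?w = P x - hsc H (of_real t) (P (P x))"
      using x y by (simp add: lin_on_diff[OF hhomD(1)[OF lin]] hhomD(3)[OF lin])
    have "hip H ?w (P ?w) = - 2 * of_real t * of_real a + (of_real t)\<^sup>2 * hip H (P x) (P (P x))"
      unfolding Pw using x y hhomD(5)[OF lin] assms(3) a \<open>hip H x (P (P x)) = of_real a\<close>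
      by (simp add: ip_diff ip_diff_left ip_scale ip_scale_left algebra_simps power2_eq_square)
    then have "Re (hip H ?w (P ?w)) = - 2 * t * a + t\<^sup>2 * b"
      by (simp add: b_def power2_eq_square)
    then show ?thesis using P w by (auto simp: psd_def)
  qed
  have "a = 0"
  proof (rule ccontr)
    assume "a \<noteq> 0"
    with a have "a > 0" by simp
    \<comment> \<open>The \<open>+ 1\<close> is there because \<open>b\<close> may vanish.\<close>
    define t where "t = a / (b + 1)"
    have t: "t > 0" "t * b \<le> a" using \<open>a > 0\<close> b by (auto simp: t_def field_simps)
    have "t * (- 2 * a + t * b) \<ge> 0" using *[of t] by (simp add: algebra_simps power2_eq_square)
    then show False using t \<open>a > 0\<close> by (simp add: zero_le_mult_iff)
  qed
  then show ?thesis using a ip_self_0[OF y] by simp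
qed

text \<open>
  A step of Cholesky's algorithm: with \<open>y = P e / sqrt \<langle>e|P e\<rangle>\<close> the operator \<open>P - |y\<rangle>\<langle>y|\<close> kills \<open>e\<close>,
  and its quadratic form at \<open>z\<close> is that of \<open>P\<close> at \<open>z - c e\<close> for a suitable scalar \<open>c\<close>.
\<close>

lemma psd_step:
  assumes P: "psd P" and e: "e \<in> hcar H"
  shows "\<exists>y\<in>hcar H. \<exists>Q. psd Q \<and> Q e = 0 \<and> (\<forall>z\<in>hcar H. P z = Q z + hsc H (hip H y z) y) \<and>
    (\<forall>z\<in>hcar H. P z = 0 \<longrightarrow> Q z = 0)"
proof (cases "hip H e (P e) = 0")
  case True
  then have "P e = 0" by (rule psd_kernel[OF P e])
  then show ?thesis using P by (intro bexI[of _ 0] exI[of _ P]) auto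
next
  case False
  have lin: "P \<in> hhom H H" using P by (simp add: psd_def)
  have Pe: "P e \<in> hcar H" using lin e by (simp add: hhomD)
  define p where "p = Re (hip H e (P e))"
  have p: "hip H e (P e) = of_real p" "p > 0"
    using P e False by (auto simp: psd_def p_def complex_eq_iff less_le)
  define r where "r = complex_of_real (1 / sqrt p)"
  define y where "y = hsc H r (P e)"
  have y: "y \<in> hcar H" using Pe by (auto simp: y_def)
  have r: "r * r = of_real (1 / p)" "cnj r = r"
    using p(2) by (simp_all add: r_def flip: of_real_mult)
  define Q where "Q = (\<lambda>z. if z \<in> hcar H then P z - hsc H (hip H y z) y else 0)"
  have herm: "hip H (P e) z = hip H e (P z)" if "z \<in> hcar H" for z
    using psd_hermitian[OF P e that] ip_cnj[OF that Pe] by simp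
  have yz: "hip H y z = r * hip H e (P z)" if "z \<in> hcar H" for z
    using Pe that by (simp add: y_def ip_scale_left herm r(2))
  have Q_eq: "Q z = P z - hsc H (of_real (1 / p) * hip H e (P z)) (P e)" if "z \<in> hcar H" for z
  proof -
    have "hsc H (hip H y z) y = hsc H (r * r * hip H e (P z)) (P e)"
      unfolding yz[OF that] by (simp add: y_def mult_ac)
    then show ?thesis using that unfolding r(1) by (simp add: Q_def)
  qed
  have Q: "Q \<in> hhom H H"
    using y hhomD(5)[OF lin]
    by (intro hhomI) (auto simp: Q_def hhomD(2,3)[OF lin] ip_add ip_scale scale_left_distrib
        scale_right_diff_distrib)
  have pos: "Im (hip H z (Q z)) = 0 \<and> Re (hip H z (Q z)) \<ge> 0" if z: "z \<in> hcar H" for z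
  proof -
    \<comment> \<open>This \<open>c\<close> minimises the quadratic form of \<open>P\<close> at \<open>z - c e\<close>.\<close>
    define c where "c = of_real (1 / p) * hip H e (P z)"
    let ?w = "z - hsc H c e"
    have w: "?w \<in> hcar H" using z e by auto
    have Pw: "P ?w = Q z"
      using z e by (simp add: lin_on_diff[OF hhomD(1)[OF lin]] hhomD(3)[OF lin] Q_eq c_def)
    have "hip H e (Q z) = 0"
      using z e p Pe hhomD(5)[OF lin z] by (simp add: Q_eq ip_diff ip_scale)
    then have "hip H ?w (P ?w) = hip H z (Q z)"
      using z e hhomD(5)[OF Q z] by (simp add: Pw ip_diff_left ip_scale_left)
    then show ?thesis using P w by (auto simp: psd_def)
  qed
  have "psd Q" using Q pos by (auto simp: psd_def)
  moreover have "Q e = 0" using e p by (simp add: Q_eq)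
  moreover have "\<forall>z\<in>hcar H. P z = Q z + hsc H (hip H y z) y" by (simp add: Q_def)
  moreover have "\<forall>z\<in>hcar H. P z = 0 \<longrightarrow> Q z = 0" using e by (simp add: Q_eq)
  ultimately show ?thesis using y by blast
qed

text \<open>
  Running the step through an orthonormal basis leaves an operator that kills the whole basis, hence \<open>0\<close>.
\<close>

lemma psd_rank_one_sum:
  assumes "psd P"
  shows "\<exists>y. (\<forall>e\<in>hbasis H. y e \<in> hcar H) \<and>
    (\<forall>z\<in>hcar H. P z = (\<Sum>e\<in>hbasis H. hsc H (hip H (y e) z) (y e)))"
proof -
  have "\<exists>y. (\<forall>e\<in>S. y e \<in> hcar H) \<and> (\<forall>z\<in>hcar H. P z = (\<Sum>e\<in>S. hsc H (hip H (y e) z) (y e)))"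
    if "finite S" "S \<subseteq> hbasis H" "psd P" "\<forall>f\<in>hbasis H - S. P f = 0" for S P
    using that
  proof (induction S arbitrary: P rule: finite_induct)
    case empty
    have "P z = 0" if "z \<in> hcar H" for z
      using lin_on_expand[OF hhomD(1) that, of P H] empty by (simp add: psd_def)
    then show ?case by simp
  next
    case (insert e S)
    then have e: "e \<in> hcar H" by auto
    obtain y Q where y: "y \<in> hcar H" and Q: "psd Q" "Q e = 0"
      "\<forall>z\<in>hcar H. P z = Q z + hsc H (hip H y z) y" "\<forall>z\<in>hcar H. P z = 0 \<longrightarrow> Q z = 0"
      using psd_step[OF insert.prems(2) e] by blast
    have Q0: "\<forall>f\<in>hbasis H - S. Q f = 0" using Q insert.prems by auto
    have "S \<subseteq> hbasis H" using insert.prems by blast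
    note IH = insert.IH[OF this Q(1) Q0]
    from IH obtain ys where ys: "\<forall>e\<in>S. ys e \<in> hcar H"
      "\<forall>z\<in>hcar H. Q z = (\<Sum>e\<in>S. hsc H (hip H (ys e) z) (ys e))"
      by blast
    have "(\<Sum>f\<in>S. hsc H (hip H ((ys(e := y)) f) z) ((ys(e := y)) f)) =
        (\<Sum>f\<in>S. hsc H (hip H (ys f) z) (ys f))" for z
      using insert.hyps by (intro sum.cong) auto
    then show ?case using ys y Q(3) insert.hyps
      by (intro exI[of _ "ys(e := y)"]) (auto simp: add.commute)
  qed
  from this[of "hbasis H" P] assms show ?thesis by simp
qed

text \<open>
  If \<open>P = \<Sum>\<^sub>e |y\<^sub>e\<rangle>\<langle>y\<^sub>e|\<close> over an orthonormal basis, then \<open>P = g\<^sup>* g\<close> for \<open>g = \<Sum>\<^sub>e |e\<rangle>\<langle>y\<^sub>e|\<close>.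
\<close>

lemma positive_ops_eq: "positive_ops H = {P. psd P}"
proof (intro set_eqI iffI)
  fix P assume "P \<in> positive_ops H"
  then obtain g where g: "g \<in> hhom H H" "P = hadj H H g \<circ> g" by (auto simp: positive_ops_def)
  have gx: "g x \<in> hcar H" if "x \<in> hcar H" for x using g that by (simp add: hhomD)
  have "P \<in> hhom H H"
    unfolding g(2) by (intro hhom_comp[OF g(1) HH.hadj_hhom[OF g(1)]] fd_hilbert_space_axioms)
      (unfold_locales)
  moreover have "hip H x (P x) = hip H (g x) (g x)" if "x \<in> hcar H" for x
    using HH.hadj_ip[OF g(1) that gx[OF that]] g(2) by simp
  ultimately show "P \<in> {P. psd P}"
    using ip_self_real[OF gx] ip_self_nonneg[OF gx] by (auto simp: psd_def complex_eq_iff)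
next
  fix P assume "P \<in> {P. psd P}"
  then have P: "psd P" by simp
  then have lin: "P \<in> hhom H H" by (simp add: psd_def)
  obtain y where y: "\<And>e. e \<in> hbasis H \<Longrightarrow> y e \<in> hcar H"
    "\<And>z. z \<in> hcar H \<Longrightarrow> P z = (\<Sum>e\<in>hbasis H. hsc H (hip H (y e) z) (y e))"
    using psd_rank_one_sum[OF P] by blast
  define g where "g = (\<lambda>z. if z \<in> hcar H then \<Sum>e\<in>hbasis H. hsc H (hip H (y e) z) e else 0)"
  define g' where "g' = (\<lambda>w. if w \<in> hcar H then \<Sum>e\<in>hbasis H. hsc H (hip H e w) (y e) else 0)"
  have g: "g \<in> hhom H H"
    by (rule hhomI) (auto simp: g_def y ip_add ip_scale scale_left_distrib sum.distrib
        scale_sum_right carr_sum intro!: carr_sum)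
  have g': "g' \<in> hhom H H"
    by (rule hhomI) (auto simp: g'_def y ip_add ip_scale scale_left_distrib sum.distrib
        scale_sum_right carr_sum intro!: carr_sum)
  have "hadj H H g = g'"
  proof (rule HH.hadj_eqI[OF g g'])
    fix x w assume xw: "x \<in> hcar H" "w \<in> hcar H"
    have "hip H x (y e) = cnj (hip H (y e) x)" if "e \<in> hbasis H" for e
      by (rule ip_cnj) (use that y xw in auto)
    note yx = this
    have "hip H (g x) w = (\<Sum>e\<in>hbasis H. cnj (hip H (y e) x) * hip H e w)"
      using xw y by (simp add: g_def ip_sum_left ip_scale_left)
    also have "\<dots> = hip H x (g' w)"
      using xw y by (simp add: g'_def ip_sum ip_scale yx mult.commute)
    finally show "hip H (g x) w = hip H x (g' w)" .
  qed
  moreover have "P = g' \<circ> g"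
  proof
    fix z
    show "P z = (g' \<circ> g) z"
    proof (cases "z \<in> hcar H")
      case True
      have "hip H e (g z) = hip H (y e) z" if "e \<in> hbasis H" for e
        using that True by (simp add: g_def ip_sum ip_scale mult.commute[of "hip H (y _) z"] hbasis_sum)
      moreover have "g z \<in> hcar H" using g True by (simp add: hhomD)
      ultimately show ?thesis using True by (simp add: y(2) g'_def)
    next
      case False
      then show ?thesis using lin_on_0[OF hhomD(1)[OF g']] by (simp add: g_def hhomD(4)[OF lin])
    qed
  qed
  ultimately show "P \<in> positive_ops H" using g by (auto simp: positive_ops_def)
qed

text \<open>
  Let \<open>p\<close> be a polynomial of least degree with \<open>p(K) v0 = 0\<close> and \<open>\<mu>\<close> a root of it, \<open>p = (X - \<mu>) q\<close>.
  Then \<open>q(K) v0\<close> is an eigenvector.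
\<close>

lemma invariant_eigenvector:
  assumes K: "lin_on H (hsc H) K" and V: "subspace V" "V \<subseteq> hcar H" and inv: "\<And>v. v \<in> V \<Longrightarrow> K v \<in> V"
    and v0: "v0 \<in> V" "v0 \<noteq> 0"
  shows "\<exists>\<mu> w. w \<in> V \<and> w \<noteq> 0 \<and> K w = hsc H \<mu> w"
proof -
  \<comment> \<open>\<open>act p\<close> is \<open>p(K) v0\<close>.\<close>
  define act where "act = (\<lambda>(p :: complex poly). \<Sum>i\<le>degree p. hsc H (coeff p i) ((K ^^ i) v0))"
  have Ki: "(K ^^ i) v0 \<in> V" for i by (induction i) (auto simp: inv v0)
  then have Kc: "(K ^^ i) v0 \<in> hcar H" for i using V by auto
  have act_ge: "act p = (\<Sum>i\<le>n. hsc H (coeff p i) ((K ^^ i) v0))" if "n \<ge> degree p" for p n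
    unfolding act_def using that by (intro sum.mono_neutral_left) (auto simp: coeff_eq_0)
  have act_add: "act (p + q) = act p + act q" for p q
    using degree_add_le_max[of p q]
    by (simp add: act_ge[of _ "max (degree p) (degree q)"] scale_left_distrib sum.distrib)
  have act_smult: "act (smult c p) = hsc H c (act p)" for c p
    using degree_smult_le[of c p]
    by (simp add: act_ge[of _ "degree p"] scale_sum_right)
  have act_X: "act (pCons 0 p) = K (act p)" for p
  proof -
    have "act (pCons 0 p) = (\<Sum>i\<le>Suc (degree p). hsc H (coeff (pCons 0 p) i) ((K ^^ i) v0))"
      by (intro act_ge degree_pCons_le)
    also have "\<dots> = (\<Sum>i\<le>degree p. hsc H (coeff p i) (K ((K ^^ i) v0)))"
      by (subst sum.atMost_Suc_shift) simp
    also have "\<dots> = K (act p)"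
      unfolding act_def using Kc by (simp add: lin_on_sum[OF K] lin_onD(2)[OF K])
    finally show ?thesis .
  qed
  have act_sum: "act (\<Sum>i\<in>I. f i) = (\<Sum>i\<in>I. act (f i))" for f and I :: "'v set"
    by (induction I rule: infinite_finite_induct) (auto simp: act_add, auto simp: act_def)
  have act_monom: "act (monom c n) = hsc H c ((K ^^ n) v0)" for c n
  proof -
    have "act (monom c n) = (\<Sum>i\<le>n. hsc H (coeff (monom c n) i) ((K ^^ i) v0))"
      by (intro act_ge degree_monom_le)
    also have "\<dots> = (\<Sum>i\<le>n. if i = n then hsc H c ((K ^^ i) v0) else 0)"
      by (intro sum.cong) auto
    finally show ?thesis by simp
  qed
  have actV: "act p \<in> V" for p
    unfolding act_def using Ki by (intro subspace_sum subspace_scale V)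
  have "\<exists>p. p \<noteq> 0 \<and> act p = 0"
  proof (cases "inj (\<lambda>i. (K ^^ i) v0)")
    case False
    then obtain i j where "i \<noteq> j" "(K ^^ i) v0 = (K ^^ j) v0" unfolding inj_def by blast
    define p where "p = monom 1 i + smult (-1) (monom (1 :: complex) j)"
    have "act p = 0"
      unfolding p_def act_add act_smult act_monom using \<open>(K ^^ i) v0 = (K ^^ j) v0\<close> by simp
    moreover have "coeff p i = 1" using \<open>i \<noteq> j\<close> by (simp add: p_def)
    ultimately show ?thesis by (intro exI[of _ p]) auto
  next
    case True
    let ?S = "range (\<lambda>i. (K ^^ i) v0)"
    have "infinite ?S" using True finite_imageD by blast
    moreover have "?S \<subseteq> span (hbasis H)" using Kc hbasis by auto
    ultimately have "dependent ?S"
      using independent_span_bound[of "hbasis H" ?S] by auto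
    then obtain t u v where t: "finite t" "t \<subseteq> ?S" "(\<Sum>v\<in>t. hsc H (u v) v) = 0" "v \<in> t" "u v \<noteq> 0"
      unfolding dependent_explicit by blast
    define idx where "idx = (\<lambda>v. SOME i. v = (K ^^ i) v0)"
    have idx: "(K ^^ idx v) v0 = v" if "v \<in> t" for v
    proof -
      have "\<exists>i. v = (K ^^ i) v0" using t(2) that by auto
      from someI_ex[OF this] show ?thesis by (simp add: idx_def)
    qed
    have inj: "idx w = idx v \<longleftrightarrow> w = v" if "w \<in> t" for w
      using idx[OF that] idx[OF t(4)] by metis
    let ?p = "\<Sum>v\<in>t. monom (u v) (idx v)"
    have "act ?p = 0" using t(3) by (simp add: act_sum act_monom idx)
    moreover have "coeff ?p (idx v) = u v"
    proof -
      have "coeff ?p (idx v) = (\<Sum>w\<in>t. if w = v then u w else 0)"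
        unfolding coeff_sum using inj by (intro sum.cong) auto
      then show ?thesis using t by simp
    qed
    ultimately show ?thesis using t(5) by (metis coeff_0)
  qed
  then obtain p0 where "p0 \<noteq> 0 \<and> act p0 = 0" by blast
  from ex_has_least_nat[of "\<lambda>p. p \<noteq> 0 \<and> act p = 0", OF this, of degree]
  obtain p where p: "p \<noteq> 0" "act p = 0" and least: "\<And>q. q \<noteq> 0 \<Longrightarrow> act q = 0 \<Longrightarrow> degree p \<le> degree q"
    by blast
  have "degree p \<noteq> 0"
  proof
    assume d: "degree p = 0"
    then have "act p = hsc H (coeff p 0) v0" by (simp add: act_def)
    then have "coeff p 0 = 0" using p(2) v0 by simp
    then show False using d p(1) by (metis leading_coeff_0_iff)
  qed
  then obtain \<mu> where "poly p \<mu> = 0"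
    using fundamental_theorem_of_algebra[of p] constant_degree[of p] by auto
  then obtain q where q: "p = [:- \<mu>, 1:] * q" by (auto simp: poly_eq_0_iff_dvd dvd_def)
  then have "q \<noteq> 0" using p by auto
  then have "degree p = Suc (degree q)" unfolding q by (subst degree_mult_eq) auto
  then have "act q \<noteq> 0" using least[OF \<open>q \<noteq> 0\<close>] by auto
  have "act p = K (act q) + hsc H (- \<mu>) (act q)"
  proof -
    have "p = pCons 0 q + smult (- \<mu>) q" unfolding q by simp
    then show ?thesis by (simp only: act_add act_X act_smult)
  qed
  then have "K (act q) = hsc H \<mu> (act q)" using p(2) by simp
  then show ?thesis using actV \<open>act q \<noteq> 0\<close> by blast
qed

lemma dim_strict_mono:
  assumes "subspace V" "V \<subset> W" "W \<subseteq> hcar H"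
  shows "dim V < dim W"
proof -
  obtain B where B: "B \<subseteq> V" "independent B" "V \<subseteq> span B" "card B = dim V"
    using basis_exists by blast
  obtain x where x: "x \<in> W" "x \<notin> V" using assms by auto
  have "span B \<subseteq> V" using B(1) assms(1) by (rule span_minimal)
  then have "x \<notin> span B" using x by auto
  then have ind: "independent (insert x B)" using B by (simp add: independent_insertI)
  have "insert x B \<subseteq> W" using B x assms by auto
  from maximal_independent_subset_extend[OF this ind] obtain B' where
    B': "insert x B \<subseteq> B'" "B' \<subseteq> W" "independent B'" "W \<subseteq> span B'" by blast
  have "B' \<subseteq> span (hbasis H)" using B' assms hbasis by auto
  then have "finite B'" using independent_span_bound[of "hbasis H" B'] B' by auto
  moreover have "dim W = card B'" using B' by (intro dim_unique) auto
  moreover have "x \<notin> B" using \<open>x \<notin> span B\<close> span_base by auto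
  ultimately show ?thesis
    using B(4) B'(1) card_mono[of B' "insert x B"] finite_subset[of B B'] by auto
qed

end

section \<open>The functor on elements\<close>

context cstar_tensor_category
begin

lemma hom_add: "f \<in> hom C a b \<Longrightarrow> g \<in> hom C a b \<Longrightarrow> f + g \<in> hom C a b"
  and hom_scl: "f \<in> hom C a b \<Longrightarrow> scl C z f \<in> hom C a b"
  and hom_0 [simp]: "0 \<in> hom C a b"
  and hom_diff: "f \<in> hom C a b \<Longrightarrow> g \<in> hom C a b \<Longrightarrow> f - g \<in> hom C a b"
  by (simp_all add: subspace_add[OF hom_subspace] subspace_scale[OF hom_subspace]
      subspace_0[OF hom_subspace] subspace_diff[OF hom_subspace])

lemma hom_sum: "(\<And>i. i \<in> I \<Longrightarrow> f i \<in> hom C a b) \<Longrightarrow> (\<Sum>i\<in>I. f i) \<in> hom C a b"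
  by (rule subspace_sum[OF hom_subspace])

lemma struct_hom:
  "assc C a b c \<in> hom C ((a \<otimes> b) \<otimes> c) (a \<otimes> (b \<otimes> c))"
  "lunit C a \<in> hom C (unt C \<otimes> a) a" "runit C a \<in> hom C (a \<otimes> unt C) a"
  using assc_unitary lunit_unitary runit_unitary by (auto simp: unitary_mor_def)

end

context dagger_tensor_functor
begin

sublocale Fo: fd_hilbert_space "fob F a" for a by (rule fob_hilbert)

sublocale FF: hilbert_pair "fob F a" "fob F b" for a b by unfold_locales

sublocale Te: fd_hilbert_space "htens (fob F a) (fob F b)" for a b by (rule FF.htens_hilbert)

sublocale Te_pair: hilbert_pair "htens (fob F a) (fob F b)" "fob F c" for a b c by unfold_locales

sublocale Fo_complex: hilbert_pair "fob F a" hcomplex for a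
  by (intro hilbert_pairI hcomplex_hilbert) unfold_locales

abbreviation car :: "'o \<Rightarrow> 'v set" where "car a \<equiv> hcar (fob F a)"
abbreviation ip :: "'o \<Rightarrow> 'v \<Rightarrow> 'v \<Rightarrow> complex" where "ip a \<equiv> hip (fob F a)"
abbreviation sc :: "'o \<Rightarrow> complex \<Rightarrow> 'v \<Rightarrow> 'v" where "sc a \<equiv> hsc (fob F a)"
abbreviation bas :: "'o \<Rightarrow> 'v set" where "bas a \<equiv> hbasis (fob F a)"

lemmas fmor_add_arg = hhomD(2)[OF fmor_hom]
lemmas fmor_scale_arg = hhomD(3)[OF fmor_hom]
lemmas fmor_carr = hhomD(5)[OF fmor_hom]
lemmas fmor_lin = hhomD(1)[OF fmor_hom]

lemma fmor_sum_arg: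
  "f \<in> hom C a b \<Longrightarrow> (\<And>i. i \<in> I \<Longrightarrow> g i \<in> car a) \<Longrightarrow>
    fmor F f (\<Sum>i\<in>I. g i) = (\<Sum>i\<in>I. fmor F f (g i))"
  by (rule Fo.lin_on_sum[OF fmor_lin])

lemma fmor_0_arg: "f \<in> hom C a b \<Longrightarrow> fmor F f 0 = 0"
  by (rule Fo.lin_on_0[OF fmor_lin])

lemma fmor_comp_apply:
  "\<lbrakk>f \<in> hom C a b; g \<in> hom C b c\<rbrakk> \<Longrightarrow> fmor F (g \<cdot> f) x = fmor F g (fmor F f x)"
  by (simp add: fmor_comp)

lemma fmor_id_apply: "x \<in> car a \<Longrightarrow> fmor F (idm C a) x = x"
  by (simp add: fmor_id hid_def)

lemma fmor_0: "x \<in> car a \<Longrightarrow> fmor F 0 x = 0"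
  using fmor_scl[of 0 a a x 0] by simp

lemma fmor_sum:
  assumes "\<And>i. i \<in> I \<Longrightarrow> g i \<in> hom C a b" "x \<in> car a"
  shows "fmor F (\<Sum>i\<in>I. g i) x = (\<Sum>i\<in>I. fmor F (g i) x)"
  using assms(1)
proof (induction I rule: infinite_finite_induct)
  case (insert i I)
  then have "fmor F (g i + (\<Sum>i\<in>I. g i)) x = fmor F (g i) x + fmor F (\<Sum>i\<in>I. g i) x"
    using assms(2) by (intro fmor_add) (auto intro!: hom_sum)
  then show ?case using insert by simp
qed (use fmor_0[OF assms(2)] in auto)

lemma fmor_diff:
  assumes "f \<in> hom C a b" "g \<in> hom C a b" "x \<in> car a"
  shows "fmor F (f - g) x = fmor F f x - fmor F g x"
  using fmor_add[of "f - g" a b g x] assms by (simp add: hom_diff)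

lemma fmor_ip:
  assumes "f \<in> hom C a b" "x \<in> car a" "y \<in> car b"
  shows "ip b (fmor F f x) y = ip a x (fmor F (dag C f) y)"
    and "ip b y (fmor F f x) = ip a (fmor F (dag C f) y) x"
  using FF.hadj_ip[OF fmor_hom assms(2,3)] FF.hadj_ip'[OF fmor_hom assms(2,3)] assms(1)
  by (auto simp: fmor_dag)

subsection \<open>The tensorator\<close>

text \<open>
  The tensorator on elementary tensors.  Together with the next lemmas it allows one to compute with
  elements and to leave the realisation of the tensor product behind.
\<close>

definition et :: "'o \<Rightarrow> 'o \<Rightarrow> 'v \<Rightarrow> 'v \<Rightarrow> 'v" where
  "et a b x y = feta F a b (tens (fob F a) (fob F b) x y)"

lemma feta_hom: "feta F a b \<in> hhom (htens (fob F a) (fob F b)) (fob F (a \<otimes> b))"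
  using eta_unitary by (auto simp: hunitary_def)

abbreviation feta_inv :: "'o \<Rightarrow> 'o \<Rightarrow> 'v \<Rightarrow> 'v \<Rightarrow> 'v \<Rightarrow> complex" where
  "feta_inv a b \<equiv> hadj (htens (fob F a) (fob F b)) (fob F (a \<otimes> b)) (feta F a b)"

lemma feta_inv_hom: "feta_inv a b \<in> hhom (fob F (a \<otimes> b)) (htens (fob F a) (fob F b))"
  by (rule Te_pair.hadj_hhom[OF feta_hom])

lemma feta_inv_feta: "T \<in> hcar (htens (fob F a) (fob F b)) \<Longrightarrow> feta_inv a b (feta F a b T) = T"
  and feta_feta_inv: "t \<in> car (a \<otimes> b) \<Longrightarrow> feta F a b (feta_inv a b t) = t"
proof -
  have "(feta_inv a b \<circ> feta F a b) T = hid (htens (fob F a) (fob F b)) T"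
    "(feta F a b \<circ> feta_inv a b) t = hid (fob F (a \<otimes> b)) t"
    using eta_unitary[of a b] unfolding hunitary_def by simp_all
  then show "T \<in> hcar (htens (fob F a) (fob F b)) \<Longrightarrow> feta_inv a b (feta F a b T) = T"
    "t \<in> car (a \<otimes> b) \<Longrightarrow> feta F a b (feta_inv a b t) = t"
    by (simp_all add: hid_def)
qed

lemma et_bilin: "bilin_on (fob F a) (fob F b) (sc (a \<otimes> b)) (et a b)"
proof (rule bilin_onI)
  note d = bilin_onD[OF FF.tens_bilin[of a b]] and t = FF.tens_carr and e = hhomD(2,3)[OF feta_hom[of a b]]
  fix x x' y y' c
  show "et a b (x + x') y = et a b x y + et a b x' y" if "x \<in> car a" "x' \<in> car a" "y \<in> car b"
    using that by (simp add: et_def d t e)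
  show "et a b x (y + y') = et a b x y + et a b x y'" if "x \<in> car a" "y \<in> car b" "y' \<in> car b"
    using that by (simp add: et_def d t e)
  assume xy: "x \<in> car a" "y \<in> car b"
  have "feta F a b (\<lambda>v w. c * tens (fob F a) (fob F b) x y v w) =
      sc (a \<otimes> b) c (feta F a b (tens (fob F a) (fob F b) x y))"
    using e(2)[OF t[OF xy], of c] by simp
  then show "et a b (sc a c x) y = sc (a \<otimes> b) c (et a b x y)"
    "et a b x (sc b c y) = sc (a \<otimes> b) c (et a b x y)"
    using xy by (simp_all add: et_def d)
qed

lemmas et_add_left = bilin_onD(1)[OF et_bilin]
  and et_scale_left = bilin_onD(2)[OF et_bilin]
  and et_add_right = bilin_onD(3)[OF et_bilin]
  and et_scale_right = bilin_onD(4)[OF et_bilin]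
  and et_sum_left = FF.bilin_on_sum_left[OF et_bilin]
  and et_sum_right = FF.bilin_on_sum_right[OF et_bilin]

lemma et_carr [simp, intro]: "x \<in> car a \<Longrightarrow> y \<in> car b \<Longrightarrow> et a b x y \<in> car (a \<otimes> b)"
  unfolding et_def by (intro hhomD(5)[OF feta_hom] FF.tens_carr)

lemma fmor_et:
  "\<lbrakk>f \<in> hom C a a'; g \<in> hom C b b'; x \<in> car a; y \<in> car b\<rbrakk> \<Longrightarrow>
    fmor F (f \<boxtimes> g) (et a b x y) = et a' b' (fmor F f x) (fmor F g y)"
  unfolding et_def by (rule eta_natural)

lemma et_expand:
  assumes "t \<in> car (a \<otimes> b)"
  shows "t = (\<Sum>e\<in>bas a. \<Sum>f\<in>bas b.
    sc (a \<otimes> b) (ip (a \<otimes> b) (et a b e f) t) (et a b e f))"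
proof -
  define T where "T = feta_inv a b t"
  have T: "T \<in> hcar (htens (fob F a) (fob F b))" "t = feta F a b T"
    using feta_feta_inv[OF assms] hhomD(5)[OF feta_inv_hom assms] by (simp_all add: T_def)
  have Tef: "T e f = ip (a \<otimes> b) (et a b e f) t" if "e \<in> bas a" "f \<in> bas b" for e f
  proof -
    have "ip (a \<otimes> b) (et a b e f) t = hip (htens (fob F a) (fob F b)) (tens (fob F a) (fob F b) e f) T"
      unfolding et_def T_def using that assms by (intro Te_pair.hadj_ip[OF feta_hom] FF.tens_carr) auto
    also have "\<dots> = T e f" by (rule FF.hip_tens_basis[OF that])
    finally show ?thesis by simp
  qed
  have Tc: "(\<lambda>v w. T e f * tens (fob F a) (fob F b) e f v w) \<in> hcar (htens (fob F a) (fob F b))"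
    if "e \<in> bas a" "f \<in> bas b" for e f
    using Te.carr_scale[OF FF.tens_carr, of e a f b "T e f"] that by simp
  have "feta F a b T = feta F a b (\<Sum>e\<in>bas a. \<Sum>f\<in>bas b.
      (\<lambda>v w. T e f * tens (fob F a) (fob F b) e f v w))"
    using FF.conj_bilin_expand[of a b T] T(1) by (simp add: FF.htens_carrier)
  also have "\<dots> = (\<Sum>e\<in>bas a. \<Sum>f\<in>bas b.
      feta F a b (\<lambda>v w. T e f * tens (fob F a) (fob F b) e f v w))"
    using Tc by (simp add: Te.lin_on_sum[OF hhomD(1)[OF feta_hom]] Te.carr_sum)
  also have "\<dots> = (\<Sum>e\<in>bas a. \<Sum>f\<in>bas b. sc (a \<otimes> b) (T e f) (et a b e f))"
    using hhomD(3)[OF feta_hom FF.tens_carr] by (intro sum.cong refl) (simp add: et_def)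
  finally show ?thesis using Tef T(2) by simp
qed

lemma lin_on_et_eqI:
  assumes "lin_on (fob F (a \<otimes> b)) s h" "lin_on (fob F (a \<otimes> b)) s h'"
    and "\<And>x y. x \<in> car a \<Longrightarrow> y \<in> car b \<Longrightarrow> h (et a b x y) = h' (et a b x y)"
  shows "h = h'"
proof (rule Fo.lin_on_eqI[OF assms(1,2)])
  fix t assume t: "t \<in> car (a \<otimes> b)"
  have *: "g t = (\<Sum>e\<in>bas a. \<Sum>f\<in>bas b.
      s (ip (a \<otimes> b) (et a b e f) t) (g (et a b e f)))" if g: "lin_on (fob F (a \<otimes> b)) s g" for g
    by (subst et_expand[OF t]) (simp add: Fo.lin_on_sum[OF g] Fo.carr_sum lin_onD(2)[OF g])
  show "h t = h' t" unfolding *[OF assms(1)] *[OF assms(2)] using assms(3) by simp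
qed

subsection \<open>The unit object and the coherence morphisms\<close>

text \<open>
  The vector of \<open>F(1)\<close> that corresponds to \<open>1 \<in> \<complex>\<close>; morphisms \<open>1 \<rightarrow> a\<close> are evaluated at it.
\<close>

definition u0 :: 'v where "u0 = hadj (fob F (unt C)) hcomplex (fone F) 1"

lemma fone_hom: "fone F \<in> hhom (fob F (unt C)) hcomplex"
  using one_unitary by (auto simp: hunitary_def)

lemmas fone_add = hhomD(2)[OF fone_hom]
  and fone_scale = hhomD(3)[OF fone_hom, simplified]
  and fone_lin = hhomD(1)[OF fone_hom, simplified]
lemmas fone_sum = Fo.lin_on_sum[OF fone_lin]

lemma u0_carr [simp]: "u0 \<in> car (unt C)"
  unfolding u0_def by (rule Fo_complex.hadj_carr[OF fone_hom]) simp

lemma fone_u0 [simp]: "fone F u0 = 1"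
proof -
  have "(fone F \<circ> hadj (fob F (unt C)) hcomplex (fone F)) 1 = hid hcomplex 1"
    using one_unitary by (simp add: hunitary_def)
  then show ?thesis by (simp add: u0_def hid_def)
qed

lemma ip_u0: "x \<in> car (unt C) \<Longrightarrow> ip (unt C) u0 x = fone F x"
  using Fo_complex.hadj_ip'[OF fone_hom, of x 1] by (simp add: u0_def)

lemma unit_expand: assumes "x \<in> car (unt C)" shows "x = sc (unt C) (fone F x) u0"
proof -
  have "(hadj (fob F (unt C)) hcomplex (fone F) \<circ> fone F) x = x"
    using one_unitary assms by (simp add: hunitary_def hid_def)
  moreover have "hadj (fob F (unt C)) hcomplex (fone F) (hsc hcomplex (fone F x) 1) =
      sc (unt C) (fone F x) u0"
    unfolding u0_def by (rule hhomD(3)[OF Fo_complex.hadj_hhom[OF fone_hom]]) simp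
  ultimately show ?thesis by simp
qed

lemma fmor_dag_unitary:
  assumes "unitary_mor C a b u" "x \<in> car a" "fmor F u x = y"
  shows "fmor F (dag C u) y = x"
proof -
  have u: "u \<in> hom C a b" "dag C u \<cdot> u = idm C a" using assms by (auto simp: unitary_mor_def)
  then show ?thesis
    using fmor_comp_apply[OF u(1) dag_hom[OF u(1)], of x] assms(2,3) by (simp add: fmor_id_apply)
qed

lemma fmor_assc:
  "\<lbrakk>x \<in> car a; y \<in> car b; w \<in> car c\<rbrakk> \<Longrightarrow>
    fmor F (assc C a b c) (et (a \<otimes> b) c (et a b x y) w) = et a (b \<otimes> c) x (et b c y w)"
  unfolding et_def by (rule eta_assoc)

lemma fmor_assc_dag:
  "\<lbrakk>x \<in> car a; y \<in> car b; w \<in> car c\<rbrakk> \<Longrightarrow>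
    fmor F (dag C (assc C a b c)) (et a (b \<otimes> c) x (et b c y w)) = et (a \<otimes> b) c (et a b x y) w"
  by (rule fmor_dag_unitary[OF assc_unitary]) (auto simp: fmor_assc)

lemma fmor_lunit:
  "\<lbrakk>u \<in> car (unt C); x \<in> car a\<rbrakk> \<Longrightarrow>
    fmor F (lunit C a) (et (unt C) a u x) = sc a (fone F u) x"
  unfolding et_def by (rule eta_lunit)

lemma fmor_runit:
  "\<lbrakk>u \<in> car (unt C); x \<in> car a\<rbrakk> \<Longrightarrow>
    fmor F (runit C a) (et a (unt C) x u) = sc a (fone F u) x"
  unfolding et_def by (rule eta_runit)

lemma fmor_lunit_dag: "x \<in> car a \<Longrightarrow> fmor F (dag C (lunit C a)) x = et (unt C) a u0 x"
  by (rule fmor_dag_unitary[OF lunit_unitary]) (auto simp: fmor_lunit)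

lemma fmor_runit_dag: "x \<in> car a \<Longrightarrow> fmor F (dag C (runit C a)) x = et a (unt C) x u0"
  by (rule fmor_dag_unitary[OF runit_unitary]) (auto simp: fmor_runit)

subsection \<open>The duality pairings\<close>

definition pev :: "'o \<Rightarrow> 'v \<Rightarrow> 'v \<Rightarrow> complex" where
  "pev a x y = fone F (fmor F (ev C a) (et (bar C a) a x y))"

definition pevb :: "'o \<Rightarrow> 'v \<Rightarrow> 'v \<Rightarrow> complex" where
  "pevb a y x = fone F (fmor F (evb C a) (et a (bar C a) y x))"

lemma ev_hat_tens: "ev_hat C F a (tens (fob F (bar C a)) (fob F a) x y) = pev a x y"
  by (simp add: ev_hat_def hat_def pev_def et_def)

lemma evb_hat_tens: "evb_hat C F a (tens (fob F a) (fob F (bar C a)) y x) = pevb a y x"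
  by (simp add: evb_hat_def hat_def pevb_def et_def)

lemma pairing_bilin:
  assumes "m \<in> hom C (a \<otimes> b) (unt C)"
  shows "bilin_on (fob F a) (fob F b) (*) (\<lambda>x y. fone F (fmor F m (et a b x y)))"
  by (rule bilin_onI)
    (simp_all add: et_add_left et_add_right et_scale_left et_scale_right fmor_add_arg[OF assms]
      fmor_scale_arg[OF assms] fmor_carr[OF assms] fone_add fone_scale)

lemma pev_bilin: "bilin_on (fob F (bar C a)) (fob F a) (*) (pev a)"
  unfolding pev_def by (rule pairing_bilin[OF ev_hom])

text \<open>
  A pairing \<open>F(a) \<times> F(b) \<rightarrow> \<complex>\<close> that comes from a morphism \<open>m : a \<otimes> b \<rightarrow> 1\<close> is turned into
  a conjugate linear map \<open>F(a) \<rightarrow> F(b)\<close>.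
\<close>

definition pvec :: "'m \<Rightarrow> 'o \<Rightarrow> 'o \<Rightarrow> 'v \<Rightarrow> 'v" where
  "pvec m a b x = ket (fob F b) (\<lambda>y. if y \<in> car b then fone F (fmor F m (et a b x y)) else 0)"

context
  fixes m a b assumes m: "m \<in> hom C (a \<otimes> b) (unt C)"
begin

lemma pvec_functional:
  "x \<in> car a \<Longrightarrow> (\<lambda>y. if y \<in> car b then fone F (fmor F m (et a b x y)) else 0) \<in> hhom (fob F b) hcomplex"
  by (intro hhomI) (auto simp: bilin_onD[OF pairing_bilin[OF m]])

lemma pvec_carr: "x \<in> car a \<Longrightarrow> pvec m a b x \<in> car b"
  unfolding pvec_def by (rule Fo.ket_carr[OF pvec_functional])

lemma pvec_ip: "x \<in> car a \<Longrightarrow> y \<in> car b \<Longrightarrow> ip b (pvec m a b x) y = fone F (fmor F m (et a b x y))"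
  unfolding pvec_def by (subst Fo.ket_ip[OF pvec_functional]) auto

lemma pvec_ip': "x \<in> car a \<Longrightarrow> y \<in> car b \<Longrightarrow> ip b y (pvec m a b x) = cnj (fone F (fmor F m (et a b x y)))"
  using Fo.ip_cnj[of "pvec m a b x" b y] by (simp add: pvec_ip pvec_carr)

lemma pvec_add: "x \<in> car a \<Longrightarrow> x' \<in> car a \<Longrightarrow> pvec m a b (x + x') = pvec m a b x + pvec m a b x'"
  by (rule Fo.ip_ext[of _ b]) (auto simp: pvec_carr pvec_ip' Fo.ip_add bilin_onD[OF pairing_bilin[OF m]])

lemma pvec_scale: "x \<in> car a \<Longrightarrow> pvec m a b (sc a c x) = sc b (cnj c) (pvec m a b x)"
  by (rule Fo.ip_ext[of _ b]) (auto simp: pvec_carr pvec_ip' Fo.ip_scale bilin_onD[OF pairing_bilin[OF m]])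

lemma dag_u0: "fmor F (dag C m) u0 = (\<Sum>p\<in>bas a. et a b p (pvec m a b p))"
proof -
  have d: "fmor F (dag C m) u0 \<in> car (a \<otimes> b)" by (intro fmor_carr[OF dag_hom[OF m]]) simp
  have "fmor F (dag C m) u0 = (\<Sum>p\<in>bas a. \<Sum>q\<in>bas b. sc (a \<otimes> b) (ip (a \<otimes> b) (et a b p q) (fmor F (dag C m) u0)) (et a b p q))"
    by (rule et_expand[OF d])
  also have "\<dots> = (\<Sum>p\<in>bas a. \<Sum>q\<in>bas b. sc (a \<otimes> b) (ip b q (pvec m a b p)) (et a b p q))"
  proof (intro sum.cong refl, goal_cases)
    case (1 p q)
    then have *: "p \<in> car a" "q \<in> car b" by auto
    then have "ip (a \<otimes> b) (et a b p q) (fmor F (dag C m) u0) = ip (unt C) (fmor F m (et a b p q)) u0"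
      using fmor_ip(1)[OF m] by simp
    also have "\<dots> = cnj (fone F (fmor F m (et a b p q)))"
      using * ip_u0 fmor_carr[OF m] Fo.ip_cnj[of u0 "unt C" "fmor F m (et a b p q)"] by simp
    finally show ?case using * by (simp add: pvec_ip')
  qed
  also have "\<dots> = (\<Sum>p\<in>bas a. et a b p (pvec m a b p))"
  proof (rule sum.cong[OF refl])
    fix p assume p: "p \<in> bas a"
    have "et a b p (pvec m a b p) = et a b p (\<Sum>q\<in>bas b. sc b (ip b q (pvec m a b p)) q)"
      by (rule arg_cong[OF Fo.expand, where f = "et a b p"]) (use p pvec_carr in auto)
    then show "(\<Sum>q\<in>bas b. sc (a \<otimes> b) (ip b q (pvec m a b p)) (et a b p q)) = et a b p (pvec m a b p)"
      using p by (subst (asm) et_sum_right) (auto simp: et_scale_right)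
  qed
  finally show ?thesis .
qed

end

text \<open>
  For the two duality maps this gives conjugate linear maps between \<open>F(a)\<close> and \<open>F(bar a)\<close>, where
  \<open>cS a v\<close> is \<open>v\<^sup>\<sharp>\<close>.  The conjugate equations say that they are inverse to each other.
\<close>

definition cS :: "'o \<Rightarrow> 'v \<Rightarrow> 'v" where "cS a = pvec (evb C a) a (bar C a)"

definition cZ :: "'o \<Rightarrow> 'v \<Rightarrow> 'v" where "cZ a = pvec (ev C a) (bar C a) a"

lemmas cS_carr [simp, intro] = pvec_carr[OF evb_hom, folded cS_def]
  and cS_ip' = pvec_ip'[OF evb_hom, folded cS_def pevb_def]
  and cS_add = pvec_add[OF evb_hom, folded cS_def]
  and cS_scale = pvec_scale[OF evb_hom, folded cS_def]
  and dag_evb_u0 = dag_u0[OF evb_hom, folded cS_def]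
  and cS_ip = pvec_ip[OF evb_hom, folded cS_def pevb_def]

lemmas cZ_carr [simp, intro] = pvec_carr[OF ev_hom, folded cZ_def]
  and cZ_ip = pvec_ip[OF ev_hom, folded cZ_def pev_def]
  and cZ_ip' = pvec_ip'[OF ev_hom, folded cZ_def pev_def]
  and cZ_add = pvec_add[OF ev_hom, folded cZ_def]
  and cZ_scale = pvec_scale[OF ev_hom, folded cZ_def]
  and dag_ev_u0 = dag_u0[OF ev_hom, folded cZ_def]

lemma cZ_sum: "(\<And>i. i \<in> I \<Longrightarrow> g i \<in> car (bar C a)) \<Longrightarrow> cZ a (\<Sum>i\<in>I. g i) = (\<Sum>i\<in>I. cZ a (g i))"
proof (induction I rule: infinite_finite_induct)
  case (insert i I)
  then show ?case by (simp add: cZ_add Fo.carr_sum)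
qed (use cZ_scale[of 0 a 0] in auto)

lemma cS_expand: "v \<in> car a \<Longrightarrow> cS a v = (\<Sum>p\<in>bas a. sc (bar C a) (cnj (ip a p v)) (cS a p))"
proof -
  have "lin_on (fob F a) (\<lambda>c. sc (bar C a) (cnj c)) (\<lambda>x. if x \<in> car a then cS a x else 0)"
    by (intro lin_onI) (auto simp: cS_add cS_scale)
  from Fo.lin_on_expand[OF this] show "v \<in> car a \<Longrightarrow> ?thesis" by simp
qed

text \<open>
  Partial transposition.  A morphism \<open>x \<otimes> a \<rightarrow> 1\<close> is bent into a morphism \<open>x \<rightarrow> bar a\<close>, and
  a morphism \<open>bar a \<otimes> y \<rightarrow> 1\<close> into \<open>y \<rightarrow> a\<close>; for the evaluations this gives the identities.
\<close>

definition bend_right :: "'o \<Rightarrow> 'o \<Rightarrow> 'm \<Rightarrow> 'm" where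
  "bend_right x a m = lunit C (bar C a) \<cdot> (m \<boxtimes> idm C (bar C a)) \<cdot> dag C (assc C x a (bar C a)) \<cdot>
     (idm C x \<boxtimes> dag C (evb C a)) \<cdot> dag C (runit C x)"

definition bend_left :: "'o \<Rightarrow> 'o \<Rightarrow> 'm \<Rightarrow> 'm" where
  "bend_left a y m = runit C a \<cdot> (idm C a \<boxtimes> m) \<cdot> assc C a (bar C a) y \<cdot>
     (dag C (evb C a) \<boxtimes> idm C y) \<cdot> dag C (lunit C y)"

lemma bend_right:
  assumes m: "m \<in> hom C (x \<otimes> a) (unt C)"
  shows "bend_right x a m \<in> hom C x (bar C a)"
    and "z \<in> car x \<Longrightarrow> fmor F (bend_right x a m) z =
      (\<Sum>p\<in>bas a. sc (bar C a) (fone F (fmor F m (et x a z p))) (cS a p))"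
proof -
  let ?b = "bar C a"
  have h1: "dag C (runit C x) \<in> hom C x (x \<otimes> unt C)" by (intro dag_hom struct_hom)
  have h2: "idm C x \<boxtimes> dag C (evb C a) \<in> hom C (x \<otimes> unt C) (x \<otimes> (a \<otimes> ?b))"
    by (intro tmor_hom id_hom dag_hom evb_hom)
  have h3: "dag C (assc C x a ?b) \<in> hom C (x \<otimes> (a \<otimes> ?b)) ((x \<otimes> a) \<otimes> ?b)"
    by (intro dag_hom struct_hom)
  have h4: "m \<boxtimes> idm C ?b \<in> hom C ((x \<otimes> a) \<otimes> ?b) (unt C \<otimes> ?b)" by (intro tmor_hom id_hom m)
  have h5: "lunit C ?b \<in> hom C (unt C \<otimes> ?b) ?b" by (rule struct_hom)
  note h45 = comp_hom[OF h4 h5] note h345 = comp_hom[OF h3 h45] note h2345 = comp_hom[OF h2 h345]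
  show "bend_right x a m \<in> hom C x ?b" unfolding bend_right_def by (rule comp_hom[OF h1 h2345])
  assume z: "z \<in> car x"
  have c: "et x (a \<otimes> ?b) z (et a ?b p (cS a p)) \<in> car (x \<otimes> (a \<otimes> ?b))"
    "et (x \<otimes> a) ?b (et x a z p) (cS a p) \<in> car ((x \<otimes> a) \<otimes> ?b)"
    "et (unt C) ?b (fmor F m (et x a z p)) (cS a p) \<in> car (unt C \<otimes> ?b)"
    if "p \<in> bas a" for p
    using that z fmor_carr[OF m] by auto
  have "fmor F (bend_right x a m) z =
    fmor F (lunit C ?b) (fmor F (m \<boxtimes> idm C ?b) (fmor F (dag C (assc C x a ?b))
      (fmor F (idm C x \<boxtimes> dag C (evb C a)) (et x (unt C) z u0))))"
    unfolding bend_right_def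
    by (simp add: fmor_comp_apply[OF h1 h2345] fmor_comp_apply[OF h2 h345] fmor_comp_apply[OF h3 h45]
        fmor_comp_apply[OF h4 h5] fmor_runit_dag z)
  also have "fmor F (idm C x \<boxtimes> dag C (evb C a)) (et x (unt C) z u0) =
      (\<Sum>p\<in>bas a. et x (a \<otimes> ?b) z (et a ?b p (cS a p)))"
    using z by (simp add: fmor_et[OF id_hom dag_hom[OF evb_hom]] fmor_id_apply dag_evb_u0 et_sum_right)
  also have "fmor F (dag C (assc C x a ?b)) \<dots> = (\<Sum>p\<in>bas a. et (x \<otimes> a) ?b (et x a z p) (cS a p))"
    using z c by (simp add: fmor_sum_arg[OF h3] fmor_assc_dag)
  also have "fmor F (m \<boxtimes> idm C ?b) \<dots> = (\<Sum>p\<in>bas a. et (unt C) ?b (fmor F m (et x a z p)) (cS a p))"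
    using z c by (simp add: fmor_sum_arg[OF h4] fmor_et[OF m id_hom] fmor_id_apply)
  also have "fmor F (lunit C ?b) \<dots> =
      (\<Sum>p\<in>bas a. sc ?b (fone F (fmor F m (et x a z p))) (cS a p))"
    using z c by (simp add: fmor_sum_arg[OF h5] fmor_lunit fmor_carr[OF m])
  finally show "fmor F (bend_right x a m) z =
      (\<Sum>p\<in>bas a. sc ?b (fone F (fmor F m (et x a z p))) (cS a p))" .
qed

lemma bend_left:
  assumes m: "m \<in> hom C (bar C a \<otimes> y) (unt C)"
  shows "bend_left a y m \<in> hom C y a"
    and "z \<in> car y \<Longrightarrow> fmor F (bend_left a y m) z =
      (\<Sum>p\<in>bas a. sc a (fone F (fmor F m (et (bar C a) y (cS a p) z))) p)"
proof -
  let ?b = "bar C a"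
  have h1: "dag C (lunit C y) \<in> hom C y (unt C \<otimes> y)" by (intro dag_hom struct_hom)
  have h2: "dag C (evb C a) \<boxtimes> idm C y \<in> hom C (unt C \<otimes> y) ((a \<otimes> ?b) \<otimes> y)"
    by (intro tmor_hom id_hom dag_hom evb_hom)
  have h3: "assc C a ?b y \<in> hom C ((a \<otimes> ?b) \<otimes> y) (a \<otimes> (?b \<otimes> y))" by (rule struct_hom)
  have h4: "idm C a \<boxtimes> m \<in> hom C (a \<otimes> (?b \<otimes> y)) (a \<otimes> unt C)" by (intro tmor_hom id_hom m)
  have h5: "runit C a \<in> hom C (a \<otimes> unt C) a" by (rule struct_hom)
  note h45 = comp_hom[OF h4 h5] note h345 = comp_hom[OF h3 h45] note h2345 = comp_hom[OF h2 h345]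
  show "bend_left a y m \<in> hom C y a" unfolding bend_left_def by (rule comp_hom[OF h1 h2345])
  assume z: "z \<in> car y"
  have c: "et (a \<otimes> ?b) y (et a ?b p (cS a p)) z \<in> car ((a \<otimes> ?b) \<otimes> y)"
    "et a (?b \<otimes> y) p (et ?b y (cS a p) z) \<in> car (a \<otimes> (?b \<otimes> y))"
    "et a (unt C) p (fmor F m (et ?b y (cS a p) z)) \<in> car (a \<otimes> unt C)"
    if "p \<in> bas a" for p
    using that z fmor_carr[OF m] by auto
  have "fmor F (bend_left a y m) z =
    fmor F (runit C a) (fmor F (idm C a \<boxtimes> m) (fmor F (assc C a ?b y)
      (fmor F (dag C (evb C a) \<boxtimes> idm C y) (et (unt C) y u0 z))))"
    unfolding bend_left_def
    by (simp add: fmor_comp_apply[OF h1 h2345] fmor_comp_apply[OF h2 h345] fmor_comp_apply[OF h3 h45]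
        fmor_comp_apply[OF h4 h5] fmor_lunit_dag z)
  also have "fmor F (dag C (evb C a) \<boxtimes> idm C y) (et (unt C) y u0 z) =
      (\<Sum>p\<in>bas a. et (a \<otimes> ?b) y (et a ?b p (cS a p)) z)"
    using z by (simp add: fmor_et[OF dag_hom[OF evb_hom] id_hom] fmor_id_apply dag_evb_u0 et_sum_left)
  also have "fmor F (assc C a ?b y) \<dots> = (\<Sum>p\<in>bas a. et a (?b \<otimes> y) p (et ?b y (cS a p) z))"
    using z c by (simp add: fmor_sum_arg[OF h3] fmor_assc)
  also have "fmor F (idm C a \<boxtimes> m) \<dots> = (\<Sum>p\<in>bas a. et a (unt C) p (fmor F m (et ?b y (cS a p) z)))"
    using z c by (simp add: fmor_sum_arg[OF h4] fmor_et[OF id_hom m] fmor_id_apply)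
  also have "fmor F (runit C a) \<dots> =
      (\<Sum>p\<in>bas a. sc a (fone F (fmor F m (et ?b y (cS a p) z))) p)"
    using z c by (simp add: fmor_sum_arg[OF h5] fmor_runit fmor_carr[OF m])
  finally show "fmor F (bend_left a y m) z =
      (\<Sum>p\<in>bas a. sc a (fone F (fmor F m (et ?b y (cS a p) z))) p)" .
qed

lemma cZ_cS: assumes v: "v \<in> car a" shows "cZ a (cS a v) = v"
proof -
  have pev_basis: "pev a (cS a p) x = ip a p x" if "p \<in> bas a" "x \<in> car a" for p x
  proof -
    have x: "x = (\<Sum>p\<in>bas a. sc a (pev a (cS a p) x) p)"
      using conj_eq[of a] fmor_id_apply[OF that(2)] bend_left(2)[OF ev_hom that(2)]
      by (simp add: bend_left_def pev_def)
    have "ip a p x = (\<Sum>q\<in>bas a. ip a p q * pev a (cS a q) x)"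
      using that by (subst x) (simp add: Fo.ip_sum Fo.ip_scale mult.commute)
    then show ?thesis using that by (simp add: Fo.hbasis_sum)
  qed
  have basis: "cZ a (cS a p) = p" if p: "p \<in> bas a" for p
  proof (rule Fo.ip_ext)
    show "ip a z (cZ a (cS a p)) = ip a z p" if "z \<in> car a" for z
      using p that Fo.ip_cnj[of p a z] by (simp add: cZ_ip' pev_basis)
  qed (use p in auto)
  have "cZ a (cS a v) = (\<Sum>p\<in>bas a. sc a (ip a p v) p)"
    unfolding cS_expand[OF v] by (subst cZ_sum) (auto simp: cZ_scale basis)
  then show ?thesis using Fo.expand[OF v] by simp
qed

lemma pev_cS: "v \<in> car a \<Longrightarrow> w \<in> car a \<Longrightarrow> pev a (cS a v) w = ip a v w"
  using cZ_ip[of "cS a v" a w] by (simp add: cZ_cS)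

lemma cS_cZ: assumes x: "x \<in> car (bar C a)" shows "cS a (cZ a x) = x"
proof -
  have "x = fmor F (bend_right (bar C a) a (ev C a)) x"
    using conj_eq_bar[of a] fmor_id_apply[OF x] by (simp add: bend_right_def)
  also have "\<dots> = (\<Sum>p\<in>bas a. sc (bar C a) (pev a x p) (cS a p))"
    by (simp add: bend_right(2)[OF ev_hom x] pev_def)
  also have "\<dots> = cS a (cZ a x)"
    using x by (simp add: cZ_ip' cS_expand)
  finally show ?thesis by simp
qed

section \<open>Faithfulness and duals of morphisms\<close>

lemma comp_0: "g \<in> hom C b c \<Longrightarrow> g \<cdot> 0 = 0" "f \<in> hom C a b \<Longrightarrow> 0 \<cdot> f = 0"
  using comp_scl_right[of 0 b b g c 0] comp_scl_left[of f a b 0 b 0] by simp_all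

text \<open>
  Bending a leg and bending it back changes nothing: by naturality of the structure morphisms \<open>f\<close> can be
  pulled through the left side of the conjugate equation.
\<close>

lemma bend_left_ev:
  assumes f: "f \<in> hom C a b"
  shows "bend_left b a (ev C b \<cdot> (idm C (bar C b) \<boxtimes> f)) = f"
proof -
  let ?c = "bar C b"
  have L: "dag C (lunit C b) \<in> hom C b (unt C \<otimes> b)" and L': "dag C (lunit C a) \<in> hom C a (unt C \<otimes> a)"
    by (intro dag_hom struct_hom)+
  have D: "dag C (evb C b) \<in> hom C (unt C) (b \<otimes> ?c)" by (intro dag_hom evb_hom)
  have E: "dag C (evb C b) \<boxtimes> idm C b \<in> hom C (unt C \<otimes> b) ((b \<otimes> ?c) \<otimes> b)"
    and E': "dag C (evb C b) \<boxtimes> idm C a \<in> hom C (unt C \<otimes> a) ((b \<otimes> ?c) \<otimes> a)"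
    by (intro tmor_hom id_hom D)+
  have A: "assc C b ?c b \<in> hom C ((b \<otimes> ?c) \<otimes> b) (b \<otimes> (?c \<otimes> b))"
    and A': "assc C b ?c a \<in> hom C ((b \<otimes> ?c) \<otimes> a) (b \<otimes> (?c \<otimes> a))" by (rule struct_hom)+
  have V: "idm C b \<boxtimes> ev C b \<in> hom C (b \<otimes> (?c \<otimes> b)) (b \<otimes> unt C)"
    by (intro tmor_hom id_hom ev_hom)
  have R: "runit C b \<in> hom C (b \<otimes> unt C) b" by (rule struct_hom)
  have F1: "idm C (unt C) \<boxtimes> f \<in> hom C (unt C \<otimes> a) (unt C \<otimes> b)"
    and F2: "idm C (b \<otimes> ?c) \<boxtimes> f \<in> hom C ((b \<otimes> ?c) \<otimes> a) ((b \<otimes> ?c) \<otimes> b)"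
    and Fc: "idm C ?c \<boxtimes> f \<in> hom C (?c \<otimes> a) (?c \<otimes> b)"
    by (intro tmor_hom id_hom f)+
  have F3: "idm C b \<boxtimes> (idm C ?c \<boxtimes> f) \<in> hom C (b \<otimes> (?c \<otimes> a)) (b \<otimes> (?c \<otimes> b))"
    by (intro tmor_hom id_hom Fc)
  note X1 = comp_hom[OF V R] note X2 = comp_hom[OF A X1] note X3 = comp_hom[OF E X2]
  have 1: "dag C (lunit C b) \<cdot> f = (idm C (unt C) \<boxtimes> f) \<cdot> dag C (lunit C a)"
  proof -
    have la: "lunit C a \<in> hom C (unt C \<otimes> a) a" "lunit C b \<in> hom C (unt C \<otimes> b) b" by (rule struct_hom)+
    have u: "lunit C a \<cdot> dag C (lunit C a) = idm C a" "dag C (lunit C b) \<cdot> lunit C b = idm C (unt C \<otimes> b)"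
      using lunit_unitary by (auto simp: unitary_mor_def)
    have "f = (f \<cdot> lunit C a) \<cdot> dag C (lunit C a)"
      using comp_assoc[OF L' la(1) f] u id_right[OF f] by simp
    also have "\<dots> = lunit C b \<cdot> ((idm C (unt C) \<boxtimes> f) \<cdot> dag C (lunit C a))"
      using comp_assoc[OF L' F1 la(2)] lunit_natural[OF f] by simp
    finally have "dag C (lunit C b) \<cdot> f =
        (dag C (lunit C b) \<cdot> lunit C b) \<cdot> ((idm C (unt C) \<boxtimes> f) \<cdot> dag C (lunit C a))"
      using comp_assoc[OF comp_hom[OF L' F1] la(2) L] by simp
    then show ?thesis using u id_left[OF comp_hom[OF L' F1]] by simp
  qed
  have 2: "(dag C (evb C b) \<boxtimes> idm C b) \<cdot> (idm C (unt C) \<boxtimes> f) =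
      (idm C (b \<otimes> ?c) \<boxtimes> f) \<cdot> (dag C (evb C b) \<boxtimes> idm C a)"
    using tmor_comp[OF id_hom D f id_hom] tmor_comp[OF D id_hom id_hom f]
      id_left[OF D] id_right[OF D] id_left[OF f] id_right[OF f] by simp
  have 3: "assc C b ?c b \<cdot> (idm C (b \<otimes> ?c) \<boxtimes> f) = (idm C b \<boxtimes> (idm C ?c \<boxtimes> f)) \<cdot> assc C b ?c a"
    using assc_natural[OF id_hom id_hom f, of b ?c] by (simp add: tmor_id)
  have 4: "(idm C b \<boxtimes> ev C b) \<cdot> (idm C b \<boxtimes> (idm C ?c \<boxtimes> f)) = idm C b \<boxtimes> (ev C b \<cdot> (idm C ?c \<boxtimes> f))"
    using tmor_comp[OF id_hom id_hom Fc ev_hom, of b] id_left[OF id_hom, of b] by simp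
  have "f = (runit C b \<cdot> (idm C b \<boxtimes> ev C b) \<cdot> assc C b ?c b \<cdot> (dag C (evb C b) \<boxtimes> idm C b) \<cdot>
      dag C (lunit C b)) \<cdot> f"
    using id_left[OF f] by (simp add: conj_eq)
  also have "\<dots> = runit C b \<cdot> (idm C b \<boxtimes> (ev C b \<cdot> (idm C ?c \<boxtimes> f))) \<cdot> assc C b ?c a \<cdot>
      (dag C (evb C b) \<boxtimes> idm C a) \<cdot> dag C (lunit C a)"
    by (simp add: comp_assoc[OF f L X3] 1 flip: comp_assoc[OF L' F1 X3],
        simp add: comp_assoc[OF F1 E X2] 2 flip: comp_assoc[OF E' F2 X2],
        simp add: comp_assoc[OF F2 A X1] 3 flip: comp_assoc[OF A' F3 X1],
        simp add: comp_assoc[OF F3 V R] 4)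
  finally show ?thesis by (simp add: bend_left_def)
qed

lemma fmor_scalar: "fone F (fmor F (scl C z (idm C (unt C))) u0) = z"
  by (simp add: fmor_scl[OF id_hom] fmor_id_apply fone_scale)

lemma unit_scalar: assumes "h \<in> hom C (unt C) (unt C)" shows "h = scl C (fone F (fmor F h u0)) (idm C (unt C))"
proof -
  obtain z where "h = scl C z (idm C (unt C))" using assms unit_simple by (auto simp: simple_obj_def)
  then show ?thesis by (simp add: fmor_scalar)
qed

lemma dag_comp_0:
  assumes f: "f \<in> hom C a b" and "dag C f \<cdot> f = 0" shows "f = 0"
proof -
  have "(nrm C f)\<^sup>2 = nrm C 0" using norm_cstar[OF f] assms(2) by simp
  also have "nrm C 0 = 0" using norm_eq_0[of 0 a a] by simp
  finally show ?thesis using norm_eq_0[OF f] by simp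
qed

text \<open>
  As \<open>End(1)\<close> consists of scalars, on which \<open>F\<close> is injective, \<open>F(m) = 0\<close> gives \<open>m m\<^sup>* = 0\<close>, and the
  C*-identity applies.
\<close>

lemma faithful_unit:
  assumes m: "m \<in> hom C x (unt C)" and 0: "\<And>t. t \<in> car x \<Longrightarrow> fmor F m t = 0"
  shows "m = 0"
proof -
  have d: "dag C m \<in> hom C (unt C) x" by (rule dag_hom[OF m])
  have "m \<cdot> dag C m = scl C 0 (idm C (unt C))"
    using unit_scalar[OF comp_hom[OF d m]] 0[OF fmor_carr[OF d]] Fo.lin_on_0[OF fone_lin]
    by (simp add: fmor_comp_apply[OF d m])
  then have "dag C m = 0" using dag_comp_0[OF d] by (simp add: dag_dag[OF m])
  then show ?thesis using dag_dag[OF m] dag_scl[OF d, of 0] by simp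
qed

text \<open>
  Bending a leg reduces this to morphisms into the unit.
\<close>

lemma faithful:
  assumes f: "f \<in> hom C a b" and 0: "\<And>x. x \<in> car a \<Longrightarrow> fmor F f x = 0"
  shows "f = 0"
proof -
  let ?c = "bar C b" and ?m = "ev C b \<cdot> (idm C (bar C b) \<boxtimes> f)"
  have t: "idm C ?c \<boxtimes> f \<in> hom C (?c \<otimes> a) (?c \<otimes> b)" by (intro tmor_hom id_hom f)
  note m = comp_hom[OF t ev_hom]
  have "fmor F ?m = (\<lambda>_. 0)"
  proof (rule lin_on_et_eqI[OF fmor_lin[OF m]])
    show "fmor F ?m (et ?c a x y) = 0" if "x \<in> car ?c" "y \<in> car a" for x y
      using that 0 et_scale_right[of x ?c y a 0] fmor_0_arg[OF ev_hom] et_scale_right[of x ?c 0 b 0]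
      by (simp add: fmor_comp_apply[OF t ev_hom] fmor_et[OF id_hom f] fmor_id_apply)
  qed (auto intro!: lin_onI)
  then have "?m = 0" using faithful_unit[OF m] by simp
  moreover have "idm C b \<boxtimes> (0 :: 'm) = 0"
    using tmor_scl_right[OF id_hom[of b] id_hom, where z = 0] by simp
  moreover have R: "runit C b \<in> hom C (b \<otimes> unt C) b" by (rule struct_hom)
  ultimately have "bend_left b a ?m = 0"
    unfolding bend_left_def
    by (simp add: comp_0(1)[OF R] comp_0(2)[OF struct_hom(1)[of b ?c a]]
        comp_0(2)[OF tmor_hom[OF dag_hom[OF evb_hom] id_hom]] comp_0(2)[OF dag_hom[OF struct_hom(2)]])
  then show ?thesis using bend_left_ev[OF f] by simp
qed

text \<open>
  The dual morphism \<open>w\<close> of \<open>f\<close>, with \<open>ev\<^sub>b (id \<otimes> f) = ev\<^sub>a (w \<otimes> id)\<close>.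
\<close>

lemma dual_exists:
  assumes f: "f \<in> hom C a b"
  shows "\<exists>w\<in>hom C (bar C b) (bar C a). \<forall>z\<in>car (bar C b).
    fmor F w z = cS a (fmor F (dag C f) (cZ b z))"
proof -
  let ?c = "bar C b" and ?m = "ev C b \<cdot> (idm C (bar C b) \<boxtimes> f)"
  have t: "idm C ?c \<boxtimes> f \<in> hom C (?c \<otimes> a) (?c \<otimes> b)" by (intro tmor_hom id_hom f)
  note m = comp_hom[OF t ev_hom]
  show ?thesis
  proof (intro bexI ballI)
    show "bend_right ?c a ?m \<in> hom C ?c (bar C a)" by (rule bend_right(1)[OF m])
    fix z assume z: "z \<in> car ?c"
    have "fone F (fmor F ?m (et ?c a z p)) = cnj (ip a p (fmor F (dag C f) (cZ b z)))"
      if "p \<in> car a" for p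
    proof -
      have "fone F (fmor F ?m (et ?c a z p)) = ip b (cZ b z) (fmor F f p)"
        using that z fmor_carr[OF f]
        by (simp add: fmor_comp_apply[OF t ev_hom] fmor_et[OF id_hom f] fmor_id_apply cZ_ip pev_def)
      also have "\<dots> = ip a (fmor F (dag C f) (cZ b z)) p"
        using that z by (simp add: fmor_ip(2)[OF f])
      finally show ?thesis
        using that z Fo.ip_cnj[of p a "fmor F (dag C f) (cZ b z)"] fmor_carr[OF dag_hom[OF f]] by simp
    qed
    then show "fmor F (bend_right ?c a ?m) z = cS a (fmor F (dag C f) (cZ b z))"
      using z by (simp add: bend_right(2)[OF m] cS_expand[OF fmor_carr[OF dag_hom[OF f]]])
  qed
qed

text \<open>
  The morphism \<open>s\<close> is obtained from \<open>f\<close> by taking two duals, the second one with an adjoint on either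
  side.  Written with the positive operators \<open>Q\<^sub>a = cS a\<^sup>* cS a\<close>, the condition is
  \<open>F(s) = Q\<^sub>b\<inverse> F(f) Q\<^sub>a\<close>.
\<close>

definition double_dual :: "'o \<Rightarrow> 'o \<Rightarrow> 'm \<Rightarrow> 'm \<Rightarrow> bool" where
  "double_dual a b f s \<longleftrightarrow> f \<in> hom C a b \<and> s \<in> hom C a b \<and>
    (\<forall>v\<in>car a. \<forall>w\<in>car b.
      ip (bar C b) (cS b (fmor F s v)) (cS b w) =
      ip (bar C a) (cS a v) (cS a (fmor F (dag C f) w)))"

lemma double_dual_exists:
  assumes f: "f \<in> hom C a b"
  shows "\<exists>s. double_dual a b f s"
proof -
  obtain w where w: "w \<in> hom C (bar C b) (bar C a)"
    "\<And>z. z \<in> car (bar C b) \<Longrightarrow> fmor F w z = cS a (fmor F (dag C f) (cZ b z))"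
    using dual_exists[OF f] by blast
  define k where "k = dag C w"
  have k: "k \<in> hom C (bar C a) (bar C b)" unfolding k_def by (rule dag_hom[OF w(1)])
  let ?m = "ev C b \<cdot> (k \<boxtimes> idm C b)"
  have t: "k \<boxtimes> idm C b \<in> hom C (bar C a \<otimes> b) (bar C b \<otimes> b)" by (intro tmor_hom id_hom k)
  note m = comp_hom[OF t ev_hom]
  define s where "s = dag C (bend_left a b ?m)"
  have s: "s \<in> hom C a b" unfolding s_def by (rule dag_hom[OF bend_left(1)[OF m]])
  have s_basis: "fmor F s p = cZ b (fmor F k (cS a p))" if p: "p \<in> bas a" for p
  proof (rule Fo.ip_ext)
    have pc: "p \<in> car a" using p by simp
    show "fmor F s p \<in> car b" "cZ b (fmor F k (cS a p)) \<in> car b"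
      using pc by (auto intro!: fmor_carr[OF s] fmor_carr[OF k])
    fix y assume y: "y \<in> car b"
    have "ip b y (fmor F s p) = ip a (fmor F (bend_left a b ?m) y) p"
      unfolding s_def using fmor_ip(1)[OF bend_left(1)[OF m] y pc] by simp
    also have "\<dots> = cnj (ip a p (fmor F (bend_left a b ?m) y))"
      using y pc by (intro Fo.ip_cnj) (auto intro!: fmor_carr[OF bend_left(1)[OF m]])
    also have "ip a p (fmor F (bend_left a b ?m) y) =
        (\<Sum>q\<in>bas a. ip a p q * pev b (fmor F k (cS a q)) y)"
      using y p by (simp add: bend_left(2)[OF m] Fo.ip_sum Fo.ip_scale fmor_comp_apply[OF t ev_hom]
          fmor_et[OF k id_hom] fmor_id_apply pev_def mult.commute)
    also have "\<dots> = pev b (fmor F k (cS a p)) y" using p by (rule Fo.hbasis_sum)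
    also have "cnj \<dots> = ip b y (cZ b (fmor F k (cS a p)))"
      using y pc by (subst cZ_ip') (auto intro!: fmor_carr[OF k])
    finally show "ip b y (fmor F s p) = ip b y (cZ b (fmor F k (cS a p)))" .
  qed
  have s_eq: "fmor F s v = cZ b (fmor F k (cS a v))" if v: "v \<in> car a" for v
  proof -
    have lin: "lin_on (fob F a) (sc b) (\<lambda>v. if v \<in> car a then cZ b (fmor F k (cS a v)) else 0)"
      by (intro lin_onI) (auto simp: cS_add cS_scale fmor_add_arg[OF k] fmor_scale_arg[OF k]
          cZ_add cZ_scale fmor_carr[OF k])
    show ?thesis
      using Fo.lin_on_expand[OF fmor_lin[OF s] v] Fo.lin_on_expand[OF lin v] v s_basis by simp
  qed
  have "ip (bar C b) (cS b (fmor F s v)) (cS b u) =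
      ip (bar C a) (cS a v) (cS a (fmor F (dag C f) u))"
    if v: "v \<in> car a" and u: "u \<in> car b" for v u
  proof -
    have "cS b (fmor F s v) = fmor F k (cS a v)"
      using v by (simp add: s_eq cS_cZ fmor_carr[OF k])
    then have "ip (bar C b) (cS b (fmor F s v)) (cS b u) = ip (bar C a) (cS a v) (fmor F w (cS b u))"
      using fmor_ip(2)[OF w(1) cS_carr[OF u] cS_carr[OF v]] by (simp add: k_def)
    then show ?thesis using u by (simp add: w(2) cZ_cS)
  qed
  then show ?thesis using f s by (auto simp: double_dual_def)
qed

lemma cS_diff: "v \<in> car a \<Longrightarrow> w \<in> car a \<Longrightarrow> cS a (v - w) = cS a v - cS a w"
  using cS_add[of "v - w" a w] by simp

lemma dag_diff: "f \<in> hom C a b \<Longrightarrow> g \<in> hom C a b \<Longrightarrow> dag C (f - g) = dag C f - dag C g"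
  using dag_add[of "f - g" a b g] by (simp add: hom_diff)

lemma double_dual_diff:
  assumes "double_dual a b f s" "double_dual a b f' s'"
  shows "double_dual a b (f - f') (s - s')"
proof -
  note d = assms[unfolded double_dual_def]
  show ?thesis
    unfolding double_dual_def
  proof (intro conjI ballI)
    fix v w assume vw: "v \<in> car a" "w \<in> car b"
    have h: "f \<in> hom C a b" "f' \<in> hom C a b" "s \<in> hom C a b" "s' \<in> hom C a b" using d by auto
    note c = fmor_carr[OF h(3) vw(1)] fmor_carr[OF h(4) vw(1)] fmor_carr[OF dag_hom[OF h(1)] vw(2)]
      fmor_carr[OF dag_hom[OF h(2)] vw(2)]
    show "ip (bar C b) (cS b (fmor F (s - s') v)) (cS b w) =
        ip (bar C a) (cS a v) (cS a (fmor F (dag C (f - f')) w))"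
      using d vw c by (simp add: fmor_diff[OF h(3,4)] dag_diff[OF h(1,2)]
          fmor_diff[OF dag_hom[OF h(1)] dag_hom[OF h(2)]] cS_diff Fo.ip_diff Fo.ip_diff_left)
  qed (use d in \<open>auto intro: hom_diff\<close>)
qed

section \<open>The categorical trace\<close>

lemma trace_scalar:
  assumes "h \<in> hom C (unt C) (unt C)"
  shows "(THE z. h = scl C z (idm C (unt C))) = fone F (fmor F h u0)"
  using unit_scalar[OF assms] fmor_scalar by (intro the_equality) auto

text \<open>
  In terms of the operators \<open>Q\<^sub>a\<close>, the left trace of \<open>f\<close> is \<open>tr(F(f) Q\<^sub>a\<inverse>)\<close> and the right trace is
  \<open>tr(Q\<^sub>a F(f))\<close>.  They agree as the duality maps are standard.
\<close>

lemma trace_left: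
  assumes f: "f \<in> hom C a a"
  shows "cat_trace C a f = (\<Sum>x\<in>bas (bar C a). ip a (cZ a x) (fmor F f (cZ a x)))"
proof -
  have t: "idm C (bar C a) \<boxtimes> f \<in> hom C (bar C a \<otimes> a) (bar C a \<otimes> a)" by (intro tmor_hom id_hom f)
  have d: "dag C (ev C a) \<in> hom C (unt C) (bar C a \<otimes> a)" by (rule dag_hom[OF ev_hom])
  note te = comp_hom[OF t ev_hom]
  have "cat_trace C a f = fone F (fmor F (ev C a) (fmor F (idm C (bar C a) \<boxtimes> f)
      (\<Sum>x\<in>bas (bar C a). et (bar C a) a x (cZ a x))))"
    unfolding cat_trace_def trace_scalar[OF comp_hom[OF d te]]
    by (simp add: fmor_comp_apply[OF d te] fmor_comp_apply[OF t ev_hom] dag_ev_u0)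
  also have "\<dots> = (\<Sum>x\<in>bas (bar C a). pev a x (fmor F f (cZ a x)))"
    by (simp add: fmor_sum_arg[OF t] fmor_et[OF id_hom f] fmor_id_apply fmor_sum_arg[OF ev_hom] fone_sum
        fmor_carr[OF ev_hom] fmor_carr[OF f] pev_def)
  finally show ?thesis by (simp add: cZ_ip fmor_carr[OF f])
qed

lemma trace_right:
  assumes f: "f \<in> hom C a a"
  shows "cat_trace C a f = (\<Sum>y\<in>bas a. ip (bar C a) (cS a (fmor F f y)) (cS a y))"
proof -
  have t: "f \<boxtimes> idm C (bar C a) \<in> hom C (a \<otimes> bar C a) (a \<otimes> bar C a)" by (intro tmor_hom id_hom f)
  have d: "dag C (evb C a) \<in> hom C (unt C) (a \<otimes> bar C a)" by (rule dag_hom[OF evb_hom])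
  note te = comp_hom[OF t evb_hom]
  have "cat_trace C a f = fone F (fmor F (evb C a) (fmor F (f \<boxtimes> idm C (bar C a))
      (\<Sum>y\<in>bas a. et a (bar C a) y (cS a y))))"
    unfolding cat_trace_def standard[OF f] trace_scalar[OF comp_hom[OF d te]]
    by (simp add: fmor_comp_apply[OF d te] fmor_comp_apply[OF t evb_hom] dag_evb_u0)
  also have "\<dots> = (\<Sum>y\<in>bas a. pevb a (fmor F f y) (cS a y))"
    by (simp add: fmor_sum_arg[OF t] fmor_et[OF f id_hom] fmor_id_apply fmor_sum_arg[OF evb_hom] fone_sum
        fmor_carr[OF evb_hom] fmor_carr[OF f] pevb_def)
  finally show ?thesis by (simp add: cS_ip fmor_carr[OF f])
qed

lemma trace_add: "f \<in> hom C a a \<Longrightarrow> g \<in> hom C a a \<Longrightarrow> cat_trace C a (f + g) = cat_trace C a f + cat_trace C a g"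
  by (simp add: trace_left hom_add fmor_add fmor_carr Fo.ip_add sum.distrib)

lemma trace_scl: "f \<in> hom C a a \<Longrightarrow> cat_trace C a (scl C z f) = z * cat_trace C a f"
  by (simp add: trace_left hom_scl fmor_scl fmor_carr Fo.ip_scale sum_distrib_left)

lemma trace_diff: "f \<in> hom C a a \<Longrightarrow> g \<in> hom C a a \<Longrightarrow> cat_trace C a (f - g) = cat_trace C a f - cat_trace C a g"
  using trace_add[of "f - g" a g] by (simp add: hom_diff)

lemma trace_dag: assumes "f \<in> hom C a a" shows "cat_trace C a (dag C f) = cnj (cat_trace C a f)"
  using fmor_ip(1)[OF assms cZ_carr cZ_carr, symmetric] fmor_carr[OF assms] Fo.ip_cnj[of "cZ a _" a "fmor F f (cZ a _)"]
  by (simp add: trace_left assms dag_hom)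

lemma trace_dag_comp:
  assumes f: "f \<in> hom C a b"
  shows "cat_trace C a (dag C f \<cdot> f) = (\<Sum>x\<in>bas (bar C a).
    ip b (fmor F f (cZ a x)) (fmor F f (cZ a x)))"
  using fmor_ip(1)[OF f cZ_carr fmor_carr[OF f cZ_carr]]
  by (simp add: trace_left comp_hom[OF f dag_hom[OF f]] fmor_comp_apply[OF f dag_hom[OF f]])

lemma trace_nonneg: "f \<in> hom C a b \<Longrightarrow> Re (cat_trace C a (dag C f \<cdot> f)) \<ge> 0"
  by (simp add: trace_dag_comp fmor_carr Fo.ip_self_nonneg sum_nonneg)

lemma trace_faithful:
  assumes f: "f \<in> hom C a b" and 0: "Re (cat_trace C a (dag C f \<cdot> f)) = 0"
  shows "f = 0"
proof (rule faithful[OF f])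
  fix v assume v: "v \<in> car a"
  have "(\<Sum>x\<in>bas (bar C a). Re (ip b (fmor F f (cZ a x)) (fmor F f (cZ a x)))) = 0"
    using 0 by (simp add: trace_dag_comp[OF f])
  then have "\<forall>x\<in>bas (bar C a). Re (ip b (fmor F f (cZ a x)) (fmor F f (cZ a x))) = 0"
    by (subst (asm) sum_nonneg_eq_0_iff) (auto intro!: Fo.ip_self_nonneg fmor_carr[OF f])
  then have fZ: "fmor F f (cZ a x) = 0" if "x \<in> bas (bar C a)" for x
    using that Fo.ip_pos[OF fmor_carr[OF f cZ_carr], of x] by force
  have "v = cZ a (\<Sum>x\<in>bas (bar C a). sc (bar C a) (ip (bar C a) x (cS a v)) x)"
    using Fo.expand[OF cS_carr[OF v]] cZ_cS[OF v] by simp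
  also have "\<dots> = (\<Sum>x\<in>bas (bar C a). sc a (cnj (ip (bar C a) x (cS a v))) (cZ a x))"
    by (subst cZ_sum) (auto simp: cZ_scale)
  finally have "fmor F f v = (\<Sum>x\<in>bas (bar C a).
      fmor F f (sc a (cnj (ip (bar C a) x (cS a v))) (cZ a x)))"
    using fmor_sum_arg[OF f, of "bas (bar C a)"
        "\<lambda>x. sc a (cnj (ip (bar C a) x (cS a v))) (cZ a x)"] by simp
  then show "fmor F f v = 0" by (simp add: fmor_scale_arg[OF f] fZ)
qed

text \<open>
  With \<open>F(s) = Q\<^sub>b\<inverse> F(f) Q\<^sub>a\<close>, this and the next lemma are the cyclicity of \<open>tr\<close>, applied to the left
  and to the right trace.
\<close>

lemma trace_twist_left:
  assumes d: "double_dual a b f s" and g: "g \<in> hom C b a"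
  shows "cat_trace C b (f \<cdot> g) = cat_trace C a (g \<cdot> s)"
proof -
  have f: "f \<in> hom C a b" and s: "s \<in> hom C a b"
    and q: "\<And>v w. v \<in> car a \<Longrightarrow> w \<in> car b \<Longrightarrow>
      ip (bar C b) (cS b (fmor F s v)) (cS b w) =
      ip (bar C a) (cS a v) (cS a (fmor F (dag C f) w))"
    using d by (auto simp: double_dual_def)
  note c = fmor_carr[OF f] fmor_carr[OF s] fmor_carr[OF g] fmor_carr[OF dag_hom[OF f]]
  let ?A = "\<lambda>x. cS a (fmor F (dag C f) (cZ b x))" and ?B = "\<lambda>x. cS b (fmor F s (cZ a x))"
  let ?\<beta> = "\<lambda>y x. ip a (cZ a y) (fmor F g (cZ b x))"
  have "cat_trace C b (f \<cdot> g) = (\<Sum>x\<in>bas (bar C b). ?\<beta> (?A x) x)"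
    using c by (simp add: trace_left[OF comp_hom[OF g f]] fmor_comp_apply[OF g f] fmor_ip(2)[OF f] cZ_cS)
  also have "\<dots> = (\<Sum>y\<in>bas (bar C a). ?\<beta> y (?B y))"
  proof (rule FF.trace_swap)
    fix x y assume xy: "x \<in> car (bar C b)" "y \<in> car (bar C a)"
    show "ip (bar C b) (?B y) x = ip (bar C a) y (?A x)"
      using q[OF cZ_carr[OF xy(2)] cZ_carr[OF xy(1)]] xy by (simp add: cS_cZ)
  next
    fix x assume x: "x \<in> car (bar C b)"
    show "lin_on (fob F (bar C a)) (*) (\<lambda>y. if y \<in> car (bar C a) then ?\<beta> y x else 0)"
      using x c by (intro lin_onI) (auto simp: cZ_add cZ_scale Fo.ip_add_left Fo.ip_scale_left)
  next
    fix y assume y: "y \<in> car (bar C a)"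
    show "lin_on (fob F (bar C b)) (\<lambda>c. (*) (cnj c)) (\<lambda>x. if x \<in> car (bar C b) then ?\<beta> y x else 0)"
      using y c by (intro lin_onI) (auto simp: cZ_add cZ_scale Fo.ip_add Fo.ip_scale fmor_add_arg[OF g] fmor_scale_arg[OF g])
  qed (use c in auto)
  also have "\<dots> = cat_trace C a (g \<cdot> s)"
    using c by (simp add: trace_left[OF comp_hom[OF s g]] fmor_comp_apply[OF s g] cZ_cS)
  finally show ?thesis .
qed

lemma trace_twist_right:
  assumes d: "double_dual a b f s" and g: "g \<in> hom C b a"
  shows "cat_trace C b (s \<cdot> g) = cat_trace C a (g \<cdot> f)"
proof -
  have f: "f \<in> hom C a b" and s: "s \<in> hom C a b"
    and q: "\<And>v w. v \<in> car a \<Longrightarrow> w \<in> car b \<Longrightarrow>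
      ip (bar C b) (cS b (fmor F s v)) (cS b w) =
      ip (bar C a) (cS a v) (cS a (fmor F (dag C f) w))"
    using d by (auto simp: double_dual_def)
  note c = fmor_carr[OF f] fmor_carr[OF s] fmor_carr[OF g] fmor_carr[OF dag_hom[OF f]]
  let ?\<beta> = "\<lambda>z y. cnj (ip (bar C a) (cS a (fmor F g y)) (cS a z))"
  have "cat_trace C b (s \<cdot> g) = cnj (\<Sum>y\<in>bas b. ?\<beta> (fmor F (dag C f) y) y)"
    using c by (simp add: trace_right[OF comp_hom[OF g s]] fmor_comp_apply[OF g s] q)
  also have "(\<Sum>y\<in>bas b. ?\<beta> (fmor F (dag C f) y) y) = (\<Sum>z\<in>bas a. ?\<beta> z (fmor F f z))"
  proof (rule FF.trace_swap)
    fix x y assume "x \<in> car b" "y \<in> car a"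
    then show "ip b (fmor F f y) x = ip a y (fmor F (dag C f) x)"
      by (rule fmor_ip(1)[OF f, rotated])
  next
    fix x assume x: "x \<in> car b"
    show "lin_on (fob F a) (*) (\<lambda>z. if z \<in> car a then ?\<beta> z x else 0)"
      using x c by (intro lin_onI) (auto simp: cS_add cS_scale Fo.ip_add Fo.ip_scale)
  next
    fix y assume y: "y \<in> car a"
    show "lin_on (fob F b) (\<lambda>c. (*) (cnj c)) (\<lambda>x. if x \<in> car b then ?\<beta> y x else 0)"
      using y c by (intro lin_onI) (auto simp: cS_add cS_scale Fo.ip_add_left Fo.ip_scale_left fmor_add_arg[OF g] fmor_scale_arg[OF g])
  qed (use c in auto)
  also have "cnj \<dots> = cat_trace C a (g \<cdot> f)"
    using c by (simp add: trace_right[OF comp_hom[OF f g]] fmor_comp_apply[OF f g])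
  finally show ?thesis .
qed

lemma comp_diff_right: "\<lbrakk>f \<in> hom C a b; f' \<in> hom C a b; g \<in> hom C b c\<rbrakk> \<Longrightarrow> g \<cdot> (f - f') = g \<cdot> f - g \<cdot> f'"
  using comp_add_right[of "f - f'" a b f' g c] by (simp add: hom_diff)

text \<open>
  Let \<open>\<sigma>(f)\<close> be the double dual of \<open>f\<close>.  The two twisting rules give
  \<open>Tr(g \<sigma>(\<sigma>(f))) = Tr(\<sigma>(f) g) = Tr(g f)\<close> for all \<open>g\<close>, so \<open>\<sigma>(\<sigma>(f)) = f\<close>, as the trace is
  faithful.  For \<open>x = \<sigma>(f) - f\<close> it follows that \<open>\<sigma>(x) = - x\<close> and therefore
  \<open>Tr(x x\<^sup>*) = Tr(x\<^sup>* \<sigma>(x)) = - Tr(x\<^sup>* x)\<close>.  Both traces are nonnegative, so \<open>x = 0\<close>.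
\<close>

lemma double_dual_self:
  assumes f: "f \<in> hom C a b"
  shows "double_dual a b f f"
proof -
  obtain s where s: "double_dual a b f s" using double_dual_exists[OF f] by blast
  then have sh: "s \<in> hom C a b" by (simp add: double_dual_def)
  then obtain s' where s': "double_dual a b s s'" using double_dual_exists by blast
  then have sh': "s' \<in> hom C a b" by (simp add: double_dual_def)
  have "s' = f"
  proof -
    have x: "s' - f \<in> hom C a b" using sh' f by (rule hom_diff)
    have g: "dag C (s' - f) \<in> hom C b a" by (rule dag_hom[OF x])
    have "cat_trace C a (dag C (s' - f) \<cdot> s') = cat_trace C a (dag C (s' - f) \<cdot> f)"
      using trace_twist_left[OF s' g] trace_twist_right[OF s g] by simp
    then have "cat_trace C a (dag C (s' - f) \<cdot> (s' - f)) = 0"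
      using comp_hom[OF sh' g] comp_hom[OF f g] by (simp add: comp_diff_right[OF sh' f g] trace_diff)
    then show ?thesis using trace_faithful[OF x] by simp
  qed
  define x where "x = s - f"
  have x: "x \<in> hom C a b" unfolding x_def using sh f by (rule hom_diff)
  have dx: "double_dual a b x (f - s)"
    using double_dual_diff[OF s' s] \<open>s' = f\<close> by (simp add: x_def)
  have g: "dag C x \<in> hom C b a" by (rule dag_hom[OF x])
  have "cat_trace C b (x \<cdot> dag C x) = cat_trace C a (dag C x \<cdot> (f - s))"
    by (rule trace_twist_left[OF dx g])
  also have "\<dots> = - cat_trace C a (dag C x \<cdot> x)"
    unfolding x_def using comp_hom[OF f g[unfolded x_def]] comp_hom[OF sh g[unfolded x_def]]
    by (simp add: comp_diff_right[OF f sh g[unfolded x_def]] comp_diff_right[OF sh f g[unfolded x_def]] trace_diff)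
  finally have "Re (cat_trace C b (x \<cdot> dag C x)) = - Re (cat_trace C a (dag C x \<cdot> x))" by simp
  moreover have "Re (cat_trace C b (x \<cdot> dag C x)) \<ge> 0" using trace_nonneg[OF g] by (simp add: dag_dag[OF x])
  moreover have "Re (cat_trace C a (dag C x \<cdot> x)) \<ge> 0" by (rule trace_nonneg[OF x])
  ultimately have "x = 0" by (intro trace_faithful[OF x]) simp
  then show ?thesis using s by (simp add: x_def)
qed

lemma trace_commute:
  assumes "f \<in> hom C a b" "g \<in> hom C b a"
  shows "cat_trace C b (f \<cdot> g) = cat_trace C a (g \<cdot> f)"
  by (rule trace_twist_left[OF double_dual_self[OF assms(1)] assms(2)])

section \<open>Orthonormal bases of morphisms\<close>

text \<open>
  The existence of the orthonormal bases of morphisms is that of an orthonormal basis of a Hilbert space.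
\<close>

definition hom_hilb :: "'o \<Rightarrow> 'o \<Rightarrow> 'm hilb" where
  "hom_hilb a b = \<lparr>hcar = hom C a b, hsc = scl C, hip = (\<lambda>f g. cat_trace C a (dag C f \<cdot> g))\<rparr>"

lemma hom_hilb_hilbert: "fd_hilbert_space (hom_hilb a b)"
proof (intro fd_hilbert_space.intro fd_hilbert_space_axioms.intro)
  show "vector_space (hsc (hom_hilb a b))" by (simp add: hom_hilb_def) unfold_locales
  show "module.subspace (hsc (hom_hilb a b)) (hcar (hom_hilb a b))"
    by (simp add: hom_hilb_def hom_subspace)
  have "\<exists>B. finite B \<and> span B = hom C a b"
  proof (rule finite_span_if_separated[where I = "bas a \<times> bas b"
        and \<phi> = "\<lambda>p f. ip b (snd p) (fmor F f (fst p))"])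
    fix f assume f: "f \<in> hom C a b"
      and 0: "\<And>p. p \<in> bas a \<times> bas b \<Longrightarrow> ip b (snd p) (fmor F f (fst p)) = 0"
    have fe: "fmor F f e = 0" if "e \<in> bas a" for e
    proof (rule trans[OF Fo.expand[OF fmor_carr[OF f]]])
      show "(\<Sum>y\<in>bas b. sc b (ip b y (fmor F f e)) y) = 0"
        using 0[of "(e, _)"] that by simp
    qed (use that in simp)
    show "f = 0"
    proof (rule faithful[OF f])
      fix x assume "x \<in> car a"
      from Fo.lin_on_expand[OF fmor_lin[OF f] this] show "fmor F f x = 0" by (simp add: fe)
    qed
  qed (auto simp: hom_subspace fmor_add fmor_scl fmor_carr Fo.ip_add Fo.ip_scale)
  then show "\<exists>B. finite B \<and> module.span (hsc (hom_hilb a b)) B = hcar (hom_hilb a b)"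
    by (simp add: hom_hilb_def)
  fix f g h c
  assume f: "f \<in> hcar (hom_hilb a b)"
  then have f': "f \<in> hom C a b" by (simp add: hom_hilb_def)
  note df = dag_hom[OF f']
  show "f \<noteq> 0 \<Longrightarrow> Re (hip (hom_hilb a b) f f) > 0"
    using trace_nonneg[OF f'] trace_faithful[OF f'] by (auto simp: hom_hilb_def less_le)
  assume g: "g \<in> hcar (hom_hilb a b)"
  then have g': "g \<in> hom C a b" by (simp add: hom_hilb_def)
  show "hip (hom_hilb a b) f (hsc (hom_hilb a b) c g) = c * hip (hom_hilb a b) f g"
    by (simp add: hom_hilb_def comp_scl_right[OF g' df] trace_scl[OF comp_hom[OF g' df]])
  show "hip (hom_hilb a b) g f = cnj (hip (hom_hilb a b) f g)"
    using trace_dag[OF comp_hom[OF g' df]] by (simp add: hom_hilb_def dag_comp[OF g' df] dag_dag[OF f'])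
  assume "h \<in> hcar (hom_hilb a b)"
  then have h': "h \<in> hom C a b" by (simp add: hom_hilb_def)
  show "hip (hom_hilb a b) f (g + h) = hip (hom_hilb a b) f g + hip (hom_hilb a b) f h"
    by (simp add: hom_hilb_def comp_add_right[OF g' h' df] trace_add comp_hom[OF g' df] comp_hom[OF h' df])
qed

lemma onb: "is_onb C a b (onb C a b)"
proof -
  interpret M: fd_hilbert_space "hom_hilb a b" by (rule hom_hilb_hilbert)
  have "is_onb C a b (hbasis (hom_hilb a b))"
    using M.hbasis unfolding is_onb_def hom_hilb_def by simp
  then show ?thesis unfolding onb_def by (rule someI)
qed

lemma onb_finite [simp]: "finite (onb C a b)"
  and onb_hom [simp, intro]: "f \<in> onb C a b \<Longrightarrow> f \<in> hom C a b"
  and onb_span: "span (onb C a b) = hom C a b"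
  and onb_orth: "f \<in> onb C a b \<Longrightarrow> g \<in> onb C a b \<Longrightarrow> cat_trace C a (dag C f \<cdot> g) = (if f = g then 1 else 0)"
  using onb[of a b] by (auto simp: is_onb_def)

section \<open>Semisimplicity\<close>

lemma comp_diff_left: "\<lbrakk>f \<in> hom C a b; g \<in> hom C b c; g' \<in> hom C b c\<rbrakk> \<Longrightarrow> (g - g') \<cdot> f = g \<cdot> f - g' \<cdot> f"
  using comp_add_left[of f a b "g - g'" c g'] by (simp add: hom_diff)

lemma dag_id: "dag C (idm C a) = idm C a"
proof -
  have d: "dag C (idm C a) \<in> hom C a a" by (rule dag_hom[OF id_hom])
  have "dag C (dag C (idm C a) \<cdot> idm C a) = dag C (idm C a) \<cdot> dag C (dag C (idm C a))"
    by (rule dag_comp[OF id_hom d])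
  then show ?thesis using id_right[OF d] id_right[OF id_hom, of a] by (simp add: dag_dag[OF id_hom])
qed

abbreviation frange :: "'o \<Rightarrow> 'm \<Rightarrow> 'v set" where
  "frange c f \<equiv> fmor F f ` car c"

abbreviation rk :: "'o \<Rightarrow> 'm \<Rightarrow> nat" where
  "rk c f \<equiv> vector_space.dim (sc c) (frange c f)"

lemma frange_subspace:
  assumes f: "f \<in> hom C c c"
  shows "module.subspace (sc c) (frange c f)"
proof (rule Fo.subspaceI)
  show "0 \<in> frange c f" using fmor_0_arg[OF f] by (force intro: image_eqI[of _ _ 0])
  show "x + y \<in> frange c f" if "x \<in> frange c f" "y \<in> frange c f" for x y
    using that by (auto simp: fmor_add_arg[OF f, symmetric])
  show "sc c k x \<in> frange c f" if "x \<in> frange c f" for k x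
    using that by (auto simp: fmor_scale_arg[OF f, symmetric])
qed

lemma selfadjoint_eigenvector:
  assumes h: "h \<in> hom C c c" "dag C h = h" and k: "k \<in> hom C c c" "k \<noteq> 0"
    and inv: "\<And>v. v \<in> frange c k \<Longrightarrow> fmor F h v \<in> frange c k"
  shows "\<exists>\<mu> w. w \<in> frange c k \<and> w \<noteq> 0 \<and> fmor F h w = sc c (of_real \<mu>) w"
proof -
  obtain x where x: "x \<in> car c" "fmor F k x \<noteq> 0" using faithful[OF k(1)] k(2) by blast
  have sub: "frange c k \<subseteq> car c" using fmor_carr[OF k(1)] by auto
  have "fmor F k x \<in> frange c k" using x by blast
  from Fo.invariant_eigenvector[OF fmor_lin[OF h(1)] frange_subspace[OF k(1)] sub inv this x(2)]
  obtain \<mu> w where w: "w \<in> frange c k" "w \<noteq> 0" "fmor F h w = sc c \<mu> w" by blast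
  have wc: "w \<in> car c" using w sub by auto
  have "cnj \<mu> * ip c w w = \<mu> * ip c w w"
    using fmor_ip(1)[OF h(1) wc wc] wc by (simp add: h(2) w(3) Fo.ip_scale Fo.ip_scale_left)
  then have "cnj \<mu> = \<mu>" using Fo.ip_self_0[OF wc] w(2) by auto
  then have "\<mu> = of_real (Re \<mu>)" by (simp add: complex_eq_iff)
  then show ?thesis using w by metis
qed

text \<open>
  The kernel of a self-adjoint operator is orthogonal to its range, so \<open>w\<close> is not in the range of \<open>h\<close>.
\<close>

lemma frange_dim_less:
  assumes h: "h \<in> hom C c c" "dag C h = h" and k: "k \<in> hom C c c"
    and sub: "frange c h \<subseteq> frange c k" and w: "w \<in> frange c k" "w \<noteq> 0" "fmor F h w = 0"
  shows "rk c h < rk c k"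
proof (rule Fo.dim_strict_mono[OF frange_subspace[OF h(1)]])
  show kc: "frange c k \<subseteq> car c" using fmor_carr[OF k] by auto
  then have wc: "w \<in> car c" using w by auto
  have "w \<notin> frange c h"
  proof
    assume "w \<in> frange c h"
    then obtain z where z: "z \<in> car c" "w = fmor F h z" by auto
    then have "ip c w w = 0" using fmor_ip(2)[OF h(1) z(1) wc] h(2) w(3) by simp
    then show False using Fo.ip_self_0[OF wc] w(2) by simp
  qed
  then show "frange c h \<subset> frange c k" using sub w by auto
qed

definition factor_irr :: "'o \<Rightarrow> 'm set" where
  "factor_irr c = {u \<cdot> w | b u w. b \<in> irr C \<and> w \<in> hom C c b \<and> u \<in> hom C b c}"

text \<open>
  Below every projection \<open>e \<noteq> 0\<close> there is a minimal one.  A self-adjoint \<open>k \<noteq> 0\<close> of least rank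
  with \<open>e k = k\<close> satisfies \<open>k\<^sup>2 = \<mu> k\<close> for an eigenvalue \<open>\<mu>\<close>, as \<open>k\<^sup>2 - \<mu> k\<close> has smaller
  rank.  So \<open>p = k / \<mu>\<close> is a projection.  By the same argument a self-adjoint \<open>h\<close> with \<open>p h = h\<close>
  equals \<open>\<nu> p\<close> for any of its eigenvalues \<open>\<nu>\<close> on the range of \<open>p\<close>.
\<close>

lemma minimal_projection:
  assumes e: "e \<in> hom C c c" "e \<cdot> e = e" "dag C e = e" and "e \<noteq> 0"
  shows "\<exists>p. p \<in> hom C c c \<and> dag C p = p \<and> p \<cdot> p = p \<and> e \<cdot> p = p \<and> p \<noteq> 0 \<and>
    (\<forall>h. h \<in> hom C c c \<longrightarrow> dag C h = h \<longrightarrow> p \<cdot> h = h \<longrightarrow> (\<exists>z. h = scl C z p))"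
proof -
  let ?SA = "\<lambda>k. k \<in> hom C c c \<and> dag C k = k \<and> e \<cdot> k = k \<and> k \<noteq> 0"
  have "?SA e" using e \<open>e \<noteq> 0\<close> by simp
  from ex_has_least_nat[of ?SA, OF this, of "rk c"]
  obtain k where k: "k \<in> hom C c c" "dag C k = k" "e \<cdot> k = k" "k \<noteq> 0"
    and least: "\<And>h. ?SA h \<Longrightarrow> rk c k \<le> rk c h" by blast
  have kk: "k \<cdot> k \<in> hom C c c" by (rule comp_hom[OF k(1) k(1)])
  have "fmor F k v \<in> frange c k" if "v \<in> frange c k" for v
    using that fmor_carr[OF k(1)] by auto
  from selfadjoint_eigenvector[OF k(1,2,1,4) this]
  obtain \<mu> w where w: "w \<in> frange c k" "w \<noteq> 0" "fmor F k w = sc c (of_real \<mu>) w" by blast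
  have wc: "w \<in> car c" using w fmor_carr[OF k(1)] by auto
  define m where "m = complex_of_real \<mu>"
  have m_cnj: "cnj m = m" by (simp add: m_def)
  have m0: "m \<noteq> 0"
  proof
    assume "m = 0"
    then have "fmor F k w = 0" using w(3) by (simp add: m_def)
    from frange_dim_less[OF k(1,2,1) subset_refl w(1,2) this] show False by simp
  qed
  define h where "h = k \<cdot> k - scl C m k"
  have h: "h \<in> hom C c c" "dag C h = h"
    unfolding h_def using kk k m_cnj
    by (auto simp: hom_diff hom_scl dag_diff[OF kk hom_scl[OF k(1)]] dag_comp[OF k(1) k(1)] dag_scl[OF k(1)])
  have eh: "e \<cdot> h = h"
    unfolding h_def using comp_assoc[OF k(1) k(1) e(1)] k(3)
    by (simp add: comp_diff_right[OF kk hom_scl[OF k(1)] e(1)] comp_scl_right[OF k(1) e(1)])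
  have hx: "fmor F h x = fmor F k (fmor F k x) - sc c m (fmor F k x)" if "x \<in> car c" for x
    unfolding h_def using that
    by (simp add: fmor_diff[OF kk hom_scl[OF k(1)]] fmor_comp_apply[OF k(1) k(1)] fmor_scl[OF k(1)])
  have "h = 0"
  proof (rule ccontr)
    assume "h \<noteq> 0"
    have "frange c h \<subseteq> frange c k"
    proof (rule image_subsetI)
      fix x assume x: "x \<in> car c"
      have "fmor F h x = fmor F k (fmor F k x - sc c m x)"
        using x fmor_carr[OF k(1) x]
        by (simp add: hx Fo.lin_on_diff[OF fmor_lin[OF k(1)]] fmor_scale_arg[OF k(1)])
      then show "fmor F h x \<in> frange c k" using x fmor_carr[OF k(1) x] by auto
    qed
    moreover have "fmor F h w = 0"
      using wc w(3) by (simp add: hx fmor_scale_arg[OF k(1)] m_def)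
    ultimately have "rk c h < rk c k"
      by (intro frange_dim_less[OF h k(1) _ w(1,2)])
    moreover have "rk c k \<le> rk c h" using least h eh \<open>h \<noteq> 0\<close> by blast
    ultimately show False by simp
  qed
  then have k2: "k \<cdot> k = scl C m k" by (simp add: h_def)
  define p where "p = scl C (inverse m) k"
  have p: "p \<in> hom C c c" "dag C p = p" "e \<cdot> p = p" "p \<noteq> 0"
    using k m0 m_cnj by (auto simp: p_def hom_scl dag_scl[OF k(1)] comp_scl_right[OF k(1) e(1)])
  have pp: "p \<cdot> p = p"
    using m0 by (simp add: p_def comp_scl_left[OF hom_scl[OF k(1)] k(1)] comp_scl_right[OF k(1) k(1)] k2)
  have px: "fmor F p x = sc c (inverse m) (fmor F k x)" if "x \<in> car c" for x
    using that by (simp add: p_def fmor_scl[OF k(1)])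
  have pfix: "fmor F p x = x" if "x \<in> frange c p" for x
    using that fmor_comp_apply[OF p(1) p(1)] by (auto simp: pp)
  have range_p: "frange c p = frange c k"
  proof
    show "frange c p \<subseteq> frange c k"
      using Fo.subspace_scale[OF frange_subspace[OF k(1)]] by (auto simp: px)
    show "frange c k \<subseteq> frange c p"
    proof (rule image_subsetI)
      fix x assume x: "x \<in> car c"
      then have "fmor F k x = fmor F p (sc c m x)"
        using m0 by (simp add: px fmor_scale_arg[OF k(1)])
      then show "fmor F k x \<in> frange c p" using x by auto
    qed
  qed
  have scalar_sa: "\<exists>z. h = scl C z p" if h: "h \<in> hom C c c" "dag C h = h" "p \<cdot> h = h" for h
  proof -
    have ph: "fmor F h v = fmor F p (fmor F h v)" for v
      using fmor_comp_apply[OF h(1) p(1)] h(3) by simp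
    have hinv: "fmor F h v \<in> frange c p" if "v \<in> car c" for v
      using that fmor_carr[OF h(1)] ph[of v] by blast
    have "fmor F h v \<in> frange c p" if "v \<in> frange c p" for v
      using that fmor_carr[OF p(1)] hinv by blast
    from selfadjoint_eigenvector[OF h(1,2) p(1,4) this]
    obtain \<nu> u where u: "u \<in> frange c p" "u \<noteq> 0" "fmor F h u = sc c (of_real \<nu>) u" by blast
    have uc: "u \<in> car c" using u fmor_carr[OF p(1)] by auto
    define n where "n = complex_of_real \<nu>"
    define g where "g = h - scl C n p"
    have g: "g \<in> hom C c c" "dag C g = g"
      unfolding g_def using h p
      by (auto simp: hom_diff hom_scl dag_diff[OF h(1) hom_scl[OF p(1)]] dag_scl[OF p(1)] n_def)
    have "e \<cdot> h = h" using comp_assoc[OF h(1) p(1) e(1)] p(3) h(3) by simp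
    then have eg: "e \<cdot> g = g"
      unfolding g_def using p(3) by (simp add: comp_diff_right[OF h(1) hom_scl[OF p(1)] e(1)] comp_scl_right[OF p(1) e(1)])
    have gx: "fmor F g x = fmor F h x - sc c n (fmor F p x)" if "x \<in> car c" for x
      unfolding g_def using that by (simp add: fmor_diff[OF h(1) hom_scl[OF p(1)]] fmor_scl[OF p(1)])
    have "g = 0"
    proof (rule ccontr)
      assume "g \<noteq> 0"
      have "frange c g \<subseteq> frange c k"
        unfolding range_p[symmetric]
      proof (rule image_subsetI)
        fix x assume x: "x \<in> car c"
        show "fmor F g x \<in> frange c p"
          unfolding gx[OF x] using x hinv[OF x]
          by (intro Fo.subspace_diff[OF frange_subspace[OF p(1)]] Fo.subspace_scale[OF frange_subspace[OF p(1)]]) auto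
      qed
      moreover have "fmor F g u = 0" using uc u(3) pfix[OF u(1)] by (simp add: gx n_def)
      ultimately have "rk c g < rk c k"
        using u(1,2) range_p by (intro frange_dim_less[OF g k(1), of u]) auto
      moreover have "rk c k \<le> rk c g" using least g eg \<open>g \<noteq> 0\<close> by blast
      ultimately show False by simp
    qed
    then show ?thesis by (auto simp: g_def)
  qed
  show ?thesis using p pp scalar_sa by blast
qed

text \<open>
  An endomorphism \<open>h\<close> of the image corresponds to \<open>v h v\<^sup>*\<close>, and it is a combination of two self-adjoint
  ones.
\<close>

lemma image_of_minimal_projection_simple:
  assumes p: "p \<in> hom C c c" "p \<noteq> 0"
    and scalar_sa: "\<And>h. h \<in> hom C c c \<Longrightarrow> dag C h = h \<Longrightarrow> p \<cdot> h = h \<Longrightarrow> \<exists>z. h = scl C z p"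
    and v: "v \<in> hom C b c" "dag C v \<cdot> v = idm C b" "v \<cdot> dag C v = p"
  shows "simple_obj C b"
proof -
  have dv: "dag C v \<in> hom C c b" by (rule dag_hom[OF v(1)])
  have simple_sa: "\<exists>z. h = scl C z (idm C b)" if h: "h \<in> hom C b b" "dag C h = h" for h
  proof -
    let ?h = "v \<cdot> (h \<cdot> dag C v)"
    have hd: "h \<cdot> dag C v \<in> hom C c b" by (rule comp_hom[OF dv h(1)])
    have hh: "?h \<in> hom C c c" by (rule comp_hom[OF hd v(1)])
    have "dag C ?h = ?h"
      using dag_comp[OF hd v(1)] dag_comp[OF dv h(1)] comp_assoc[OF dv h(1) v(1)] h(2)
      by (simp add: dag_dag[OF v(1)])
    moreover have "p \<cdot> ?h = ?h"
      using comp_assoc[OF hh dv v(1)] comp_assoc[OF hd v(1) dv] v(2,3) id_left[OF hd] by simp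
    ultimately obtain z where z: "?h = scl C z p" using scalar_sa[OF hh] by blast
    have "h = (dag C v \<cdot> v) \<cdot> (h \<cdot> (dag C v \<cdot> v))"
      using v(2) id_left[OF h(1)] id_right[OF h(1)] by simp
    also have "\<dots> = (dag C v \<cdot> ?h) \<cdot> v"
      using comp_assoc[OF v(1) dv h(1)] comp_assoc[OF v(1) hd comp_hom[OF v(1) dv]]
        comp_assoc[OF hd v(1) dv] by simp
    also have "\<dots> = scl C z ((dag C v \<cdot> (v \<cdot> dag C v)) \<cdot> v)"
      unfolding z v(3) by (simp add: comp_scl_right[OF p(1) dv] comp_scl_left[OF v(1) comp_hom[OF p(1) dv]])
    also have "(dag C v \<cdot> (v \<cdot> dag C v)) \<cdot> v = idm C b"
      using comp_assoc[OF dv v(1) dv] comp_assoc[OF v(1) dv comp_hom[OF v(1) dv]] v(2) id_left[OF id_hom, of b]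
      by (simp add: id_left[OF dv])
    finally show ?thesis by blast
  qed
  show ?thesis
    unfolding simple_obj_def
  proof
    show "idm C b \<noteq> 0"
    proof
      assume "idm C b = 0"
      then have "v = 0" using id_right[OF v(1)] comp_0(1)[OF v(1)] by simp
      then show False using v(3) p(2) comp_0(2)[OF dv] by simp
    qed
    have "\<exists>z. h = scl C z (idm C b)" if h: "h \<in> hom C b b" for h
    proof -
      note dh = dag_hom[OF h]
      have s: "h + dag C h \<in> hom C b b" "scl C \<i> (h - dag C h) \<in> hom C b b"
        by (intro hom_add hom_scl hom_diff h dh)+
      have "dag C (h + dag C h) = h + dag C h"
        using dag_add[OF h dh] dag_dag[OF h] by (simp add: add.commute)
      moreover have "dag C (scl C \<i> (h - dag C h)) = scl C \<i> (h - dag C h)"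
        using dag_scl[OF hom_diff[OF h dh], of \<i>] dag_diff[OF h dh] dag_dag[OF h]
        by (simp add: scale_right_diff_distrib)
      ultimately obtain y z where yz: "h + dag C h = scl C y (idm C b)" "scl C \<i> (h - dag C h) = scl C z (idm C b)"
        using simple_sa[OF s(1)] simple_sa[OF s(2)] by blast
      have "scl C 2 h = (h + dag C h) + (h - dag C h)"
        using scale_left_distrib[of 1 1 h] by simp
      also have "h - dag C h = scl C (- \<i>) (scl C \<i> (h - dag C h))" by simp
      finally have "scl C 2 h = scl C (y - \<i> * z) (idm C b)"
        unfolding yz by (simp add: scale_left_diff_distrib)
      then have "scl C (1/2) (scl C 2 h) = scl C (1/2) (scl C (y - \<i> * z) (idm C b))" by (rule arg_cong)
      then have "h = scl C (1/2 * (y - \<i> * z)) (idm C b)" by (simp only: scale_scale) simp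
      then show ?thesis by blast
    qed
    then show "hom C b b = range (\<lambda>z. scl C z (idm C b))" by (auto simp: hom_scl id_hom)
  qed
qed

text \<open>
  Splitting off the image of a minimal projection lowers the rank, so every projection is a sum of
  morphisms that factor through simple objects.
\<close>

lemma projection_factors:
  assumes "e \<in> hom C c c" "e \<cdot> e = e" "dag C e = e"
  shows "e \<in> span (factor_irr c)"
  using assms
proof (induction "rk c e" arbitrary: e rule: less_induct)
  case less
  note e = less.prems
  show ?case
  proof (cases "e = 0")
    case True then show ?thesis by (simp add: span_zero)
  next
    case False
    from minimal_projection[OF e False]
    obtain p where p: "p \<in> hom C c c" "dag C p = p" "e \<cdot> p = p" "p \<noteq> 0" and pp: "p \<cdot> p = p"
      and minimal: "\<And>h. h \<in> hom C c c \<Longrightarrow> dag C h = h \<Longrightarrow> p \<cdot> h = h \<Longrightarrow> \<exists>z. h = scl C z p" by blast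
    have pe: "p \<cdot> e = p" using dag_comp[OF p(1) e(1)] p e by simp
    obtain x where x: "x \<in> car c" "fmor F p x \<noteq> 0" using faithful[OF p(1)] p(4) by blast
    obtain b v where v: "v \<in> hom C b c" "dag C v \<cdot> v = idm C b" "v \<cdot> dag C v = p"
      using subobjects[OF p(1) pp p(2)] by blast
    have dv: "dag C v \<in> hom C c b" by (rule dag_hom[OF v(1)])
    have "simple_obj C b" by (rule image_of_minimal_projection_simple[OF p(1,4) minimal v])
    then obtain b' f g where b': "b' \<in> irr C" "f \<in> hom C b b'" "g \<in> hom C b' b" "g \<cdot> f = idm C b"
      using irr_representatives unfolding iso_obj_def by metis
    have "p = (v \<cdot> g) \<cdot> (f \<cdot> dag C v)"
      using comp_assoc[OF comp_hom[OF dv b'(2)] b'(3) v(1)] comp_assoc[OF dv b'(2,3)] b'(4) id_left[OF dv] v(3) by simp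
    then have "p \<in> factor_irr c"
      unfolding factor_irr_def using b'(1) comp_hom[OF dv b'(2)] comp_hom[OF b'(3) v(1)] by blast
    then have p_span: "p \<in> span (factor_irr c)" by (rule span_base)
    define q where "q = e - p"
    have q: "q \<in> hom C c c" "dag C q = q"
      unfolding q_def using e p by (auto simp: hom_diff dag_diff[OF e(1) p(1)])
    have "q \<cdot> q = q"
      unfolding q_def using e p pp pe
      by (simp add: comp_diff_left[OF hom_diff[OF e(1) p(1)] e(1) p(1)] comp_diff_right[OF e(1) p(1) e(1)]
          comp_diff_right[OF e(1) p(1) p(1)])
    have qx: "fmor F q x = fmor F e x - fmor F p x" if "x \<in> car c" for x
      unfolding q_def by (rule fmor_diff[OF e(1) p(1) that])
    have p_range_e: "frange c p \<subseteq> frange c e"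
    proof (rule image_subsetI)
      fix x assume x: "x \<in> car c"
      have "fmor F p x = fmor F e (fmor F p x)" using fmor_comp_apply[OF p(1) e(1)] p(3) by simp
      then show "fmor F p x \<in> frange c e" using fmor_carr[OF p(1) x] by blast
    qed
    have "rk c q < rk c e"
    proof (rule frange_dim_less[OF q e(1)])
      show "frange c q \<subseteq> frange c e"
        using Fo.subspace_diff[OF frange_subspace[OF e(1)]] p_range_e by (auto simp: qx subset_iff)
      show w1: "fmor F p x \<in> frange c e" using x(1) p_range_e by blast
      show "fmor F p x \<noteq> 0" by (rule x(2))
      have "fmor F e (fmor F p x) = fmor F p x" "fmor F p (fmor F p x) = fmor F p x"
        using fmor_comp_apply[OF p(1) e(1)] fmor_comp_apply[OF p(1) p(1)] p(3) pp by simp_all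
      then show "fmor F q (fmor F p x) = 0" using fmor_carr[OF p(1) x(1)] by (simp add: qx)
    qed
    from less.hyps[OF this q(1) \<open>q \<cdot> q = q\<close> q(2)] p_span
    have "q + p \<in> span (factor_irr c)" by (rule span_add)
    then show ?thesis by (simp add: q_def)
  qed
qed

lemma identity_factors: "idm C c \<in> span (factor_irr c)"
  by (rule projection_factors) (auto simp: id_hom dag_id id_left[OF id_hom])

lemma irr_scalar:
  assumes "b \<in> irr C" "h \<in> hom C b b"
  obtains z where "h = scl C z (idm C b)"
  using irr_simple[OF assms(1)] assms(2) unfolding simple_obj_def by blast

text \<open>
  Schur's lemma; a nonzero morphism between simple objects is a multiple of a unitary.
\<close>

lemma hom_irr_0:
  assumes b: "b \<in> irr C" and b': "b' \<in> irr C" and ne: "b \<noteq> b'" and f: "f \<in> hom C b b'"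
  shows "f = 0"
proof (rule ccontr)
  assume f0: "f \<noteq> 0"
  have d: "dag C f \<in> hom C b' b" by (rule dag_hom[OF f])
  obtain y where y: "dag C f \<cdot> f = scl C y (idm C b)" using irr_scalar[OF b comp_hom[OF f d]] by blast
  obtain z where z: "f \<cdot> dag C f = scl C z (idm C b')" using irr_scalar[OF b' comp_hom[OF d f]] by blast
  have "y \<noteq> 0" using dag_comp_0[OF f] f0 y by auto
  have "scl C y f = scl C z f"
    using comp_assoc[OF f d f] y z comp_scl_right[OF id_hom f] comp_scl_left[OF f id_hom] id_left[OF f] id_right[OF f]
    by auto
  then have "y = z" using f0 by simp
  let ?g = "scl C (inverse y) (dag C f)"
  have "?g \<in> hom C b' b" by (rule hom_scl[OF d])
  moreover have "?g \<cdot> f = idm C b" using y \<open>y \<noteq> 0\<close> by (simp add: comp_scl_left[OF f d])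
  moreover have "f \<cdot> ?g = idm C b'" using z \<open>y = z\<close> \<open>y \<noteq> 0\<close> by (simp add: comp_scl_right[OF d f])
  ultimately have "iso_obj C b b'" unfolding iso_obj_def using f by blast
  moreover have "iso_obj C b b" unfolding iso_obj_def using id_hom[of b] id_left[OF id_hom, of b] by blast
  ultimately show False using irr_representatives[OF irr_simple[OF b]] b b' ne by blast
qed

text \<open>
  Only the finitely many simple objects through which a decomposition of \<open>id\<^sub>c\<close> passes receive nonzero
  morphisms from \<open>c\<close>.
\<close>

lemma finite_irr_targets: "finite {b \<in> irr C. \<exists>f\<in>hom C c b. f \<noteq> 0}"
proof -
  obtain S u where S: "finite S" "S \<subseteq> factor_irr c" "idm C c = (\<Sum>x\<in>S. scl C (u x) x)"
    using identity_factors[of c] unfolding span_explicit by blast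
  have "\<forall>x\<in>S. \<exists>b. b \<in> irr C \<and> (\<exists>u w. w \<in> hom C c b \<and> u \<in> hom C b c \<and> x = u \<cdot> w)"
    using S(2) unfolding factor_irr_def by blast
  then obtain t where t: "\<And>x. x \<in> S \<Longrightarrow> t x \<in> irr C \<and> (\<exists>u w. w \<in> hom C c (t x) \<and> u \<in> hom C (t x) c \<and> x = u \<cdot> w)"
    by metis
  have "b \<in> t ` S" if b: "b \<in> irr C" and f: "f \<in> hom C c b" "f \<noteq> 0" for b f
  proof (rule ccontr)
    assume nb: "b \<notin> t ` S"
    have "x \<in> {x \<in> hom C c c. f \<cdot> x = 0}" if x: "x \<in> S" for x
    proof -
      obtain v w where vw: "w \<in> hom C c (t x)" "v \<in> hom C (t x) c" "x = v \<cdot> w" using t[OF x] by blast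
      have "f \<cdot> v = 0" using nb x t[OF x] b by (intro hom_irr_0[OF _ b _ comp_hom[OF vw(2) f(1)]]) auto
      then have "f \<cdot> x = 0" using comp_assoc[OF vw(1,2) f(1)] comp_0(2)[OF vw(1)] vw(3) by simp
      then show ?thesis using comp_hom[OF vw(1,2)] vw(3) by simp
    qed
    moreover have "subspace {x \<in> hom C c c. f \<cdot> x = 0}"
      by (rule subspaceI) (auto simp: comp_0(1)[OF f(1)] hom_add hom_scl comp_add_right[OF _ _ f(1)] comp_scl_right[OF _ f(1)])
    ultimately have "idm C c \<in> {x \<in> hom C c c. f \<cdot> x = 0}"
      unfolding S(3) by (intro subspace_sum subspace_scale) auto
    then show False using id_right[OF f(1)] f(2) by simp
  qed
  then have "{b \<in> irr C. \<exists>f\<in>hom C c b. f \<noteq> 0} \<subseteq> t ` S" by blast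
  then show ?thesis using S(1) finite_subset by blast
qed

section \<open>Completeness of the orthonormal bases\<close>

text \<open>
  As \<open>End(b)\<close> consists of scalars, \<open>f g\<^sup>*\<close> is determined by its trace, which by traciality is the inner
  product of \<open>g\<close> and \<open>f\<close>.
\<close>

lemma onb_comp:
  assumes b: "b \<in> irr C" and f: "f \<in> onb C c b" and g: "g \<in> onb C c b"
  shows "scl C (qdim C b) (f \<cdot> dag C g) = (if f = g then idm C b else 0)"
proof -
  have h: "f \<in> hom C c b" "g \<in> hom C c b" using f g by auto
  have d: "dag C g \<in> hom C b c" by (rule dag_hom[OF h(2)])
  obtain z where z: "f \<cdot> dag C g = scl C z (idm C b)" using irr_scalar[OF b comp_hom[OF d h(1)]] by blast
  have "z * qdim C b = cat_trace C b (f \<cdot> dag C g)"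
    unfolding z qdim_def by (simp add: trace_scl[OF id_hom])
  also have "\<dots> = (if f = g then 1 else 0)"
    using trace_commute[OF h(1) d] onb_orth[OF g f] by auto
  finally show ?thesis using z by (simp add: mult.commute)
qed

definition isotypic :: "'o \<Rightarrow> 'o \<Rightarrow> 'm" where
  "isotypic c b = (\<Sum>f\<in>onb C c b. scl C (qdim C b) (dag C f \<cdot> f))"

lemma isotypic_hom: "isotypic c b \<in> hom C c c"
  unfolding isotypic_def by (intro hom_sum hom_scl comp_hom[of _ c b] dag_hom onb_hom)

lemma comp_sum_right:
  assumes "g \<in> hom C b c" "\<And>i. i \<in> I \<Longrightarrow> f i \<in> hom C a b"
  shows "g \<cdot> (\<Sum>i\<in>I. f i) = (\<Sum>i\<in>I. g \<cdot> f i)"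
  using assms(2)
proof (induction I rule: infinite_finite_induct)
  case (insert i I)
  then have "g \<cdot> (f i + (\<Sum>i\<in>I. f i)) = g \<cdot> f i + g \<cdot> (\<Sum>i\<in>I. f i)"
    by (intro comp_add_right[OF _ _ assms(1)]) (auto intro: hom_sum)
  then show ?case using insert by simp
qed (use comp_0(1)[OF assms(1)] in auto)

lemma comp_isotypic:
  assumes "g \<in> hom C c b'"
  shows "g \<cdot> isotypic c b = (\<Sum>f\<in>onb C c b. scl C (qdim C b) (g \<cdot> dag C f) \<cdot> f)"
proof -
  have h: "dag C f \<cdot> f \<in> hom C c c" "dag C f \<in> hom C b c" "f \<in> hom C c b" if "f \<in> onb C c b" for f
    using comp_hom[OF onb_hom[OF that] dag_hom[OF onb_hom[OF that]]] dag_hom[OF onb_hom[OF that]] that by auto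
  have "g \<cdot> isotypic c b = (\<Sum>f\<in>onb C c b. g \<cdot> scl C (qdim C b) (dag C f \<cdot> f))"
    unfolding isotypic_def by (rule comp_sum_right[OF assms hom_scl[OF h(1)]])
  also have "\<dots> = (\<Sum>f\<in>onb C c b. scl C (qdim C b) (g \<cdot> dag C f) \<cdot> f)"
  proof (rule sum.cong[OF refl])
    fix f assume "f \<in> onb C c b"
    note h = h[OF this]
    show "g \<cdot> scl C (qdim C b) (dag C f \<cdot> f) = scl C (qdim C b) (g \<cdot> dag C f) \<cdot> f"
      using comp_scl_right[OF h(1) assms] comp_scl_left[OF h(3) comp_hom[OF h(2) assms]] comp_assoc[OF h(3,2) assms]
      by simp
  qed
  finally show ?thesis .
qed

lemma comp_isotypic_same:
  assumes b: "b \<in> irr C" and g: "g \<in> hom C c b"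
  shows "g \<cdot> isotypic c b = g"
proof -
  have "g \<cdot> isotypic c b = g" if g: "g \<in> onb C c b" for g
  proof -
    have "g \<cdot> isotypic c b = (\<Sum>f\<in>onb C c b. if f = g then g else 0)"
      unfolding comp_isotypic[OF onb_hom[OF g]]
    proof (rule sum.cong[OF refl])
      fix f assume f: "f \<in> onb C c b"
      show "scl C (qdim C b) (g \<cdot> dag C f) \<cdot> f = (if f = g then g else 0)"
        unfolding onb_comp[OF b g f] using id_left[OF onb_hom[OF g]] comp_0(2)[OF onb_hom[OF f]] by auto
    qed
    then show ?thesis using g by simp
  qed
  moreover have "subspace {g \<in> hom C c b. g \<cdot> isotypic c b = g}"
    by (rule subspaceI) (auto simp: hom_add hom_scl comp_0(2)[OF isotypic_hom] comp_add_left[OF isotypic_hom]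
        comp_scl_left[OF isotypic_hom])
  ultimately have "span (onb C c b) \<subseteq> {g \<in> hom C c b. g \<cdot> isotypic c b = g}"
    by (intro span_minimal) auto
  then show ?thesis using g onb_span by auto
qed

lemma comp_isotypic_other:
  assumes "b \<in> irr C" "b' \<in> irr C" "b \<noteq> b'" "g \<in> hom C c b'"
  shows "g \<cdot> isotypic c b = 0"
  unfolding comp_isotypic[OF assms(4)]
proof (rule sum.neutral, rule ballI)
  fix f assume f: "f \<in> onb C c b"
  have "g \<cdot> dag C f = 0"
    using assms f by (intro hom_irr_0[OF assms(1-3)] comp_hom[OF _ assms(4)] dag_hom) auto
  then show "scl C (qdim C b) (g \<cdot> dag C f) \<cdot> f = 0" using comp_0(2)[OF onb_hom[OF f]] by simp
qed

text \<open>
  By the preceding lemmas the sum acts as the identity on all morphisms to simple objects, and the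
  identity of \<open>c\<close> is a sum of morphisms that factor through simple objects.
\<close>

lemma onb_complete:
  assumes S: "finite S" "S \<subseteq> irr C" "{b \<in> irr C. \<exists>f\<in>hom C c b. f \<noteq> 0} \<subseteq> S"
  shows "(\<Sum>b\<in>S. isotypic c b) = idm C c"
proof -
  let ?E = "\<Sum>b\<in>S. isotypic c b"
  have E: "?E \<in> hom C c c" by (intro hom_sum isotypic_hom)
  have wE: "w \<cdot> ?E = w" if b: "b \<in> irr C" and w: "w \<in> hom C c b" for b w
  proof (cases "w = 0")
    case True then show ?thesis using comp_0(2)[OF E] by simp
  next
    case False
    then have bS: "b \<in> S" using S(3) b w by blast
    have "w \<cdot> ?E = (\<Sum>b'\<in>S. w \<cdot> isotypic c b')" by (rule comp_sum_right[OF w isotypic_hom])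
    also have "\<dots> = (\<Sum>b'\<in>S. if b' = b then w else 0)"
    proof (rule sum.cong[OF refl])
      fix b' assume "b' \<in> S"
      then show "w \<cdot> isotypic c b' = (if b' = b then w else 0)"
        using comp_isotypic_same[OF b w] comp_isotypic_other[OF _ b _ w] S(2) by auto
    qed
    finally show ?thesis using bS S(1) by simp
  qed
  have "x \<in> {x \<in> hom C c c. x \<cdot> ?E = x}" if "x \<in> factor_irr c" for x
  proof -
    obtain b u w where x: "x = u \<cdot> w" "b \<in> irr C" "w \<in> hom C c b" "u \<in> hom C b c"
      using \<open>x \<in> factor_irr c\<close> unfolding factor_irr_def by blast
    then show ?thesis using wE[OF x(2,3)] comp_assoc[OF E x(3,4)] comp_hom[OF x(3,4)] by simp
  qed
  moreover have "subspace {x \<in> hom C c c. x \<cdot> ?E = x}"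
    by (rule subspaceI) (auto simp: hom_add hom_scl comp_0(2)[OF E] comp_add_left[OF E] comp_scl_left[OF E])
  ultimately have "span (factor_irr c) \<subseteq> {x \<in> hom C c c. x \<cdot> ?E = x}"
    by (intro span_minimal) auto
  then have "idm C c \<cdot> ?E = idm C c" using identity_factors by blast
  then show ?thesis using id_left[OF E] by simp
qed

section \<open>Functionals on the algebra\<close>

sublocale Du: fd_hilbert_space "hdual (fob F a)" for a by (rule hdual_hilbert[OF fob_hilbert])

sublocale DF: hilbert_pair "hdual (fob F a)" "fob F a" for a by unfold_locales

sublocale DT: fd_hilbert_space "htens (hdual (fob F a)) (fob F a)" for a by (rule DF.htens_hilbert)

abbreviation dten :: "'o \<Rightarrow> 'v dtens hilb" where "dten a \<equiv> htens (hdual (fob F a)) (fob F a)"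
abbreviation dbas :: "'o \<Rightarrow> ('v \<Rightarrow> complex) set" where "dbas a \<equiv> hbasis (hdual (fob F a))"

abbreviation fdual :: "'o \<Rightarrow> ('v \<Rightarrow> complex) set" where
  "fdual a \<equiv> hhom (fob F a) hcomplex"

lemma dbas_fdual: "e \<in> dbas a \<Longrightarrow> e \<in> fdual a"
  using Du.hbasis_carr[of e a] by simp

lemma fdual_comp: "f \<in> fdual c \<Longrightarrow> u \<in> hom C a c \<Longrightarrow> f \<circ> fmor F u \<in> fdual a"
  by (rule hhom_comp[OF fmor_hom _ fob_hilbert])

text \<open>
  A natural family of bilinear forms assigns numbers to the matrix coefficients \<open>f \<otimes> v\<close> of arbitrary
  objects, compatibly with morphisms.  It is determined by its values on the simple objects and hence
  the same as a functional on the algebra (the functional \<open>cg_ext m\<close> below), but more convenient,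
  since products and adjoints lead out of the chosen simple objects.
\<close>

definition nat_form :: "('o \<Rightarrow> ('v \<Rightarrow> complex) \<Rightarrow> 'v \<Rightarrow> complex) \<Rightarrow> bool" where
  "nat_form m \<longleftrightarrow> (\<forall>a. bilin_on (hdual (fob F a)) (fob F a) (*) (m a)) \<and>
    (\<forall>a c. \<forall>u\<in>hom C a c. \<forall>f\<in>fdual c. \<forall>v\<in>car a. m a (f \<circ> fmor F u) v = m c f (fmor F u v))"

lemma nat_form_bilin: "nat_form m \<Longrightarrow> bilin_on (hdual (fob F a)) (fob F a) (*) (m a)"
  and nat_form_nat: "\<lbrakk>nat_form m; u \<in> hom C a c; f \<in> fdual c; v \<in> car a\<rbrakk> \<Longrightarrow>
    m a (f \<circ> fmor F u) v = m c f (fmor F u v)"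
  by (auto simp: nat_form_def)

lemma nat_formD:
  assumes "nat_form m"
  shows "f \<in> fdual a \<Longrightarrow> g \<in> fdual a \<Longrightarrow> v \<in> car a \<Longrightarrow> m a (f + g) v = m a f v + m a g v"
    and "f \<in> fdual a \<Longrightarrow> v \<in> car a \<Longrightarrow> m a (\<lambda>x. c * f x) v = c * m a f v"
    and "f \<in> fdual a \<Longrightarrow> v \<in> car a \<Longrightarrow> w \<in> car a \<Longrightarrow> m a f (v + w) = m a f v + m a f w"
    and "f \<in> fdual a \<Longrightarrow> v \<in> car a \<Longrightarrow> m a f (sc a c v) = c * m a f v"
  using bilin_onD[OF nat_form_bilin[OF assms], of _ a] by simp_all

definition cg_ext :: "('o \<Rightarrow> ('v \<Rightarrow> complex) \<Rightarrow> 'v \<Rightarrow> complex) \<Rightarrow> ('o \<Rightarrow> 'v dtens) \<Rightarrow> complex" where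
  "cg_ext m X = (\<Sum>a\<in>cg_support X. tens_ext (*) (hdual (fob F a)) (fob F a) (m a) (X a))"

abbreviation bilin_family :: "('o \<Rightarrow> ('v \<Rightarrow> complex) \<Rightarrow> 'v \<Rightarrow> complex) \<Rightarrow> bool" where
  "bilin_family m \<equiv> (\<forall>a. bilin_on (hdual (fob F a)) (fob F a) (*) (m a))"

lemma cg_carrierD:
  assumes "X \<in> cg_carrier C F"
  shows "finite (cg_support X)" "cg_support X \<subseteq> irr C" "X a \<in> hcar (dten a)"
  using assms by (auto simp: cg_carrier_def dual_tens_def)

lemma cg_ext_eq:
  assumes m: "bilin_family m" and X: "X \<in> cg_carrier C F" and S: "finite S" "cg_support X \<subseteq> S"
  shows "cg_ext m X = (\<Sum>a\<in>S. \<Sum>e\<in>dbas a. \<Sum>p\<in>bas a. X a e p * m a e p)"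
proof -
  have "cg_ext m X = (\<Sum>a\<in>cg_support X. \<Sum>e\<in>dbas a. \<Sum>p\<in>bas a. X a e p * m a e p)"
    unfolding cg_ext_def using DF.tens_ext(3)[OF vector_space_mult m[rule_format] cg_carrierD(3)[OF X]]
    by (intro sum.cong) auto
  also have "\<dots> = (\<Sum>a\<in>S. \<Sum>e\<in>dbas a. \<Sum>p\<in>bas a. X a e p * m a e p)"
    using S by (intro sum.mono_neutral_left) (auto simp: cg_support_def)
  finally show ?thesis .
qed

lemma cg_support_add: "cg_support (X + Y) \<subseteq> cg_support X \<union> cg_support Y"
  by (auto simp: cg_support_def)

lemma cg_support_scale: "cg_support (cg_scale c X) \<subseteq> cg_support X"
  by (auto simp: cg_support_def cg_scale_def dtens_scale_def fun_eq_iff)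

lemma cg_add_carr:
  assumes "X \<in> cg_carrier C F" "Y \<in> cg_carrier C F" shows "X + Y \<in> cg_carrier C F"
  using assms cg_support_add[of X Y] finite_subset[OF cg_support_add[of X Y]] DT.carr_add
  by (auto simp: cg_carrier_def dual_tens_def)

lemma cg_scale_carr:
  assumes "X \<in> cg_carrier C F" shows "cg_scale c X \<in> cg_carrier C F"
proof -
  have "cg_scale c X a \<in> hcar (dten a)" for a
    using DT.carr_scale[OF cg_carrierD(3)[OF assms, of a], of c] by (simp add: cg_scale_def dtens_scale_def)
  then show ?thesis
    using assms cg_support_scale[of c X] finite_subset[OF cg_support_scale[of c X]]
    by (auto simp: cg_carrier_def dual_tens_def)
qed

lemma cg_0_carr: "0 \<in> cg_carrier C F"
  using DT.carr_0 by (auto simp: cg_carrier_def dual_tens_def cg_support_def)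

lemma cg_ext_add:
  assumes "bilin_family m" "X \<in> cg_carrier C F" "Y \<in> cg_carrier C F"
  shows "cg_ext m (X + Y) = cg_ext m X + cg_ext m Y"
proof -
  let ?S = "cg_support X \<union> cg_support Y"
  have S: "finite ?S" using assms by (simp add: cg_carrierD)
  show ?thesis
    unfolding cg_ext_eq[OF assms(1) cg_add_carr[OF assms(2,3)] S cg_support_add]
      cg_ext_eq[OF assms(1,2) S Un_upper1] cg_ext_eq[OF assms(1,3) S Un_upper2]
    by (simp add: sum.distrib distrib_right)
qed

lemma cg_ext_scale:
  assumes "bilin_family m" "X \<in> cg_carrier C F"
  shows "cg_ext m (cg_scale c X) = c * cg_ext m X"
  unfolding cg_ext_eq[OF assms(1) cg_scale_carr[OF assms(2)] cg_carrierD(1)[OF assms(2)] cg_support_scale]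
    cg_ext_eq[OF assms cg_carrierD(1)[OF assms(2)] subset_refl]
  by (simp add: sum_distrib_left cg_scale_def dtens_scale_def mult.assoc)

lemma cg_sum_carr: "(\<And>i. i \<in> I \<Longrightarrow> X i \<in> cg_carrier C F) \<Longrightarrow> (\<Sum>i\<in>I. X i) \<in> cg_carrier C F"
  by (induction I rule: infinite_finite_induct) (auto simp: cg_0_carr intro: cg_add_carr)

lemma cg_ext_sum:
  assumes "bilin_family m" "\<And>i. i \<in> I \<Longrightarrow> X i \<in> cg_carrier C F"
  shows "cg_ext m (\<Sum>i\<in>I. X i) = (\<Sum>i\<in>I. cg_ext m (X i))"
  using assms(2)
proof (induction I rule: infinite_finite_induct)
  case (insert i I)
  then have "cg_ext m (X i + (\<Sum>i\<in>I. X i)) = cg_ext m (X i) + cg_ext m (\<Sum>i\<in>I. X i)"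
    by (intro cg_ext_add[OF assms(1)] cg_sum_carr) auto
  moreover have "cg_ext m (\<Sum>i\<in>I. X i) = (\<Sum>i\<in>I. cg_ext m (X i))"
    using insert.prems by (intro insert.IH) auto
  ultimately show ?case by (simp only: sum.insert[OF insert.hyps(1,2)])
qed (auto simp: cg_ext_def cg_support_def)

lemma cg_ext_nat:
  assumes "nat_form m" and X: "X \<in> cg_carrier C F"
  shows "cg_ext m X = (\<Sum>a\<in>cg_support X. \<Sum>e\<in>dbas a. \<Sum>p\<in>bas a. X a e p * m a e p)"
  using nat_form_bilin[OF assms(1)] by (intro cg_ext_eq[OF _ X cg_carrierD(1)[OF X]]) auto

lemma tens_ext_cg:
  assumes "hilbert_pair H K" and \<beta>: "bilin_on H K cg_scale \<beta>"
    and c: "\<And>x y. x \<in> hcar H \<Longrightarrow> y \<in> hcar K \<Longrightarrow> \<beta> x y \<in> cg_carrier C F" and T: "T \<in> hcar (htens H K)"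
  shows "tens_ext cg_scale H K \<beta> T \<in> cg_carrier C F"
    and "bilin_family m \<Longrightarrow> cg_ext m (tens_ext cg_scale H K \<beta> T) =
      (\<Sum>x\<in>hbasis H. \<Sum>y\<in>hbasis K. T x y * cg_ext m (\<beta> x y))"
proof -
  interpret hilbert_pair H K by fact
  have eq: "tens_ext cg_scale H K \<beta> T = (\<Sum>x\<in>hbasis H. \<Sum>y\<in>hbasis K. cg_scale (T x y) (\<beta> x y))"
    by (rule tens_ext(3)[OF vector_space_cg \<beta> T])
  have carr: "cg_scale (T x y) (\<beta> x y) \<in> cg_carrier C F" if "x \<in> hbasis H" "y \<in> hbasis K" for x y
    using that by (intro cg_scale_carr c) auto
  show "tens_ext cg_scale H K \<beta> T \<in> cg_carrier C F"
    unfolding eq using carr by (intro cg_sum_carr) auto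
  assume m: "bilin_family m"
  show "cg_ext m (tens_ext cg_scale H K \<beta> T) = (\<Sum>x\<in>hbasis H. \<Sum>y\<in>hbasis K. T x y * cg_ext m (\<beta> x y))"
    unfolding eq using carr c
    by (simp add: cg_ext_sum[OF m] cg_sum_carr cg_ext_scale[OF m])
qed

subsection \<open>Matrix coefficients\<close>

lemma dtens_bilin: "bilin_on (hdual (fob F a)) (fob F a) dtens_scale (dtens (fob F a))"
  using DF.tens_bilin[of a] by (simp add: dtens_def dtens_scale_def[abs_def])

lemma cg_elem_apply:
  assumes "b \<in> irr C"
  shows "cg_elem C F c f v b = (\<Sum>\<alpha>\<in>onb C c b. dtens_scale (qdim C b)
      (dtens (fob F b) (f \<circ> fmor F (dag C \<alpha>)) (fmor F \<alpha> v)))"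
  using assms by (simp add: cg_elem_def fmor_dag[OF onb_hom])

lemma cg_elem_bilin: "bilin_on (hdual (fob F c)) (fob F c) cg_scale (cg_elem C F c)"
proof -
  let ?t = "\<lambda>b \<alpha> f v. dtens_scale (qdim C b) (dtens (fob F b) (f \<circ> fmor F (dag C \<alpha>)) (fmor F \<alpha> v))"
  have t: "bilin_on (hdual (fob F c)) (fob F c) dtens_scale (?t b \<alpha>)" if "\<alpha> \<in> onb C c b" for b \<alpha>
  proof -
    note \<alpha> = onb_hom[OF that] and d = fdual_comp[OF _ dag_hom[OF onb_hom[OF that]]]
    note dt = bilin_onD[OF dtens_bilin[of b], simplified]
    have "(f + g) \<circ> fmor F (dag C \<alpha>) = (f \<circ> fmor F (dag C \<alpha>)) + (g \<circ> fmor F (dag C \<alpha>))"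
      "(\<lambda>x. k * f x) \<circ> fmor F (dag C \<alpha>) = (\<lambda>x. k * (f \<circ> fmor F (dag C \<alpha>)) x)" for f g k by auto
    note cc = this
    show ?thesis
      by (rule bilin_onI; unfold hdual_simps cc; simp only: fmor_add_arg[OF \<alpha>] fmor_scale_arg[OF \<alpha>] dt d fmor_carr[OF \<alpha>])
        (auto simp: o_def dtens_scale_def fun_eq_iff algebra_simps)
  qed
  have e: "cg_elem C F c f v b = (if b \<in> irr C then \<Sum>\<alpha>\<in>onb C c b. ?t b \<alpha> f v else 0)" for b f v
    by (simp add: cg_elem_apply) (simp add: cg_elem_def)
  have s: "dtens_scale k (\<Sum>i\<in>I. h i) = (\<Sum>i\<in>I. dtens_scale k (h i))" for k h and I :: "'m set"
    by (simp add: dtens_scale_def fun_eq_iff sum_fun_apply sum_distrib_left)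
  have s0: "dtens_scale k 0 = 0" for k by (simp add: dtens_scale_def fun_eq_iff)
  note tD = bilin_onD[OF t]
  show ?thesis
    by (rule bilin_onI; rule ext) (simp_all only: e plus_fun_apply cg_scale_def split: if_split,
        simp_all add: sum.distrib s s0 tD del: hdual_simps)
qed

lemma dtens_carr: "f \<in> fdual b \<Longrightarrow> v \<in> car b \<Longrightarrow>
    dtens (fob F b) f v \<in> hcar (dten b)"
  unfolding dtens_def by (rule DF.tens_carr) auto

lemma dtens_scale_carr: "T \<in> hcar (dten b) \<Longrightarrow>
    dtens_scale k T \<in> hcar (dten b)"
  using DT.carr_scale[of T b k] by (simp add: dtens_scale_def)

lemma cg_elem_carr:
  assumes f: "f \<in> fdual c" and v: "v \<in> car c"
  shows "cg_elem C F c f v \<in> cg_carrier C F"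
    and "cg_support (cg_elem C F c f v) \<subseteq> {b \<in> irr C. \<exists>h\<in>hom C c b. h \<noteq> 0}"
proof -
  have z: "fmor F \<alpha> v = 0" if "b \<in> irr C" "\<alpha> \<in> onb C c b" "\<not> (\<exists>h\<in>hom C c b. h \<noteq> 0)" for b \<alpha>
  proof -
    have "\<alpha> = 0" using that(3) onb_hom[OF that(2)] by blast
    then show ?thesis using fmor_0[OF v] by simp
  qed
  show supp: "cg_support (cg_elem C F c f v) \<subseteq> {b \<in> irr C. \<exists>h\<in>hom C c b. h \<noteq> 0}"
  proof (rule subsetI, rule ccontr)
    fix b assume b: "b \<in> cg_support (cg_elem C F c f v)" "b \<notin> {b \<in> irr C. \<exists>h\<in>hom C c b. h \<noteq> 0}"
    show False
    proof (cases "b \<in> irr C")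
      case True
      then have "cg_elem C F c f v b = (\<Sum>\<alpha>\<in>onb C c b. dtens_scale (qdim C b) (dtens (fob F b) (f \<circ> fmor F (dag C \<alpha>)) 0))"
        using b(2) z by (simp add: cg_elem_apply[OF True])
      also have "\<dots> = 0"
      proof (rule sum.neutral, rule ballI)
        fix \<alpha> assume "\<alpha> \<in> onb C c b"
        from fdual_comp[OF f dag_hom[OF onb_hom[OF this]]]
        have "f \<circ> fmor F (dag C \<alpha>) \<in> hcar (hdual (fob F b))" by simp
        from bilin_onD(4)[OF dtens_bilin this Fo.carr_0, of 0]
        show "dtens_scale (qdim C b) (dtens (fob F b) (f \<circ> fmor F (dag C \<alpha>)) 0) = 0"
          by (simp add: dtens_scale_def fun_eq_iff)
      qed
      finally show False using b(1) by (simp add: cg_support_def)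
    next
      case False then show False using b(1) by (simp add: cg_support_def cg_elem_def)
    qed
  qed
  have "cg_elem C F c f v b \<in> hcar (dten b)" for b
  proof (cases "b \<in> irr C")
    case True
    show ?thesis unfolding cg_elem_apply[OF True]
      by (intro DT.carr_sum dtens_scale_carr dtens_carr fdual_comp[OF f] dag_hom onb_hom fmor_carr[OF _ v])
  next
    case False then show ?thesis using DT.carr_0 by (simp add: cg_elem_def)
  qed
  then show "cg_elem C F c f v \<in> cg_carrier C F"
    using supp finite_subset[OF supp finite_irr_targets]
    by (auto simp: cg_carrier_def dual_tens_def)
qed

text \<open>
  The orthonormal bases resolve the identity of \<open>c\<close>; by naturality the form may be evaluated before or
  after the decomposition into simple objects.
\<close>

lemma cg_ext_elem:
  assumes m: "nat_form m" and f: "f \<in> fdual c" and v: "v \<in> car c"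
  shows "cg_ext m (cg_elem C F c f v) = m c f v"
proof -
  let ?S = "{b \<in> irr C. \<exists>h\<in>hom C c b. h \<noteq> 0}" and ?X = "cg_elem C F c f v"
  let ?te = "\<lambda>a. tens_ext (*) (hdual (fob F a)) (fob F a) (m a)"
  note te = DF.tens_ext[OF vector_space_mult nat_form_bilin[OF m]]
  have b: "?te b (?X b) = m c f (fmor F (isotypic c b) v)" if "b \<in> irr C" for b
  proof -
    have carr: "dtens (fob F b) (f \<circ> fmor F (dag C \<alpha>)) (fmor F \<alpha> v) \<in> hcar (dten b)"
      if "\<alpha> \<in> onb C c b" for \<alpha>
      using that by (intro dtens_carr fdual_comp[OF f] dag_hom onb_hom fmor_carr[OF _ v])
    have d: "dag C \<alpha> \<in> hom C b c" "\<alpha> \<in> hom C c b" if "\<alpha> \<in> onb C c b" for \<alpha>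
      using that by (auto intro: dag_hom)
    have x: "fmor F (dag C \<alpha>) (fmor F \<alpha> v) \<in> car c" if "\<alpha> \<in> onb C c b" for \<alpha>
      using d[OF that] v by (intro fmor_carr[of _ b] fmor_carr[of \<alpha> c b])
    have "?te b (?X b) = (\<Sum>\<alpha>\<in>onb C c b. ?te b (dtens_scale (qdim C b) (dtens (fob F b) (f \<circ> fmor F (dag C \<alpha>)) (fmor F \<alpha> v))))"
      unfolding cg_elem_apply[OF that] by (intro DT.lin_on_sum[OF te(1)] dtens_scale_carr carr)
    also have "\<dots> = (\<Sum>\<alpha>\<in>onb C c b. qdim C b * m c f (fmor F (dag C \<alpha>) (fmor F \<alpha> v)))"
    proof (rule sum.cong[OF refl])
      fix \<alpha> assume \<alpha>: "\<alpha> \<in> onb C c b"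
      have "?te b (dtens_scale (qdim C b) (dtens (fob F b) (f \<circ> fmor F (dag C \<alpha>)) (fmor F \<alpha> v))) =
          qdim C b * ?te b (dtens (fob F b) (f \<circ> fmor F (dag C \<alpha>)) (fmor F \<alpha> v))"
        using lin_onD(2)[OF te(1) carr[OF \<alpha>], of "qdim C b"] by (simp add: dtens_scale_def)
      also have "?te b (dtens (fob F b) (f \<circ> fmor F (dag C \<alpha>)) (fmor F \<alpha> v)) = m b (f \<circ> fmor F (dag C \<alpha>)) (fmor F \<alpha> v)"
        unfolding dtens_def using te(2) fdual_comp[OF f d(1)[OF \<alpha>]] fmor_carr[OF d(2)[OF \<alpha>] v] by simp
      also have "\<dots> = m c f (fmor F (dag C \<alpha>) (fmor F \<alpha> v))"
        by (rule nat_form_nat[OF m d(1)[OF \<alpha>] f fmor_carr[OF d(2)[OF \<alpha>] v]])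
      finally show "?te b (dtens_scale (qdim C b) (dtens (fob F b) (f \<circ> fmor F (dag C \<alpha>)) (fmor F \<alpha> v))) =
          qdim C b * m c f (fmor F (dag C \<alpha>) (fmor F \<alpha> v))" .
    qed
    also have "\<dots> = (\<Sum>\<alpha>\<in>onb C c b. m c f (sc c (qdim C b) (fmor F (dag C \<alpha>) (fmor F \<alpha> v))))"
      using nat_formD(4)[OF m f x] by simp
    also have "\<dots> = m c f (\<Sum>\<alpha>\<in>onb C c b. sc c (qdim C b) (fmor F (dag C \<alpha>) (fmor F \<alpha> v)))"
      using DF.bilin_on_sum_right[OF nat_form_bilin[OF m], of "onb C c b" _ c f] f x by simp
    also have "(\<Sum>\<alpha>\<in>onb C c b. sc c (qdim C b) (fmor F (dag C \<alpha>) (fmor F \<alpha> v))) = fmor F (isotypic c b) v"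
      unfolding isotypic_def using v d comp_hom[OF d(2,1)]
      by (subst fmor_sum[of _ _ c c]) (simp_all add: hom_scl fmor_scl[of _ c c] fmor_comp_apply[OF d(2,1)])
    finally show ?thesis .
  qed
  have "cg_ext m ?X = (\<Sum>b\<in>?S. ?te b (?X b))"
    unfolding cg_ext_def
  proof (rule sum.mono_neutral_left[OF finite_irr_targets cg_elem_carr(2)[OF f v]], rule ballI)
    fix b assume "b \<in> ?S - cg_support ?X"
    then have "?X b = 0" by (simp add: cg_support_def)
    then show "?te b (?X b) = 0" using DT.lin_on_0[OF te(1)] by simp
  qed
  also have "\<dots> = (\<Sum>b\<in>?S. m c f (fmor F (isotypic c b) v))"
    by (rule sum.cong[OF refl]) (simp add: b)
  also have "\<dots> = m c f (\<Sum>b\<in>?S. fmor F (isotypic c b) v)"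
    using DF.bilin_on_sum_right[OF nat_form_bilin[OF m], of ?S "\<lambda>b. fmor F (isotypic c b) v" c f]
      f fmor_carr[OF isotypic_hom v] by simp
  also have "(\<Sum>b\<in>?S. fmor F (isotypic c b) v) = fmor F (\<Sum>b\<in>?S. isotypic c b) v"
    by (rule fmor_sum[OF isotypic_hom v, symmetric])
  also have "(\<Sum>b\<in>?S. isotypic c b) = idm C c" by (rule onb_complete[OF finite_irr_targets]) auto
  finally show ?thesis using v by (simp add: fmor_id_apply)
qed

text \<open>
  For isometries \<open>p : a \<rightarrow> d\<close>, \<open>q : b \<rightarrow> d\<close> of a direct sum take \<open>f' = f p\<^sup>* + g q\<^sup>*\<close> and
  \<open>v' = p v + q w\<close>; the mixed terms vanish because \<open>p\<^sup>* q = 0\<close>.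
\<close>

lemma coefficient_sum:
  assumes fg: "f \<in> fdual a" "v \<in> car a" "g \<in> fdual b" "w \<in> car b"
  shows "\<exists>d. \<exists>f'\<in>fdual d. \<exists>v'\<in>car d. \<forall>m. nat_form m \<longrightarrow> m a f v + m b g w = m d f' v'"
proof -
  obtain d p q where pq: "p \<in> hom C a d" "q \<in> hom C b d" "dag C p \<cdot> p = idm C a" "dag C q \<cdot> q = idm C b"
    "p \<cdot> dag C p + q \<cdot> dag C q = idm C d" using direct_sums[of a b] by blast
  note dp = dag_hom[OF pq(1)] and dq = dag_hom[OF pq(2)]
  have pq0: "dag C p \<cdot> q = 0"
  proof -
    have "dag C p \<cdot> (p \<cdot> dag C p + q \<cdot> dag C q) = dag C p" using pq(5) id_right[OF dp] by simp
    then have "dag C p \<cdot> (q \<cdot> dag C q) = 0"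
      using comp_add_right[OF comp_hom[OF dp pq(1)] comp_hom[OF dq pq(2)] dp]
        comp_assoc[OF dp pq(1) dp] pq(3) id_left[OF dp] by simp
    then have "((dag C p \<cdot> q) \<cdot> dag C q) \<cdot> q = 0"
      using comp_assoc[OF dq pq(2) dp] comp_0(2)[OF pq(2)] by simp
    then show ?thesis
      using comp_assoc[OF pq(2) dq comp_hom[OF pq(2) dp]] pq(4) id_right[OF comp_hom[OF pq(2) dp]] by simp
  qed
  have qp0: "dag C q \<cdot> p = 0"
    using dag_comp[OF pq(2) dp] dag_dag[OF pq(1)] pq0 dag_scl[OF hom_0, where z = 0] by simp
  define f' where "f' = (f \<circ> fmor F (dag C p)) + (g \<circ> fmor F (dag C q))"
  define v' where "v' = fmor F p v + fmor F q w"
  have f1: "f \<circ> fmor F (dag C p) \<in> fdual d" "g \<circ> fmor F (dag C q) \<in> fdual d"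
    by (rule fdual_comp[OF fg(1) dp], rule fdual_comp[OF fg(3) dq])
  have f': "f' \<in> fdual d" unfolding f'_def by (rule Fo.functional_add[OF f1])
  have v1: "fmor F p v \<in> car d" "fmor F q w \<in> car d"
    by (rule fmor_carr[OF pq(1) fg(2)], rule fmor_carr[OF pq(2) fg(4)])
  have v': "v' \<in> car d" unfolding v'_def using v1 by simp
  have "m a f v + m b g w = m d f' v'" if m: "nat_form m" for m
  proof -
    have "fmor F (dag C p) (fmor F p v) = v" "fmor F (dag C p) (fmor F q w) = 0"
      "fmor F (dag C q) (fmor F q w) = w" "fmor F (dag C q) (fmor F p v) = 0"
      using fmor_comp_apply[OF pq(1) dp, of v] fmor_comp_apply[OF pq(2) dp, of w]
        fmor_comp_apply[OF pq(2) dq, of w] fmor_comp_apply[OF pq(1) dq, of v] fg(2) fg(4)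
      by (simp_all add: pq pq0 qp0 fmor_id_apply fmor_0)
    then have "fmor F (dag C p) v' = v" "fmor F (dag C q) v' = w"
      unfolding v'_def by (simp_all add: fmor_add_arg[OF dp v1] fmor_add_arg[OF dq v1])
    moreover have "m d f' v' = m a f (fmor F (dag C p) v') + m b g (fmor F (dag C q) v')"
      unfolding f'_def nat_formD(1)[OF m f1 v'] nat_form_nat[OF m dp fg(1) v'] nat_form_nat[OF m dq fg(3) v'] ..
    ultimately show ?thesis by simp
  qed
  then show ?thesis using f' v' by blast
qed

text \<open>
  By induction over the finitely many terms of \<open>X\<close>.  The coefficient does not depend on \<open>m\<close>, so that it
  can be used in both arguments of a sesquilinear form.
\<close>

lemma single_coefficient:
  assumes X: "X \<in> cg_carrier C F"
  shows "\<exists>c. \<exists>f\<in>fdual c. \<exists>v\<in>car c. \<forall>m. nat_form m \<longrightarrow> cg_ext m X = m c f v"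
proof -
  have *: "\<exists>c. \<exists>f\<in>fdual c. \<exists>v\<in>car c. \<forall>m. nat_form m \<longrightarrow> (\<Sum>i\<in>I. m (a i) (g i) (w i)) = m c f v"
    if "finite I" "\<And>i. i \<in> I \<Longrightarrow> g i \<in> fdual (a i) \<and> w i \<in> car (a i)"
    for I :: "('o \<times> ('v \<Rightarrow> complex) \<times> 'v) set" and a g w
    using that
  proof (induction I rule: finite_induct)
    case empty
    have "m (unt C) (\<lambda>_. 0) 0 = 0" if "nat_form m" for m
      using nat_formD(4)[OF that Fo.functional_0(2) Fo.carr_0, where c = 0] by simp
    then show ?case using Fo.functional_0(2) Fo.carr_0
      by (intro exI[of _ "unt C"] bexI[of _ "\<lambda>_. 0"] bexI[of _ 0]) auto
  next
    case (insert i I)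
    then obtain c f v where c: "f \<in> fdual c" "v \<in> car c"
      "\<And>m. nat_form m \<Longrightarrow> (\<Sum>i\<in>I. m (a i) (g i) (w i)) = m c f v" by auto
    have i: "g i \<in> fdual (a i)" "w i \<in> car (a i)" using insert.prems by auto
    obtain d f' v' where "f' \<in> fdual d" "v' \<in> car d"
      "\<And>m. nat_form m \<Longrightarrow> m (a i) (g i) (w i) + m c f v = m d f' v'"
      using coefficient_sum[OF i c(1,2)] by blast
    then show ?case using c(3) insert.hyps by (intro exI[of _ d] bexI[of _ f'] bexI[of _ v']) auto
  qed
  define I where "I = Sigma (cg_support X) (\<lambda>a. dbas a \<times> bas a)"
  have "finite I" unfolding I_def using cg_carrierD(1)[OF X] by (intro finite_SigmaI) auto
  moreover have "(\<lambda>x. X (fst i) (fst (snd i)) (snd (snd i)) * fst (snd i) x) \<in> fdual (fst i) \<and>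
      snd (snd i) \<in> car (fst i)" if "i \<in> I" for i
    using that dbas_fdual unfolding I_def
    by (auto intro!: Fo.functional_scale)
  ultimately obtain c f v where c: "f \<in> fdual c" "v \<in> car c" "\<And>m. nat_form m \<Longrightarrow>
      (\<Sum>i\<in>I. m (fst i) (\<lambda>x. X (fst i) (fst (snd i)) (snd (snd i)) * fst (snd i) x) (snd (snd i))) = m c f v"
    using *[of I "\<lambda>i x. X (fst i) (fst (snd i)) (snd (snd i)) * fst (snd i) x" fst "\<lambda>i. snd (snd i)"] by blast
  have "cg_ext m X = m c f v" if m: "nat_form m" for m
  proof -
    have "cg_ext m X = (\<Sum>a\<in>cg_support X. \<Sum>e\<in>dbas a. \<Sum>p\<in>bas a. X a e p * m a e p)"
      by (rule cg_ext_nat[OF m X])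
    also have "\<dots> = (\<Sum>i\<in>I. X (fst i) (fst (snd i)) (snd (snd i)) * m (fst i) (fst (snd i)) (snd (snd i)))"
      unfolding I_def using cg_carrierD(1)[OF X] by (simp add: sum.cartesian_product sum.Sigma split_def)
    also have "\<dots> = (\<Sum>i\<in>I. m (fst i) (\<lambda>x. X (fst i) (fst (snd i)) (snd (snd i)) * fst (snd i) x) (snd (snd i)))"
    proof (rule sum.cong[OF refl])
      fix i assume "i \<in> I"
      then have "fst (snd i) \<in> fdual (fst i)" "snd (snd i) \<in> car (fst i)"
        using dbas_fdual by (auto simp: I_def)
      then show "X (fst i) (fst (snd i)) (snd (snd i)) * m (fst i) (fst (snd i)) (snd (snd i)) =
          m (fst i) (\<lambda>x. X (fst i) (fst (snd i)) (snd (snd i)) * fst (snd i) x) (snd (snd i))"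
        by (simp add: nat_formD(2)[OF m])
    qed
    also have "\<dots> = m c f v" by (rule c(3)[OF m])
    finally show ?thesis .
  qed
  then show ?thesis using c(1,2) by blast
qed

lemma nat_formI:
  assumes "\<And>a f g v. f \<in> fdual a \<Longrightarrow> g \<in> fdual a \<Longrightarrow> v \<in> car a \<Longrightarrow> m a (f + g) v = m a f v + m a g v"
    and "\<And>a f v c. f \<in> fdual a \<Longrightarrow> v \<in> car a \<Longrightarrow> m a (\<lambda>x. c * f x) v = c * m a f v"
    and "\<And>a f v w. f \<in> fdual a \<Longrightarrow> v \<in> car a \<Longrightarrow> w \<in> car a \<Longrightarrow> m a f (v + w) = m a f v + m a f w"
    and "\<And>a f v c. f \<in> fdual a \<Longrightarrow> v \<in> car a \<Longrightarrow> m a f (sc a c v) = c * m a f v"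
    and "\<And>a c u f v. u \<in> hom C a c \<Longrightarrow> f \<in> fdual c \<Longrightarrow> v \<in> car a \<Longrightarrow>
      m a (f \<circ> fmor F u) v = m c f (fmor F u v)"
  shows "nat_form m"
proof -
  have "bilin_on (hdual (fob F a)) (fob F a) (*) (m a)" for a
    by (rule bilin_onI) (use assms(1-4) in simp_all)
  then show ?thesis unfolding nat_form_def using assms(5) by blast
qed

subsection \<open>Multiplication\<close>

text \<open>
  The product of \<open>f\<close> and \<open>g\<close> in the algebra object, \<open>(f \<otimes> g) \<circ> \<eta>\<inverse>\<close>.
\<close>

definition fprod :: "'o \<Rightarrow> 'o \<Rightarrow> ('v \<Rightarrow> complex) \<Rightarrow> ('v \<Rightarrow> complex) \<Rightarrow> 'v \<Rightarrow> complex" where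
  "fprod a b f g = tens_ext (*) (fob F a) (fob F b) (\<lambda>v w. f v * g w) \<circ> feta_inv a b"

lemma functional_mult_bilin:
  "f \<in> fdual a \<Longrightarrow> g \<in> fdual b \<Longrightarrow> bilin_on (fob F a) (fob F b) (*) (\<lambda>v w. f v * g w)"
  by (rule bilin_onI) (auto simp: hhomD algebra_simps)

lemma fprod_dual:
  assumes "f \<in> fdual a" "g \<in> fdual b"
  shows "fprod a b f g \<in> fdual (a \<otimes> b)"
proof -
  have "tens_ext (*) (fob F a) (fob F b) (\<lambda>v w. f v * g w) \<in> hhom (htens (fob F a) (fob F b)) hcomplex"
    using FF.tens_ext(1)[OF vector_space_mult functional_mult_bilin[OF assms]] by (simp add: hhom_def)
  then show ?thesis unfolding fprod_def by (rule hhom_comp[OF feta_inv_hom _ FF.htens_hilbert])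
qed

lemma fprod_et:
  assumes "f \<in> fdual a" "g \<in> fdual b" "v \<in> car a" "w \<in> car b"
  shows "fprod a b f g (et a b v w) = f v * g w"
  using FF.tens_ext(2)[OF vector_space_mult functional_mult_bilin[OF assms(1,2)] assms(3,4)]
  by (simp add: fprod_def et_def feta_inv_feta[OF FF.tens_carr[OF assms(3,4)]])

lemma fdual_et_eqI:
  assumes "f \<in> fdual (a \<otimes> b)" "g \<in> fdual (a \<otimes> b)"
    and "\<And>x y. x \<in> car a \<Longrightarrow> y \<in> car b \<Longrightarrow> f (et a b x y) = g (et a b x y)"
  shows "f = g"
  using hhomD(1)[OF assms(1)] hhomD(1)[OF assms(2)] assms(3) by (rule lin_on_et_eqI)

lemma fprod_linear:
  assumes "f \<in> fdual a" "g \<in> fdual b"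
  shows "f' \<in> fdual a \<Longrightarrow> fprod a b (f + f') g = fprod a b f g + fprod a b f' g"
    and "g' \<in> fdual b \<Longrightarrow> fprod a b f (g + g') = fprod a b f g + fprod a b f g'"
    and "fprod a b (\<lambda>x. c * f x) g = (\<lambda>x. c * fprod a b f g x)"
    and "fprod a b f (\<lambda>x. c * g x) = (\<lambda>x. c * fprod a b f g x)"
proof -
  note d = fprod_dual Fo.functional_add Fo.functional_scale assms
  show "fprod a b (f + f') g = fprod a b f g + fprod a b f' g" if "f' \<in> fdual a"
    by (rule fdual_et_eqI[of _ a b]) (simp_all add: d fprod_et distrib_right that)
  show "fprod a b f (g + g') = fprod a b f g + fprod a b f g'" if "g' \<in> fdual b"
    by (rule fdual_et_eqI[of _ a b]) (simp_all add: d fprod_et distrib_left that)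
  show "fprod a b (\<lambda>x. c * f x) g = (\<lambda>x. c * fprod a b f g x)"
    by (rule fdual_et_eqI[of _ a b]) (simp_all add: d fprod_et)
  show "fprod a b f (\<lambda>x. c * g x) = (\<lambda>x. c * fprod a b f g x)"
    by (rule fdual_et_eqI[of _ a b]) (simp_all add: d fprod_et)
qed

lemma fprod_natural:
  assumes u: "u \<in> hom C a a'" and w: "w \<in> hom C b b'" and f: "f \<in> fdual a'" and g: "g \<in> fdual b'"
  shows "fprod a b (f \<circ> fmor F u) (g \<circ> fmor F w) = fprod a' b' f g \<circ> fmor F (u \<boxtimes> w)"
proof (rule fdual_et_eqI[of _ a b])
  show "fprod a b (f \<circ> fmor F u) (g \<circ> fmor F w) \<in> fdual (a \<otimes> b)"
    by (intro fprod_dual fdual_comp[OF f u] fdual_comp[OF g w])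
  show "fprod a' b' f g \<circ> fmor F (u \<boxtimes> w) \<in> fdual (a \<otimes> b)"
    by (intro fdual_comp[OF fprod_dual[OF f g]] tmor_hom u w)
  fix x y assume xy: "x \<in> car a" "y \<in> car b"
  show "fprod a b (f \<circ> fmor F u) (g \<circ> fmor F w) (et a b x y) = (fprod a' b' f g \<circ> fmor F (u \<boxtimes> w)) (et a b x y)"
    using fprod_et[OF fdual_comp[OF f u] fdual_comp[OF g w] xy] xy
    by (simp add: fmor_et[OF u w] fprod_et[OF f g] fmor_carr[OF u] fmor_carr[OF w])
qed

text \<open>
  The value of \<open>m\<close> at the product of the coefficients \<open>f \<otimes> v\<close> of \<open>a\<close> and \<open>g \<otimes> w\<close> of \<open>b\<close>, which is a
  coefficient of \<open>a \<otimes> b\<close>.  It is a natural form in either coefficient.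
\<close>

abbreviation mult_form :: "('o \<Rightarrow> ('v \<Rightarrow> complex) \<Rightarrow> 'v \<Rightarrow> complex) \<Rightarrow>
    'o \<Rightarrow> ('v \<Rightarrow> complex) \<Rightarrow> 'v \<Rightarrow> 'o \<Rightarrow> ('v \<Rightarrow> complex) \<Rightarrow> 'v \<Rightarrow> complex" where
  "mult_form m a f v b g w \<equiv> m (a \<otimes> b) (fprod a b f g) (et a b v w)"

lemma mult_form_right:
  assumes m: "nat_form m" and f: "f \<in> fdual a" and v: "v \<in> car a"
  shows "nat_form (mult_form m a f v)"
proof (rule nat_formI)
  show "mult_form m a f v b (g \<circ> fmor F u) w = mult_form m a f v c g (fmor F u w)"
    if u: "u \<in> hom C b c" and g: "g \<in> fdual c" and w: "w \<in> car b" for b c u g w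
  proof -
    have "f \<circ> fmor F (idm C a) = f"
      using fdual_comp[OF f id_hom] f by (rule Fo.functional_eqI) (simp add: fmor_id_apply)
    then have "fprod a b f (g \<circ> fmor F u) = fprod a c f g \<circ> fmor F (idm C a \<boxtimes> u)"
      using fprod_natural[OF id_hom u f g] by simp
    then show ?thesis
      using nat_form_nat[OF m tmor_hom[OF id_hom u] fprod_dual[OF f g] et_carr[OF v w]] v w
      by (simp add: fmor_et[OF id_hom u] fmor_id_apply)
  qed
qed (use f v in \<open>simp_all add: nat_formD[OF m] fprod_dual fprod_linear et_add_right et_scale_right\<close>)

lemma mult_form_left:
  assumes m: "nat_form m" and g: "g \<in> fdual b" and w: "w \<in> car b"
  shows "nat_form (\<lambda>a f v. mult_form m a f v b g w)"
proof (rule nat_formI)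
  show "mult_form m a (f \<circ> fmor F u) v b g w = mult_form m c f (fmor F u v) b g w"
    if u: "u \<in> hom C a c" and f: "f \<in> fdual c" and v: "v \<in> car a" for a c u f v
  proof -
    have "g \<circ> fmor F (idm C b) = g"
      using fdual_comp[OF g id_hom] g by (rule Fo.functional_eqI) (simp add: fmor_id_apply)
    then have "fprod a b (f \<circ> fmor F u) g = fprod c b f g \<circ> fmor F (u \<boxtimes> idm C b)"
      using fprod_natural[OF u id_hom f g] by simp
    then show ?thesis
      using nat_form_nat[OF m tmor_hom[OF u id_hom] fprod_dual[OF f g] et_carr[OF v w]] v w
      by (simp add: fmor_et[OF u id_hom] fmor_id_apply)
  qed
qed (use g w in \<open>simp_all add: nat_formD[OF m] fprod_dual fprod_linear et_add_left et_scale_left\<close>)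

lemma mult_form_ext:
  assumes m: "nat_form m" and Y: "Y \<in> cg_carrier C F"
  shows "nat_form (\<lambda>a f v. cg_ext (mult_form m a f v) Y)"
proof -
  have eq: "cg_ext (mult_form m a f v) Y = (\<Sum>b\<in>cg_support Y. \<Sum>e\<in>dbas b.
      \<Sum>p\<in>bas b. Y b e p * mult_form m a f v b e p)"
    if "f \<in> fdual a" "v \<in> car a" for a f v
    by (rule cg_ext_nat[OF mult_form_right[OF m that] Y])
  note e = dbas_fdual
  note n = nat_formD[OF mult_form_left[OF m e Fo.hbasis_carr]]
  show ?thesis
  proof (rule nat_formI)
    fix a c u f v assume u: "u \<in> hom C a c" and f: "f \<in> fdual c" and v: "v \<in> car a"
    show "cg_ext (mult_form m a (f \<circ> fmor F u) v) Y = cg_ext (mult_form m c f (fmor F u v)) Y"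
      unfolding eq[OF fdual_comp[OF f u] v] eq[OF f fmor_carr[OF u v]]
      using nat_form_nat[OF mult_form_left[OF m e Fo.hbasis_carr] u f v] by simp
  qed (simp_all add: eq Fo.functional_add Fo.functional_scale n distrib_left sum.distrib
        sum_distrib_left mult.left_commute)
qed

lemma cg_mult_elem_eq:
  assumes "f \<in> fdual a" "g \<in> fdual b" "v \<in> car a" "w \<in> car b"
  shows "cg_mult_elem C F a b f v g w = cg_elem C F (a \<otimes> b) (fprod a b f g) (et a b v w)"
proof
  fix c
  have "hadj (htens (fob F a) (fob F b)) (fob F c) (hat F a b \<alpha>) =
      feta_inv a b \<circ> hadj (fob F (a \<otimes> b)) (fob F c) (fmor F \<alpha>)" if "\<alpha> \<in> onb C (a \<otimes> b) c" for \<alpha>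
    unfolding hat_def
    by (rule hadj_comp[OF FF.htens_hilbert fob_hilbert fob_hilbert feta_hom fmor_hom[OF onb_hom[OF that]]])
  then show "cg_mult_elem C F a b f v g w c = cg_elem C F (a \<otimes> b) (fprod a b f g) (et a b v w) c"
    by (simp add: cg_mult_elem_def cg_elem_def Let_def fprod_def hat_def et_def comp_assoc o_assoc)
qed

text \<open>
  On coefficients of simple objects this is \<open>cg_mult_elem_eq\<close>; both sides extend bilinearly.
\<close>

lemma cg_ext_mult:
  assumes m: "nat_form m" and X: "X \<in> cg_carrier C F" and Y: "Y \<in> cg_carrier C F"
  shows "cg_ext m (cg_mult C F X Y) = cg_ext (\<lambda>a f v. cg_ext (mult_form m a f v) Y) X"
proof -
  have mb: "bilin_family m" using nat_form_bilin[OF m] by blast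
  let ?B = "\<lambda>a b x1 x2. \<lambda>y1 y2. cg_mult_elem C F a b x1 x2 y1 y2"
  let ?I = "\<lambda>a b x1 x2. tens_ext cg_scale (hdual (fob F b)) (fob F b) (?B a b x1 x2) (Y b)"
  have el: "bilin_on (hdual (fob F c)) (fob F c) cg_scale (cg_elem C F c)" for c by (rule cg_elem_bilin)
  note eld = bilin_onD[OF el, simplified]
  have B: "bilin_on (hdual (fob F b)) (fob F b) cg_scale (?B a b x1 x2)"
    if "x1 \<in> fdual a" "x2 \<in> car a" for a b x1 x2
    by (rule bilin_onI)
      (use that in \<open>simp_all add: cg_mult_elem_eq Fo.functional_add Fo.functional_scale fprod_linear
        et_add_right et_scale_right eld fprod_dual\<close>)
  have Bc: "?B a b x1 x2 y1 y2 \<in> cg_carrier C F"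
    if "x1 \<in> fdual a" "x2 \<in> car a" "y1 \<in> fdual b" "y2 \<in> car b" for a b x1 x2 y1 y2
    unfolding cg_mult_elem_eq[OF that(1,3,2,4)] using that by (intro cg_elem_carr fprod_dual) auto
  note Yc = cg_carrierD(3)[OF Y] and Xc = cg_carrierD(3)[OF X]
  have pb: "hilbert_pair (hdual (fob F b)) (fob F b)" for b by unfold_locales
  note e = dbas_fdual
  have I_eq: "?I a b x1 x2 = (\<Sum>s\<in>dbas b. \<Sum>p\<in>bas b. cg_scale (Y b s p) (?B a b x1 x2 s p))"
    if "x1 \<in> fdual a" "x2 \<in> car a" for a b x1 x2
    by (rule DF.tens_ext(3)[OF vector_space_cg B[OF that] Yc])
  have Ic: "?I a b x1 x2 \<in> cg_carrier C F" if "x1 \<in> fdual a" "x2 \<in> car a" for a b x1 x2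
    using Bc that by (intro tens_ext_cg(1)[OF pb B[OF that] _ Yc]) auto
  have Iext: "cg_ext m (?I a b x1 x2) = (\<Sum>s\<in>dbas b. \<Sum>p\<in>bas b. Y b s p * mult_form m a x1 x2 b s p)"
    if "x1 \<in> fdual a" "x2 \<in> car a" for a b x1 x2
  proof -
    have "cg_ext m (?I a b x1 x2) = (\<Sum>s\<in>dbas b. \<Sum>p\<in>bas b. Y b s p * cg_ext m (?B a b x1 x2 s p))"
      using Bc that by (intro tens_ext_cg(2)[OF pb B[OF that] _ Yc mb]) auto
    also have "\<dots> = (\<Sum>s\<in>dbas b. \<Sum>p\<in>bas b. Y b s p * mult_form m a x1 x2 b s p)"
      using that e by (intro sum.cong refl)
        (simp add: cg_mult_elem_eq cg_ext_elem[OF m fprod_dual et_carr])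
    finally show ?thesis .
  qed
  interpret cgv: vector_space "cg_scale :: complex \<Rightarrow> ('o \<Rightarrow> 'v dtens) \<Rightarrow> 'o \<Rightarrow> 'v dtens" by (rule vector_space_cg)
  have IB: "bilin_on (hdual (fob F a)) (fob F a) cg_scale (?I a b)" for a b
  proof (rule bilin_onI)
    fix x x' y y' c
    note simps = I_eq Fo.functional_add Fo.functional_scale cg_mult_elem_eq e fprod_linear et_add_left et_scale_left
      eld fprod_dual cgv.scale_right_distrib sum.distrib cgv.scale_sum_right
    show "?I a b (x + x') y = ?I a b x y + ?I a b x' y"
      if "x \<in> hcar (hdual (fob F a))" "x' \<in> hcar (hdual (fob F a))" "y \<in> car a"
      using that by (simp add: simps)
    show "?I a b x (y + y') = ?I a b x y + ?I a b x y'"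
      if "x \<in> hcar (hdual (fob F a))" "y \<in> car a" "y' \<in> car a"
      using that by (simp add: simps)
    show "?I a b (hsc (hdual (fob F a)) c x) y = cg_scale c (?I a b x y)"
      if "x \<in> hcar (hdual (fob F a))" "y \<in> car a"
      using that by (simp add: simps mult.commute)
    show "?I a b x (sc a c y) = cg_scale c (?I a b x y)"
      if "x \<in> hcar (hdual (fob F a))" "y \<in> car a"
      using that by (simp add: simps mult.commute)
  qed
  have c1: "tens_ext cg_scale (hdual (fob F a)) (fob F a) (?I a b) (X a) \<in> cg_carrier C F" for a b
    using Ic by (intro tens_ext_cg(1)[OF pb IB _ Xc]) auto
  have "cg_ext m (cg_mult C F X Y) = (\<Sum>a\<in>cg_support X. \<Sum>b\<in>cg_support Y.
      cg_ext m (tens_ext cg_scale (hdual (fob F a)) (fob F a) (?I a b) (X a)))"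
    unfolding cg_mult_def using c1 by (simp add: cg_ext_sum[OF mb] cg_sum_carr)
  also have "\<dots> = (\<Sum>a\<in>cg_support X. \<Sum>b\<in>cg_support Y. \<Sum>e\<in>dbas a. \<Sum>q\<in>bas a.
      X a e q * cg_ext m (?I a b e q))"
    using Ic by (intro sum.cong refl tens_ext_cg(2)[OF pb IB _ Xc mb]) auto
  also have "\<dots> = (\<Sum>a\<in>cg_support X. \<Sum>e\<in>dbas a. \<Sum>q\<in>bas a.
      X a e q * (\<Sum>b\<in>cg_support Y. cg_ext m (?I a b e q)))"
    by (rule sum.cong[OF refl]) (simp add: sum.swap[of _ _ "cg_support Y"] sum_distrib_left)
  also have "\<dots> = (\<Sum>a\<in>cg_support X. \<Sum>e\<in>dbas a. \<Sum>q\<in>bas a.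
      X a e q * cg_ext (mult_form m a e q) Y)"
  proof (intro sum.cong refl arg_cong2[where f = "(*)"])
    fix a s q assume "s \<in> dbas a" "q \<in> bas a"
    then have sq: "s \<in> fdual a" "q \<in> car a" using e by auto
    have "cg_ext (mult_form m a s q) Y = (\<Sum>b\<in>cg_support Y. \<Sum>e\<in>dbas b.
        \<Sum>p\<in>bas b. Y b e p * mult_form m a s q b e p)"
      by (rule cg_ext_nat[OF mult_form_right[OF m sq] Y])
    then show "(\<Sum>b\<in>cg_support Y. cg_ext m (?I a b s q)) = cg_ext (mult_form m a s q) Y"
      by (simp add: Iext[OF sq])
  qed
  also have "\<dots> = cg_ext (\<lambda>a f v. cg_ext (mult_form m a f v) Y) X"
    by (rule cg_ext_nat[OF mult_form_ext[OF m Y] X, symmetric])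
  finally show ?thesis .
qed

subsection \<open>The involution\<close>

lemma gj_apply: "z \<in> car (bar C a) \<Longrightarrow> gj C F a f z = pev a z (ket (fob F a) f)"
  by (simp add: gj_def ev_hat_tens)

lemma gj_dual: assumes "f \<in> fdual a" shows "gj C F a f \<in> fdual (bar C a)"
proof -
  have k: "ket (fob F a) f \<in> car a" by (rule Fo.ket_carr[OF assms])
  have "gj C F a f = (\<lambda>v. if v \<in> car (bar C a) then pev a v (ket (fob F a) f) else 0)"
    by (auto simp: gj_def ev_hat_tens fun_eq_iff)
  then show ?thesis by (auto intro!: hhomI simp: bilin_onD[OF pev_bilin] k)
qed

lemma gj_cS: "f \<in> fdual a \<Longrightarrow> v \<in> car a \<Longrightarrow> gj C F a f (cS a v) = cnj (f v)"
  using Fo.ip_cnj[of "ket (fob F a) f" a v] by (simp add: gj_apply pev_cS Fo.ket_carr Fo.ket_ip)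

lemma bar_eqI:
  assumes "f \<in> fdual (bar C a)" "g \<in> fdual (bar C a)" "\<And>v. v \<in> car a \<Longrightarrow> f (cS a v) = g (cS a v)"
  shows "f = g"
proof (rule Fo.functional_eqI[OF assms(1,2)])
  fix x assume "x \<in> car (bar C a)"
  then show "f x = g x" using assms(3)[OF cZ_carr, of x] by (simp add: cS_cZ)
qed

lemma gj_antilinear:
  assumes "f \<in> fdual a" "g \<in> fdual a"
  shows "gj C F a (f + g) = gj C F a f + gj C F a g" "gj C F a (\<lambda>x. c * f x) = (\<lambda>x. cnj c * gj C F a f x)"
proof -
  show "gj C F a (f + g) = gj C F a f + gj C F a g"
    by (rule bar_eqI[of _ a]) (simp_all add: gj_dual Fo.functional_add assms gj_cS)
  show "gj C F a (\<lambda>x. c * f x) = (\<lambda>x. cnj c * gj C F a f x)"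
    by (rule bar_eqI[of _ a]) (simp_all add: gj_dual Fo.functional_scale assms gj_cS)
qed

text \<open>
  The adjoint of the coefficient \<open>f \<otimes> v\<close> of \<open>a\<close> is the coefficient \<open>j(f) \<otimes> v\<^sup>\<sharp>\<close> of \<open>bar a\<close>, and a morphism
  \<open>u\<close> acts on these adjoints through the dual of \<open>u\<^sup>*\<close>.
\<close>

lemma nat_form_star:
  assumes m: "nat_form m"
  shows "nat_form (\<lambda>a f v. cnj (m (bar C a) (gj C F a f) (cS a v)))"
proof (rule nat_formI)
  fix a c u f v assume u: "u \<in> hom C a c" and f: "f \<in> fdual c" and v: "v \<in> car a"
  obtain w where w: "w \<in> hom C (bar C a) (bar C c)"
    "\<And>z. z \<in> car (bar C a) \<Longrightarrow> fmor F w z = cS c (fmor F u (cZ a z))"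
    using dual_exists[OF dag_hom[OF u]] unfolding dag_dag[OF u] by blast
  have ws: "fmor F w (cS a x) = cS c (fmor F u x)" if "x \<in> car a" for x
    using that by (simp add: w(2) cZ_cS)
  have "gj C F a (f \<circ> fmor F u) = gj C F c f \<circ> fmor F w"
  proof (rule bar_eqI[OF gj_dual[OF fdual_comp[OF f u]] fdual_comp[OF gj_dual[OF f] w(1)]])
    fix x assume x: "x \<in> car a"
    show "gj C F a (f \<circ> fmor F u) (cS a x) = (gj C F c f \<circ> fmor F w) (cS a x)"
      using gj_cS[OF fdual_comp[OF f u] x] gj_cS[OF f fmor_carr[OF u x]] ws[OF x] by simp
  qed
  then show "cnj (m (bar C a) (gj C F a (f \<circ> fmor F u)) (cS a v)) =
      cnj (m (bar C c) (gj C F c f) (cS c (fmor F u v)))"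
    using nat_form_nat[OF m w(1) gj_dual[OF f] cS_carr[OF v]] ws[OF v] by simp
qed (simp_all add: gj_antilinear gj_dual nat_formD[OF m] cS_add cS_scale)

text \<open>
  In the basis expansion of \<open>evb\<^sub>a\<^sup>*(1)\<close> the coefficient at \<open>p \<otimes> q\<close> is \<open>\<langle>q|p\<^sup>\<sharp>\<rangle>\<close>, so that contracting
  it with \<open>x1\<close> gives \<open>\<Sum>\<^sub>p x1(p) p\<^sup>\<sharp>\<close>.
\<close>

lemma cg_antipode_elem_eq:
  assumes x1: "x1 \<in> fdual a" and x2: "x2 \<in> car a"
  shows "cg_antipode_elem C F a x1 x2 =
    cg_elem C F (bar C a) (gj C F a (bra (fob F a) x2)) (cS a (ket (fob F a) x1))"
proof -
  let ?A = "fob F a" and ?A' = "fob F (bar C a)"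
  have eb: "evb_hat C F a \<in> hhom (htens ?A ?A') hcomplex"
    unfolding evb_hat_def hat_def
    by (intro hhom_comp[OF _ fone_hom] hhom_comp[OF feta_hom fmor_hom[OF evb_hom]] fob_hilbert)
  interpret TC: hilbert_pair "htens ?A ?A'" hcomplex by (intro hilbert_pairI FF.htens_hilbert hcomplex_hilbert)
  let ?T = "hadj (htens ?A ?A') hcomplex (evb_hat C F a) 1"
  have T: "?T \<in> hcar (htens ?A ?A')" by (rule TC.hadj_carr[OF eb]) simp
  have Tpq: "?T p q = hip ?A' q (cS a p)" if "p \<in> hbasis ?A" "q \<in> hbasis ?A'" for p q
    using TC.hadj_ip[OF eb FF.tens_carr, of p q 1] that
    by (simp add: FF.hip_tens_basis[OF that, symmetric] evb_hat_tens cS_ip')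
  have bil: "bilin_on ?A ?A' (hsc ?A') (\<lambda>v w. hsc ?A' (x1 v) w)"
    by (rule bilin_onI)
      (simp_all add: hhomD[OF x1] Fo.scale_left_distrib Fo.scale_right_distrib mult.commute)
  have "tens_ext (hsc ?A') ?A ?A' (\<lambda>v w. hsc ?A' (x1 v) w) ?T =
      (\<Sum>p\<in>hbasis ?A. \<Sum>q\<in>hbasis ?A'. hsc ?A' (?T p q) (hsc ?A' (x1 p) q))"
    by (rule FF.tens_ext(3)[OF Fo.vector_space_axioms bil T])
  also have "\<dots> = (\<Sum>p\<in>hbasis ?A. hsc ?A' (x1 p) (\<Sum>q\<in>hbasis ?A'. hsc ?A' (hip ?A' q (cS a p)) q))"
    unfolding Fo.scale_sum_right by (intro sum.cong refl) (simp add: Tpq mult.commute)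
  also have "\<dots> = (\<Sum>p\<in>hbasis ?A. hsc ?A' (cnj (hip ?A p (ket ?A x1))) (cS a p))"
  proof (rule sum.cong[OF refl])
    fix p assume p: "p \<in> hbasis ?A"
    have "x1 p = cnj (hip ?A p (ket ?A x1))"
      using p Fo.ket_ip[OF x1, of p] Fo.ip_cnj[of "ket ?A x1" a p] Fo.ket_carr[OF x1] by simp
    then show "hsc ?A' (x1 p) (\<Sum>q\<in>hbasis ?A'. hsc ?A' (hip ?A' q (cS a p)) q) =
        hsc ?A' (cnj (hip ?A p (ket ?A x1))) (cS a p)"
      using Fo.expand[of "cS a p" "bar C a"] p by simp
  qed
  also have "\<dots> = cS a (ket ?A x1)" by (rule cS_expand[OF Fo.ket_carr[OF x1], symmetric])
  finally show ?thesis
    using x2 by (simp add: cg_antipode_elem_def Let_def gj_def Fo.ket_bra cong: if_cong)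
qed

lemma bra_dual: "x \<in> car a \<Longrightarrow> bra (fob F a) x \<in> fdual a"
  by (rule Fo.bra_hhom)

lemma ket_linear:
  assumes "f \<in> fdual a" "g \<in> fdual a"
  shows "ket (fob F a) (f + g) = ket (fob F a) f + ket (fob F a) g"
    "ket (fob F a) (\<lambda>x. c * f x) = sc a (cnj c) (ket (fob F a) f)"
proof -
  show "ket (fob F a) (f + g) = ket (fob F a) f + ket (fob F a) g"
    by (rule Fo.ket_unique) (simp_all add: assms Fo.functional_add Fo.ket_carr Fo.ip_add_left Fo.ket_ip)
  show "ket (fob F a) (\<lambda>x. c * f x) = sc a (cnj c) (ket (fob F a) f)"
    by (rule Fo.ket_unique) (simp_all add: assms Fo.functional_scale Fo.ket_carr Fo.ip_scale_left Fo.ket_ip)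
qed

lemma cg_antipode_elem_bilin:
  "bilin_on (hdual (fob F a)) (fob F a) cg_scale (cg_antipode_elem C F a)"
proof -
  note eld = bilin_onD[OF cg_elem_bilin[of "bar C a"], simplified]
  show ?thesis
    by (rule bilin_onI)
      (simp_all add: cg_antipode_elem_eq Fo.functional_add Fo.functional_scale ket_linear cS_add cS_scale
        Fo.ket_carr bra_dual gj_dual eld Fo.bra_add Fo.bra_scale gj_antilinear)
qed

lemma cg_antipode_elem_carr:
  "x1 \<in> fdual a \<Longrightarrow> x2 \<in> car a \<Longrightarrow> cg_antipode_elem C F a x1 x2 \<in> cg_carrier C F"
  unfolding cg_antipode_elem_eq by (intro cg_elem_carr gj_dual bra_dual cS_carr Fo.ket_carr)

lemma cg_j_apply:
  assumes X: "X \<in> cg_carrier C F"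
  shows "cg_j F X a = (\<Sum>e\<in>dbas a. \<Sum>p\<in>bas a.
    dtens_scale (cnj (X a e p)) (dtens (fob F a) (bra (fob F a) p) (ket (fob F a) e)))"
proof -
  note dt = bilin_onD[OF dtens_bilin[of a], simplified]
  have "bilin_on (hdual (fob F a)) (fob F a) (\<lambda>c. dtens_scale (cnj c))
      (\<lambda>x1 x2. dtens (fob F a) (bra (fob F a) x2) (ket (fob F a) x1))"
    by (rule bilin_onI)
      (simp_all add: ket_linear Fo.ket_carr bra_dual dt Fo.bra_add Fo.bra_scale)
  from DF.tens_ext(3)[OF vector_space_dtens_cnj this cg_carrierD(3)[OF X]]
  show ?thesis unfolding cg_j_def .
qed

lemma cg_j_carr:
  assumes X: "X \<in> cg_carrier C F"
  shows "cg_j F X \<in> cg_carrier C F" "cg_support (cg_j F X) \<subseteq> cg_support X"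
proof -
  note e = dbas_fdual
  have "cg_j F X a = 0" if "X a = 0" for a
    unfolding cg_j_apply[OF X] using that by (simp add: dtens_scale_def fun_eq_iff sum_fun_apply)
  then show supp: "cg_support (cg_j F X) \<subseteq> cg_support X" by (auto simp: cg_support_def)
  have "cg_j F X a \<in> hcar (dten a)" for a
    unfolding cg_j_apply[OF X] using e
    by (intro DT.carr_sum dtens_scale_carr dtens_carr bra_dual Fo.ket_carr) auto
  then show "cg_j F X \<in> cg_carrier C F"
    using supp finite_subset[OF supp] X by (auto simp: cg_carrier_def dual_tens_def)
qed

lemma cg_star_carr:
  assumes X: "X \<in> cg_carrier C F"
  shows "cg_star C F X \<in> cg_carrier C F"
  unfolding cg_star_def cg_antipode_def
  by (intro cg_sum_carr tens_ext_cg(1)[OF DF.hilbert_pair_axioms cg_antipode_elem_bilin]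
      cg_carrierD(3)[OF cg_j_carr(1)[OF X]] cg_antipode_elem_carr) simp_all

lemma cg_ext_star:
  assumes m: "nat_form m" and X: "X \<in> cg_carrier C F"
  shows "cg_ext m (cg_star C F X) = cnj (cg_ext (\<lambda>a f v. cnj (m (bar C a) (gj C F a f) (cS a v))) X)"
proof -
  have mb: "bilin_family m" using nat_form_bilin[OF m] by blast
  let ?J = "cg_j F X" and ?m = "\<lambda>a x1 x2. m (bar C a) (gj C F a (bra (fob F a) x2)) (cS a (ket (fob F a) x1))"
  note J = cg_j_carr[OF X] and anti = cg_antipode_elem_carr
  note e = dbas_fdual
  have mm: "bilin_on (hdual (fob F a)) (fob F a) (*) (?m a)" for a
    by (rule bilin_onI)
      (simp_all add: Fo.functional_add Fo.functional_scale ket_linear cS_add cS_scale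
        Fo.ket_carr bra_dual gj_dual nat_formD[OF m] Fo.bra_add Fo.bra_scale gj_antilinear)
  let ?te = "\<lambda>a. tens_ext (*) (hdual (fob F a)) (fob F a) (?m a)"
  note te = DF.tens_ext[OF vector_space_mult mm]
  have c1: "tens_ext cg_scale (hdual (fob F a)) (fob F a) (cg_antipode_elem C F a) (?J a) \<in> cg_carrier C F" for a
    by (intro tens_ext_cg(1)[OF DF.hilbert_pair_axioms cg_antipode_elem_bilin]
      cg_carrierD(3)[OF J(1)] anti) simp_all
  have "cg_ext m (cg_star C F X) = (\<Sum>a\<in>cg_support ?J.
      cg_ext m (tens_ext cg_scale (hdual (fob F a)) (fob F a) (cg_antipode_elem C F a) (?J a)))"
    unfolding cg_star_def cg_antipode_def by (rule cg_ext_sum[OF mb c1])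
  also have "\<dots> = (\<Sum>a\<in>cg_support ?J. ?te a (?J a))"
  proof (rule sum.cong[OF refl])
    fix a
    have "cg_ext m (tens_ext cg_scale (hdual (fob F a)) (fob F a) (cg_antipode_elem C F a) (?J a)) =
        (\<Sum>x\<in>dbas a. \<Sum>y\<in>bas a. ?J a x y * cg_ext m (cg_antipode_elem C F a x y))"
      by (intro tens_ext_cg(2)[OF DF.hilbert_pair_axioms cg_antipode_elem_bilin _ cg_carrierD(3)[OF J(1)] mb] anti) simp_all
    also have "\<dots> = (\<Sum>x\<in>dbas a. \<Sum>y\<in>bas a. ?J a x y * ?m a x y)"
      using e by (intro sum.cong refl)
        (simp add: cg_antipode_elem_eq cg_ext_elem[OF m gj_dual[OF bra_dual] cS_carr[OF Fo.ket_carr]])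
    also have "\<dots> = ?te a (?J a)" by (rule te(3)[OF cg_carrierD(3)[OF J(1)], symmetric])
    finally show "cg_ext m (tens_ext cg_scale (hdual (fob F a)) (fob F a) (cg_antipode_elem C F a) (?J a)) = ?te a (?J a)" .
  qed
  also have "\<dots> = (\<Sum>a\<in>cg_support X. ?te a (?J a))"
  proof (rule sum.mono_neutral_left[OF cg_carrierD(1)[OF X] J(2)], rule ballI)
    fix a assume "a \<in> cg_support X - cg_support ?J"
    then have "?J a = 0" by (simp add: cg_support_def)
    then show "?te a (?J a) = 0" using DT.lin_on_0[OF te(1)] by simp
  qed
  also have "\<dots> = (\<Sum>a\<in>cg_support X. \<Sum>s\<in>dbas a. \<Sum>p\<in>bas a.
      cnj (X a s p) * m (bar C a) (gj C F a s) (cS a p))"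
  proof (rule sum.cong[OF refl])
    fix a
    have dc: "dtens (fob F a) (bra (fob F a) p) (ket (fob F a) s) \<in> hcar (dten a)"
      if "s \<in> dbas a" "p \<in> bas a" for s p
      using that e by (intro dtens_carr bra_dual Fo.ket_carr) auto
    have val: "?te a (dtens_scale (cnj (X a s p)) (dtens (fob F a) (bra (fob F a) p) (ket (fob F a) s))) =
        cnj (X a s p) * m (bar C a) (gj C F a s) (cS a p)"
      if sp: "s \<in> dbas a" "p \<in> bas a" for s p
    proof -
      have "?te a (dtens_scale (cnj (X a s p)) (dtens (fob F a) (bra (fob F a) p) (ket (fob F a) s))) =
          cnj (X a s p) * ?te a (dtens (fob F a) (bra (fob F a) p) (ket (fob F a) s))"
        using lin_onD(2)[OF te(1) dc[OF sp], of "cnj (X a s p)"] by (simp add: dtens_scale_def)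
      also have "?te a (dtens (fob F a) (bra (fob F a) p) (ket (fob F a) s)) =
          ?m a (bra (fob F a) p) (ket (fob F a) s)"
        unfolding dtens_def using sp e by (intro te(2)) (auto intro!: bra_dual Fo.ket_carr)
      also have "\<dots> = m (bar C a) (gj C F a s) (cS a p)"
        using sp e by (simp add: Fo.bra_ket Fo.ket_bra)
      finally show ?thesis .
    qed
    show "?te a (?J a) = (\<Sum>s\<in>dbas a. \<Sum>p\<in>bas a.
        cnj (X a s p) * m (bar C a) (gj C F a s) (cS a p))"
      unfolding cg_j_apply[OF X]
      by (simp add: DT.lin_on_sum[OF te(1)] DT.carr_sum dtens_scale_carr dc val)
  qed
  also have "\<dots> = cnj (\<Sum>a\<in>cg_support X. \<Sum>s\<in>dbas a. \<Sum>p\<in>bas a.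
      X a s p * cnj (m (bar C a) (gj C F a s) (cS a p)))"
    by simp
  also have "(\<Sum>a\<in>cg_support X. \<Sum>s\<in>dbas a. \<Sum>p\<in>bas a.
      X a s p * cnj (m (bar C a) (gj C F a s) (cS a p))) =
      cg_ext (\<lambda>a f v. cnj (m (bar C a) (gj C F a f) (cS a v))) X"
    by (rule cg_ext_nat[OF nat_form_star[OF m] X, symmetric])
  finally show ?thesis .
qed

text \<open>
  The value of \<open>m\<close> at \<open>X\<^sup># Y\<close> for the coefficients \<open>X = f \<otimes> v\<close> of \<open>a\<close> and \<open>Y = g \<otimes> w\<close> of \<open>b\<close>.
\<close>

definition star_form :: "('o \<Rightarrow> ('v \<Rightarrow> complex) \<Rightarrow> 'v \<Rightarrow> complex) \<Rightarrow>
    'o \<Rightarrow> ('v \<Rightarrow> complex) \<Rightarrow> 'v \<Rightarrow> 'o \<Rightarrow> ('v \<Rightarrow> complex) \<Rightarrow> 'v \<Rightarrow> complex" where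
  "star_form m a f v b g w = mult_form m (bar C a) (gj C F a f) (cS a v) b g w"

lemma star_form_right:
  "nat_form m \<Longrightarrow> f \<in> fdual a \<Longrightarrow> v \<in> car a \<Longrightarrow> nat_form (star_form m a f v)"
  unfolding star_form_def[abs_def] by (intro mult_form_right gj_dual cS_carr)

lemma star_form_left:
  "nat_form m \<Longrightarrow> g \<in> fdual b \<Longrightarrow> w \<in> car b \<Longrightarrow> nat_form (\<lambda>a f v. cnj (star_form m a f v b g w))"
  unfolding star_form_def by (rule nat_form_star[OF mult_form_left])

text \<open>
  The representation of \<open>X\<close> by one coefficient is used twice, for the form in the right factor and for
  the conjugate of the form in the left factor.
\<close>

lemma cg_ext_star_mult:
  assumes m: "nat_form m" and X: "X \<in> cg_carrier C F" and f: "f \<in> fdual c" and v: "v \<in> car c"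
    and rep: "\<And>m. nat_form m \<Longrightarrow> cg_ext m X = m c f v"
  shows "cg_ext m (cg_mult C F (cg_star C F X) X) = star_form m c f v c f v"
proof -
  let ?o = "\<lambda>a f v. cg_ext (mult_form m a f v) X"
  have o: "nat_form ?o" by (rule mult_form_ext[OF m X])
  have "cg_ext m (cg_mult C F (cg_star C F X) X) = cg_ext ?o (cg_star C F X)"
    by (rule cg_ext_mult[OF m cg_star_carr[OF X] X])
  also have "\<dots> = cnj (cg_ext (\<lambda>a f v. cnj (?o (bar C a) (gj C F a f) (cS a v))) X)"
    by (rule cg_ext_star[OF o X])
  also have "\<dots> = ?o (bar C c) (gj C F c f) (cS c v)"
    by (simp add: rep[OF nat_form_star[OF o]])
  also have "\<dots> = mult_form m (bar C c) (gj C F c f) (cS c v) c f v"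
    by (rule rep[OF mult_form_right[OF m gj_dual[OF f] cS_carr[OF v]]])
  finally show ?thesis by (simp add: star_form_def)
qed

text \<open>
  Every \<open>X\<close> is represented by a single coefficient, and conversely every coefficient is an element of the
  algebra.
\<close>

lemma positivity_on_coefficients:
  assumes m: "nat_form m"
  shows "(\<forall>X\<in>cg_carrier C F. P (cg_ext m (cg_mult C F (cg_star C F X) X))) \<longleftrightarrow>
    (\<forall>c. \<forall>f\<in>fdual c. \<forall>v\<in>car c. P (star_form m c f v c f v))"
proof (intro iffI allI ballI)
  fix c f v assume P: "\<forall>X\<in>cg_carrier C F. P (cg_ext m (cg_mult C F (cg_star C F X) X))"
    and f: "f \<in> fdual c" and v: "v \<in> car c"
  have X: "cg_elem C F c f v \<in> cg_carrier C F" by (rule cg_elem_carr(1)[OF f v])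
  show "P (star_form m c f v c f v)"
    using P[rule_format, OF X] cg_ext_star_mult[OF m X f v cg_ext_elem[OF _ f v]] by simp
next
  fix X assume P: "\<forall>c. \<forall>f\<in>fdual c. \<forall>v\<in>car c. P (star_form m c f v c f v)"
    and X: "X \<in> cg_carrier C F"
  obtain c f v where "f \<in> fdual c" "v \<in> car c" "\<And>m. nat_form m \<Longrightarrow> cg_ext m X = m c f v"
    using single_coefficient[OF X] by blast
  then show "P (cg_ext m (cg_mult C F (cg_star C F X) X))"
    using P cg_ext_star_mult[OF m X] by simp
qed

section \<open>Natural transformations and their functionals\<close>

lemma nat_transD:
  assumes "nat_trans C F \<Phi>"
  shows "x \<in> fdual a \<Longrightarrow> y \<in> fdual a \<Longrightarrow> \<Phi> a (x + y) = \<Phi> a x + \<Phi> a y"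
    and "x \<in> fdual a \<Longrightarrow> \<Phi> a (\<lambda>v. c * x v) = (\<lambda>v. c * \<Phi> a x v)"
    and "x \<in> fdual a \<Longrightarrow> \<Phi> a x \<in> fdual a"
    and "u \<in> hom C a b \<Longrightarrow> x \<in> fdual b \<Longrightarrow> \<Phi> a (x \<circ> fmor F u) = \<Phi> b x \<circ> fmor F u"
proof -
  have h: "\<Phi> a \<in> hhom (gob F a) (gob F a)" using assms by (simp add: nat_trans_def)
  show "x \<in> fdual a \<Longrightarrow> y \<in> fdual a \<Longrightarrow> \<Phi> a (x + y) = \<Phi> a x + \<Phi> a y"
    "x \<in> fdual a \<Longrightarrow> \<Phi> a (\<lambda>v. c * x v) = (\<lambda>v. c * \<Phi> a x v)"
    "x \<in> fdual a \<Longrightarrow> \<Phi> a x \<in> fdual a"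
    using hhomD(2)[OF h, of x y] hhomD(3)[OF h, of x c] hhomD(5)[OF h, of x] by (simp_all add: gob_def)
  show "u \<in> hom C a b \<Longrightarrow> x \<in> fdual b \<Longrightarrow> \<Phi> a (x \<circ> fmor F u) = \<Phi> b x \<circ> fmor F u"
    using assms by (simp add: nat_trans_def gob_def)
qed

text \<open>
  The operator \<open>T\<close> with \<open>\<langle>e|T v\<rangle> = \<Phi>(\<langle>e|) v\<close> for basis vectors \<open>e\<close> has the defining property, and
  functionals separate vectors.
\<close>

lemma corr_op:
  assumes nt: "nat_trans C F \<Phi>"
  shows "corr_op F \<Phi> a \<in> hhom (fob F a) (fob F a)"
    and "x \<in> fdual a \<Longrightarrow> \<Phi> a x = x \<circ> corr_op F \<Phi> a"
proof -
  note n = nat_transD[OF nt]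
  let ?P = "\<lambda>T. T \<in> hhom (fob F a) (fob F a) \<and> (\<forall>x \<in> hcar (gob F a). \<Phi> a x = x \<circ> T)"
  let ?T = "\<lambda>v. if v \<in> car a then \<Sum>e\<in>bas a. sc a (\<Phi> a (bra (fob F a) e) v) e else 0"
  have be: "bra (fob F a) e \<in> fdual a" if "e \<in> bas a" for e using that by (intro bra_dual) simp
  have T: "?T \<in> hhom (fob F a) (fob F a)"
    using hhomD(2,3)[OF n(3)[OF be]]
    by (intro hhomI) (auto simp: Fo.scale_left_distrib sum.distrib Fo.scale_sum_right intro!: Fo.carr_sum)
  have TP: "\<Phi> a x = x \<circ> ?T" if x: "x \<in> fdual a" for x
  proof (rule Fo.functional_eqI[OF n(3)[OF x] hhom_comp[OF T x fob_hilbert]])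
    fix v assume v: "v \<in> car a"
    have lin: "lin_on (hdual (fob F a)) (*) (\<lambda>x. if x \<in> fdual a then \<Phi> a x v else 0)"
      by (intro lin_onI) (auto simp: n Fo.functional_add Fo.functional_scale)
    have "x = (\<Sum>e\<in>bas a. (\<lambda>v. x e * bra (fob F a) e v))" by (rule Fo.functional_expand[OF x])
    then have "\<Phi> a x v = (\<lambda>x. if x \<in> fdual a then \<Phi> a x v else 0) (\<Sum>e\<in>bas a. (\<lambda>v. x e * bra (fob F a) e v))"
      using x by simp
    also have "\<dots> = (\<Sum>e\<in>bas a. (\<lambda>x. if x \<in> fdual a then \<Phi> a x v else 0) (\<lambda>v. x e * bra (fob F a) e v))"
      using be by (intro Du.lin_on_sum[OF lin]) (simp add: Fo.functional_scale)
    also have "\<dots> = (\<Sum>e\<in>bas a. x e * \<Phi> a (bra (fob F a) e) v)"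
      using be by (intro sum.cong refl) (simp add: Fo.functional_scale n)
    also have "\<dots> = x (?T v)"
      using v Fo.lin_on_sum[OF hhomD(1)[OF x], of "bas a" "\<lambda>e. sc a (\<Phi> a (bra (fob F a) e) v) e"]
        hhomD(3)[OF x] by (simp add: mult.commute)
    finally show "\<Phi> a x v = (x \<circ> ?T) v" by simp
  qed
  have uni: "T = T'" if "?P T" "?P T'" for T T'
  proof (rule Fo.lin_on_eqI)
    show "lin_on (fob F a) (sc a) T" "lin_on (fob F a) (sc a) T'"
      using that by (auto dest: hhomD(1))
    fix v assume v: "v \<in> car a"
    show "T v = T' v"
    proof (rule Fo.ip_ext)
      show c: "T v \<in> car a" "T' v \<in> car a" using that v by (auto dest: hhomD(5))
      fix z assume z: "z \<in> car a"
      have "bra (fob F a) z \<in> hcar (gob F a)" using bra_dual[OF z] by (simp add: gob_def)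
      then have "(bra (fob F a) z \<circ> T) v = (bra (fob F a) z \<circ> T') v" using that by (metis (no_types, lifting))
      then show "ip a z (T v) = ip a z (T' v)" using c by (simp add: Fo.bra_apply)
    qed
  qed
  have "?P ?T" using T TP by (auto simp: gob_def)
  then have "?P (corr_op F \<Phi> a)" unfolding corr_op_def by (rule theI[of ?P]) (use uni \<open>?P ?T\<close> in blast)
  then show "corr_op F \<Phi> a \<in> hhom (fob F a) (fob F a)" "x \<in> fdual a \<Longrightarrow> \<Phi> a x = x \<circ> corr_op F \<Phi> a"
    by (simp_all add: gob_def)
qed

lemma corr_op_natural:
  assumes nt: "nat_trans C F \<Phi>" and u: "u \<in> hom C a b" and v: "v \<in> car a"
  shows "fmor F u (corr_op F \<Phi> a v) = corr_op F \<Phi> b (fmor F u v)"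
proof (rule Fo.ip_ext)
  note T = hhomD(5)[OF corr_op(1)[OF nt]]
  show c: "fmor F u (corr_op F \<Phi> a v) \<in> car b" "corr_op F \<Phi> b (fmor F u v) \<in> car b"
    by (intro fmor_carr[OF u] T v)+
  fix z assume z: "z \<in> car b"
  have "(bra (fob F b) z \<circ> fmor F u \<circ> corr_op F \<Phi> a) v = (bra (fob F b) z \<circ> corr_op F \<Phi> b \<circ> fmor F u) v"
    using corr_op(2)[OF nt fdual_comp[OF bra_dual[OF z] u]] corr_op(2)[OF nt bra_dual[OF z]]
      nat_transD(4)[OF nt u bra_dual[OF z]] by simp
  then show "ip b z (fmor F u (corr_op F \<Phi> a v)) = ip b z (corr_op F \<Phi> b (fmor F u v))"
    using c by (simp add: Fo.bra_apply)
qed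

abbreviation cform :: "('o \<Rightarrow> ('v \<Rightarrow> complex) \<Rightarrow> ('v \<Rightarrow> complex)) \<Rightarrow> 'o \<Rightarrow> ('v \<Rightarrow> complex) \<Rightarrow> 'v \<Rightarrow> complex" where
  "cform \<Phi> \<equiv> \<lambda>a f v. f (corr_op F \<Phi> a v)"

lemma cform_nat: assumes nt: "nat_trans C F \<Phi>" shows "nat_form (cform \<Phi>)"
  using hhomD[OF corr_op(1)[OF nt]] corr_op_natural[OF nt]
  by (intro nat_formI) (simp_all add: hhomD(2,3))

lemma corr_functional_eq: "corr_functional F \<Phi> = cg_ext (cform \<Phi>)"
  by (simp add: corr_functional_def cg_ext_def fun_eq_iff)

lemma corr_functional_one:
  assumes nt: "nat_trans C F \<Phi>"
  shows "corr_functional F \<Phi> (cg_one C F) = 1 \<longleftrightarrow> \<Phi> (unt C) (fone F) = fone F"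
proof -
  let ?T = "corr_op F \<Phi> (unt C)"
  note T = corr_op(1)[OF nt, of "unt C"]
  have "corr_functional F \<Phi> (cg_one C F) = fone F (?T u0)"
    unfolding corr_functional_eq cg_one_def u0_def[symmetric]
    by (rule cg_ext_elem[OF cform_nat[OF nt] fone_hom u0_carr])
  moreover have "fone F (?T u0) = 1 \<longleftrightarrow> fone F \<circ> ?T = fone F"
  proof
    assume 1: "fone F (?T u0) = 1"
    show "fone F \<circ> ?T = fone F"
    proof (rule Fo.functional_eqI[OF hhom_comp[OF T fone_hom fob_hilbert] fone_hom])
      fix x assume x: "x \<in> car (unt C)"
      have "fone F (?T (sc (unt C) (fone F x) u0)) = fone F x"
        using 1 by (simp add: hhomD[OF T] fone_scale)
      then show "(fone F \<circ> ?T) x = fone F x" using unit_expand[OF x] by simp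
    qed
  next
    assume "fone F \<circ> ?T = fone F"
    then have "(fone F \<circ> ?T) u0 = fone F u0" by (rule fun_cong)
    then show "fone F (?T u0) = 1" by simp
  qed
  ultimately show ?thesis by (simp add: corr_op(2)[OF nt fone_hom])
qed

section \<open>Positive elements of the algebra object\<close>

lemma g_of_op:
  assumes P: "P \<in> hhom (fob F c) (fob F c)"
  shows "g_of_op C F c P \<in> fdual (bar C c \<otimes> c)"
    and "x \<in> car (bar C c) \<Longrightarrow> w \<in> car c \<Longrightarrow> g_of_op C F c P (et (bar C c) c x w) = pev c x (P w)"
proof -
  let ?A = "fob F c" and ?A' = "fob F (bar C c)"
  let ?t = "tens_ext (hsc (htens ?A' ?A)) ?A' ?A (\<lambda>v w. tens ?A' ?A v (P w))"
  have bil: "bilin_on ?A' ?A (hsc (htens ?A' ?A)) (\<lambda>v w. tens ?A' ?A v (P w))"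
    using bilin_onD[OF FF.tens_bilin[of "bar C c" c]] by (intro bilin_onI) (simp_all add: hhomD[OF P])
  note t = FF.tens_ext[OF Te.vector_space_axioms bil]
  have tc: "?t T \<in> hcar (htens ?A' ?A)" if "T \<in> hcar (htens ?A' ?A)" for T
    unfolding t(3)[OF that] by (intro Te.carr_sum Te.carr_scale FF.tens_carr) (auto simp: hhomD[OF P])
  have th: "?t \<in> hhom (htens ?A' ?A) (htens ?A' ?A)" using t(1) tc by (auto simp: hhom_def)
  have eh: "ev_hat C F c \<in> hhom (htens ?A' ?A) hcomplex"
    unfolding ev_hat_def hat_def
    by (intro hhom_comp[OF _ fone_hom] hhom_comp[OF feta_hom fmor_hom[OF ev_hom]] fob_hilbert)
  have g: "g_of_op C F c P = ev_hat C F c \<circ> ?t \<circ> feta_inv (bar C c) c"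
    by (simp add: g_of_op_def Let_def)
  show "g_of_op C F c P \<in> fdual (bar C c \<otimes> c)"
    unfolding g by (intro hhom_comp[OF feta_inv_hom hhom_comp[OF th eh]] FF.htens_hilbert)
  assume xw: "x \<in> hcar ?A'" "w \<in> hcar ?A"
  show "g_of_op C F c P (et (bar C c) c x w) = pev c x (P w)"
    unfolding g et_def using xw
    by (simp add: feta_inv_feta FF.tens_carr t(2) ev_hat_tens del: htens_simps)
qed

lemma g_of_op_cS:
  assumes "P \<in> hhom (fob F c) (fob F c)" "v \<in> car c" "w \<in> car c"
  shows "g_of_op C F c P (et (bar C c) c (cS c v) w) = ip c v (P w)"
  using assms by (simp add: g_of_op pev_cS hhomD)

lemma g_of_op_eqI:
  assumes "K \<in> fdual (bar C c \<otimes> c)" "P \<in> hhom (fob F c) (fob F c)"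
    and "\<And>v w. v \<in> car c \<Longrightarrow> w \<in> car c \<Longrightarrow>
      K (et (bar C c) c (cS c v) w) = ip c v (P w)"
  shows "K = g_of_op C F c P"
proof (rule fdual_et_eqI[OF assms(1) g_of_op(1)[OF assms(2)]])
  fix x w assume xw: "x \<in> car (bar C c)" "w \<in> car c"
  show "K (et (bar C c) c x w) = g_of_op C F c P (et (bar C c) c x w)"
    using assms(3)[OF cZ_carr[OF xw(1)] xw(2)] g_of_op_cS[OF assms(2) cZ_carr[OF xw(1)] xw(2)] xw(1)
    by (simp add: cS_cZ)
qed

abbreviation nonneg :: "complex \<Rightarrow> bool" where
  "nonneg z \<equiv> Im z = 0 \<and> Re z \<ge> 0"

text \<open>
  The operator \<open>P\<close> of \<open>K\<close> is recovered as \<open>\<langle>v|P w\<rangle> = K(v\<^sup>\<sharp> \<otimes> w)\<close>.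
\<close>

lemma g_positive_iff:
  assumes K: "K \<in> fdual (bar C c \<otimes> c)"
  shows "K \<in> g_of_op C F c ` positive_ops (fob F c) \<longleftrightarrow>
    (\<forall>v\<in>car c. nonneg (K (et (bar C c) c (cS c v) v)))"
proof
  assume "K \<in> g_of_op C F c ` positive_ops (fob F c)"
  then obtain P where P: "Fo.psd c P" "K = g_of_op C F c P" by (auto simp: Fo.positive_ops_eq)
  then show "\<forall>v\<in>car c. nonneg (K (et (bar C c) c (cS c v) v))"
    by (simp add: g_of_op_cS Fo.psd_def)
next
  let ?A = "fob F c"
  assume pos: "\<forall>v\<in>hcar ?A. nonneg (K (et (bar C c) c (cS c v) v))"
  define k where "k = (\<lambda>v w. K (et (bar C c) c (cS c v) w))"
  define P where "P = (\<lambda>w. if w \<in> hcar ?A then \<Sum>e\<in>hbasis ?A. hsc ?A (k e w) e else 0)"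
  have P: "P \<in> hhom ?A ?A"
    unfolding P_def k_def
    by (intro hhomI) (auto simp: et_add_right et_scale_right hhomD[OF K] Fo.scale_left_distrib sum.distrib
        Fo.scale_sum_right intro!: Fo.carr_sum)
  have kP: "k v w = hip ?A v (P w)" if v: "v \<in> hcar ?A" and w: "w \<in> hcar ?A" for v w
  proof -
    have lin: "lin_on ?A (\<lambda>c. (*) (cnj c)) (\<lambda>v. if v \<in> hcar ?A then k v w else 0)"
      unfolding k_def using w by (intro lin_onI) (auto simp: cS_add cS_scale et_add_left et_scale_left hhomD[OF K])
    have "k v w = (\<Sum>e\<in>hbasis ?A. cnj (hip ?A e v) * k e w)"
      using Fo.lin_on_expand[OF lin v] v by simp
    also have "\<dots> = (\<Sum>e\<in>hbasis ?A. hip ?A v e * k e w)"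
    proof (rule sum.cong[OF refl])
      fix e assume "e \<in> hbasis ?A"
      then show "cnj (hip ?A e v) * k e w = hip ?A v e * k e w" using Fo.ip_cnj[of e c v] v by simp
    qed
    also have "\<dots> = hip ?A v (P w)"
      using v w by (simp add: P_def Fo.ip_sum Fo.ip_scale mult.commute)
    finally show ?thesis .
  qed
  have "Fo.psd c P" unfolding Fo.psd_def using P pos kP by (auto simp: k_def)
  moreover have "K = g_of_op C F c P" by (rule g_of_op_eqI[OF K P]) (use kP in \<open>simp add: k_def\<close>)
  ultimately show "K \<in> g_of_op C F c ` positive_ops ?A" by (auto simp: Fo.positive_ops_eq)
qed

lemma rank_one:
  assumes f: "f \<in> fdual c"
  shows "Fo.psd c (\<lambda>w. if w \<in> car c then sc c (f w) (ket (fob F c) f) else 0)" (is "Fo.psd c ?P")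
    and "g_of_op C F c (\<lambda>w. if w \<in> car c then sc c (f w) (ket (fob F c) f) else 0) =
      fprod (bar C c) c (gj C F c f) f"
proof -
  note k = Fo.ket_carr[OF f]
  have P: "?P \<in> hhom (fob F c) (fob F c)"
    by (intro hhomI) (auto simp: hhomD[OF f] k Fo.scale_left_distrib)
  have ip: "ip c v (ket (fob F c) f) = cnj (f v)" if "v \<in> car c" for v
    using Fo.ip_cnj[OF k that] that by (simp add: Fo.ket_ip[OF f])
  have "nonneg (z * cnj z)" for z :: complex by (simp add: power2_eq_square[symmetric])
  then show "Fo.psd c ?P" unfolding Fo.psd_def using P k ip by (simp add: Fo.ip_scale)
  show "g_of_op C F c ?P = fprod (bar C c) c (gj C F c f) f"
    by (rule g_of_op_eqI[OF fprod_dual[OF gj_dual[OF f] f] P, symmetric])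
      (simp add: fprod_et[OF gj_dual[OF f] f] gj_cS[OF f] Fo.ip_scale k ip mult.commute)
qed

lemma star_form_cform:
  "star_form (cform \<Phi>) a f v b g w =
    fprod (bar C a) b (gj C F a f) g (corr_op F \<Phi> (bar C a \<otimes> b) (et (bar C a) b (cS a v) w))"
  by (simp add: star_form_def)

text \<open>
  Every positive operator is a sum of rank one operators \<open>|f\<^sup>*\<rangle>f\<close>, and the rank one operator is the
  element \<open>j(f) f\<close> of the algebra object, which leads to the right hand side.
\<close>

lemma preserves_positive_iff:
  assumes nt: "nat_trans C F \<Phi>"
  shows "\<Phi> (bar C c \<otimes> c) ` (g_of_op C F c ` positive_ops (fob F c)) \<subseteq> g_of_op C F c ` positive_ops (fob F c) \<longleftrightarrow>
    (\<forall>f\<in>fdual c. \<forall>v\<in>car c. nonneg (star_form (cform \<Phi>) c f v c f v))"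
proof -
  let ?T = "corr_op F \<Phi> (bar C c \<otimes> c)" and ?e = "\<lambda>v. et (bar C c) c (cS c v) v"
  note T = hhomD(5)[OF corr_op(1)[OF nt]]
  have \<Phi>: "\<Phi> (bar C c \<otimes> c) K \<in> g_of_op C F c ` positive_ops (fob F c) \<longleftrightarrow>
      (\<forall>v\<in>car c. nonneg (K (?T (?e v))))" if "K \<in> fdual (bar C c \<otimes> c)" for K
    using g_positive_iff[OF nat_transD(3)[OF nt that]] corr_op(2)[OF nt that] by simp
  show ?thesis
  proof (intro iffI ballI subsetI)
    fix f v assume sub: "\<Phi> (bar C c \<otimes> c) ` (g_of_op C F c ` positive_ops (fob F c)) \<subseteq> g_of_op C F c ` positive_ops (fob F c)"
      and f: "f \<in> fdual c" and v: "v \<in> car c"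
    have K: "fprod (bar C c) c (gj C F c f) f \<in> fdual (bar C c \<otimes> c)" by (rule fprod_dual[OF gj_dual[OF f] f])
    have "fprod (bar C c) c (gj C F c f) f \<in> g_of_op C F c ` positive_ops (fob F c)"
      unfolding Fo.positive_ops_eq using rank_one[OF f] by force
    then show "nonneg (star_form (cform \<Phi>) c f v c f v)"
      unfolding star_form_cform using sub \<Phi>[OF K] v by blast
  next
    fix K' assume pos: "\<forall>f\<in>fdual c. \<forall>v\<in>car c. nonneg (star_form (cform \<Phi>) c f v c f v)"
      and "K' \<in> \<Phi> (bar C c \<otimes> c) ` (g_of_op C F c ` positive_ops (fob F c))"
    then obtain P where P: "Fo.psd c P" "K' = \<Phi> (bar C c \<otimes> c) (g_of_op C F c P)"
      by (auto simp: Fo.positive_ops_eq)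
    have Ph: "P \<in> hhom (fob F c) (fob F c)" using P(1) by (simp add: Fo.psd_def)
    obtain y where y: "\<And>e. e \<in> bas c \<Longrightarrow> y e \<in> car c"
      "\<And>z. z \<in> car c \<Longrightarrow> P z = (\<Sum>e\<in>bas c. sc c (ip c (y e) z) (y e))"
      using Fo.psd_rank_one_sum[OF P(1)] by blast
    let ?b = "\<lambda>e. bra (fob F c) (y e)"
    let ?R = "\<lambda>e. fprod (bar C c) c (gj C F c (?b e)) (?b e)"
    have b: "?b e \<in> fdual c" if "e \<in> bas c" for e using that y by (intro bra_dual) auto
    have R: "?R e \<in> fdual (bar C c \<otimes> c)" if "e \<in> bas c" for e
      by (intro fprod_dual gj_dual b that)
    have sumR: "(\<lambda>t. \<Sum>e\<in>bas c. ?R e t) \<in> fdual (bar C c \<otimes> c)"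
      using hhomD[OF R] by (intro hhomI) (simp_all add: sum.distrib sum_distrib_left)
    have "g_of_op C F c P = (\<lambda>t. \<Sum>e\<in>bas c. ?R e t)"
    proof (rule g_of_op_eqI[OF sumR Ph, symmetric])
      fix v w assume v: "v \<in> car c" and w: "w \<in> car c"
      have "?R e (et (bar C c) c (cS c v) w) = ip c (y e) w * ip c v (y e)"
        if e: "e \<in> bas c" for e
        using fprod_et[OF gj_dual[OF b[OF e]] b[OF e] cS_carr[OF v] w] gj_cS[OF b[OF e] v]
          Fo.ip_cnj[OF y(1)[OF e] v] v w by (simp add: Fo.bra_apply)
      then show "(\<Sum>e\<in>bas c. ?R e (et (bar C c) c (cS c v) w)) = ip c v (P w)"
        using v w y by (simp add: Fo.ip_sum Fo.ip_scale)
    qed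
    then have "g_of_op C F c P (?T (?e v)) = (\<Sum>e\<in>bas c. star_form (cform \<Phi>) c (?b e) v c (?b e) v)" for v
      unfolding star_form_cform by simp
    moreover have "nonneg (\<Sum>e\<in>bas c. star_form (cform \<Phi>) c (?b e) v c (?b e) v)"
      if "v \<in> car c" for v
      using pos b that by (simp add: sum_nonneg)
    ultimately show "K' \<in> g_of_op C F c ` positive_ops (fob F c)"
      unfolding P(2) \<Phi>[OF g_of_op(1)[OF Ph]] by simp
  qed
qed

section \<open>Compatibility with the *-structure\<close>

text \<open>
  The unit of the algebra is a coefficient of the unit object.  If one of the two factors is the unit,
  naturality with respect to a unitor replaces \<open>T\<close> at the tensor product by \<open>T\<close> at the other factor; on
  the left side the dual of the unit object is first identified with the unit object.
\<close>

lemma star_form_one_right: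
  assumes nt: "nat_trans C F \<Phi>" and f: "f \<in> fdual a" and v: "v \<in> car a"
  shows "star_form (cform \<Phi>) a f v (unt C) (fone F) u0 = gj C F a f (corr_op F \<Phi> (bar C a) (cS a v))"
proof -
  have r: "runit C (bar C a) \<in> hom C (bar C a \<otimes> unt C) (bar C a)" by (rule struct_hom)
  note j = gj_dual[OF f]
  have "fprod (bar C a) (unt C) (gj C F a f) (fone F) = gj C F a f \<circ> fmor F (runit C (bar C a))"
  proof (rule fdual_et_eqI[OF fprod_dual[OF j fone_hom] fdual_comp[OF j r]])
    fix x y assume "x \<in> car (bar C a)" "y \<in> car (unt C)"
    then show "fprod (bar C a) (unt C) (gj C F a f) (fone F) (et (bar C a) (unt C) x y) =
        (gj C F a f \<circ> fmor F (runit C (bar C a))) (et (bar C a) (unt C) x y)"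
      using hhomD(3)[OF j, of x "fone F y"] by (simp add: fprod_et[OF j fone_hom] fmor_runit)
  qed
  then show ?thesis
    unfolding star_form_cform using v
    by (simp add: corr_op_natural[OF nt r] fmor_runit)
qed

lemma star_form_one_left:
  assumes nt: "nat_trans C F \<Phi>" and g: "g \<in> fdual b" and w: "w \<in> car b"
  shows "star_form (cform \<Phi>) (unt C) (fone F) u0 b g w = g (corr_op F \<Phi> b w)"
proof -
  let ?I = "unt C"
  define r where "r = ev C ?I \<cdot> dag C (runit C (bar C ?I))"
  have r1: "dag C (runit C (bar C ?I)) \<in> hom C (bar C ?I) (bar C ?I \<otimes> ?I)" by (intro dag_hom struct_hom)
  have r: "r \<in> hom C (bar C ?I) ?I" unfolding r_def by (rule comp_hom[OF r1 ev_hom])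
  have rx: "fone F (fmor F r x) = pev ?I x u0" if "x \<in> car (bar C ?I)" for x
    unfolding r_def using that by (simp add: fmor_comp_apply[OF r1 ev_hom] fmor_runit_dag pev_def)
  have l: "lunit C b \<in> hom C (?I \<otimes> b) b" by (rule struct_hom)
  have rb: "r \<boxtimes> idm C b \<in> hom C (bar C ?I \<otimes> b) (?I \<otimes> b)" by (intro tmor_hom r id_hom)
  have ket1: "ket (fob F ?I) (fone F) = u0" by (simp add: ket_def u0_def)
  note j = gj_dual[OF fone_hom]
  have "fprod (bar C ?I) b (gj C F ?I (fone F)) g = g \<circ> fmor F (lunit C b \<cdot> (r \<boxtimes> idm C b))"
  proof (rule fdual_et_eqI[OF fprod_dual[OF j g] fdual_comp[OF g comp_hom[OF rb l]]])
    fix x y assume xy: "x \<in> car (bar C ?I)" "y \<in> car b"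
    show "fprod (bar C ?I) b (gj C F ?I (fone F)) g (et (bar C ?I) b x y) =
        (g \<circ> fmor F (lunit C b \<cdot> (r \<boxtimes> idm C b))) (et (bar C ?I) b x y)"
      using xy hhomD(3)[OF g xy(2), of "fone F (fmor F r x)"]
      by (simp add: fprod_et[OF j g] fmor_comp_apply[OF rb l] fmor_et[OF r id_hom] fmor_id_apply fmor_lunit
          fmor_carr[OF r] gj_apply ket1 rx)
  qed
  then have "star_form (cform \<Phi>) ?I (fone F) u0 b g w =
      g (corr_op F \<Phi> b (fmor F (lunit C b \<cdot> (r \<boxtimes> idm C b)) (et (bar C ?I) b (cS ?I u0) w)))"
    unfolding star_form_cform using w by (simp add: corr_op_natural[OF nt comp_hom[OF rb l]])
  also have "fmor F (lunit C b \<cdot> (r \<boxtimes> idm C b)) (et (bar C ?I) b (cS ?I u0) w) = w"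
    using w by (simp add: fmor_comp_apply[OF rb l] fmor_et[OF r id_hom] fmor_id_apply fmor_lunit
          fmor_carr[OF r] rx pev_cS ip_u0)
  finally show ?thesis .
qed

text \<open>
  Polarisation; the sum of two coefficients is again a coefficient, at which the form is real.
\<close>

lemma star_form_hermitian:
  assumes m: "nat_form m"
    and pos: "\<And>c f v. f \<in> fdual c \<Longrightarrow> v \<in> car c \<Longrightarrow> Im (star_form m c f v c f v) = 0"
    and f: "f \<in> fdual a" and v: "v \<in> car a" and g: "g \<in> fdual b" and w: "w \<in> car b"
  shows "star_form m b g w a f v = cnj (star_form m a f v b g w)"
proof -
  let ?D = "star_form m"
  have im: "Im (k * ?D a f v b g w + cnj k * ?D b g w a f v) = 0" for k
  proof -
    let ?w = "sc b k w"
    have w': "?w \<in> car b" using w by simp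
    obtain d f' v' where d: "f' \<in> fdual d" "v' \<in> car d"
      "\<And>n. nat_form n \<Longrightarrow> n a f v + n b g ?w = n d f' v'"
      using coefficient_sum[OF f v g w'] by blast
    note R = star_form_right[OF m] and L = star_form_left[OF m]
    have l: "?D d f' v' c h x = ?D a f v c h x + ?D b g ?w c h x" if "h \<in> fdual c" "x \<in> car c" for c h x
      using d(3)[OF L[OF that]] by (metis complex_cnj_add complex_cnj_cancel_iff)
    have "?D d f' v' d f' v' = ?D d f' v' a f v + ?D d f' v' b g ?w"
      by (rule d(3)[OF R[OF d(1,2)], symmetric])
    also have "\<dots> = ?D a f v a f v + ?D b g ?w a f v + (?D a f v b g ?w + ?D b g ?w b g ?w)"
      by (simp only: l[OF f v] l[OF g w'])
    finally have "Im (?D b g ?w a f v + ?D a f v b g ?w) = 0"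
      using pos[OF d(1,2)] pos[OF f v] pos[OF g w'] by simp
    moreover have "?D a f v b g ?w = k * ?D a f v b g w" by (rule nat_formD(4)[OF R[OF f v] g w])
    moreover have "cnj (?D b g ?w a f v) = k * cnj (?D b g w a f v)" by (rule nat_formD(4)[OF L[OF f v] g w])
    then have "?D b g ?w a f v = cnj k * ?D b g w a f v" by (metis complex_cnj_cnj complex_cnj_mult)
    ultimately show ?thesis by (simp add: add.commute)
  qed
  show ?thesis by (rule conjugate_by_polarisation) (use im[of 1] im[of \<i>] in simp_all)
qed

text \<open>
  Hermitian symmetry between the coefficient \<open>f \<otimes> v\<close> and the unit.
\<close>

lemma commutes_with_gj:
  assumes nt: "nat_trans C F \<Phi>"
    and pos: "\<And>c f v. f \<in> fdual c \<Longrightarrow> v \<in> car c \<Longrightarrow> nonneg (star_form (cform \<Phi>) c f v c f v)"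
    and f: "f \<in> fdual a"
  shows "\<Phi> (bar C a) (gj C F a f) = gj C F a (\<Phi> a f)"
proof (rule bar_eqI[OF nat_transD(3)[OF nt gj_dual[OF f]] gj_dual[OF nat_transD(3)[OF nt f]]])
  fix v assume v: "v \<in> car a"
  have "\<Phi> (bar C a) (gj C F a f) (cS a v) = star_form (cform \<Phi>) a f v (unt C) (fone F) u0"
    using corr_op(2)[OF nt gj_dual[OF f]] star_form_one_right[OF nt f v] by simp
  also have "\<dots> = cnj (star_form (cform \<Phi>) (unt C) (fone F) u0 a f v)"
    using pos by (intro star_form_hermitian[OF cform_nat[OF nt] _ fone_hom u0_carr f v]) auto
  also have "\<dots> = cnj (\<Phi> a f v)" using star_form_one_left[OF nt f v] corr_op(2)[OF nt f] by simp
  also have "\<dots> = gj C F a (\<Phi> a f) (cS a v)" by (rule gj_cS[OF nat_transD(3)[OF nt f] v, symmetric])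
  finally show "\<Phi> (bar C a) (gj C F a f) (cS a v) = gj C F a (\<Phi> a f) (cS a v)" .
qed

lemma ucp_iff_state:
  assumes nt: "nat_trans C F \<Phi>"
  shows "ucp C F \<Phi> \<longleftrightarrow> cg_state C F (corr_functional F \<Phi>)"
proof -
  let ?pos = "\<forall>c. \<forall>f\<in>fdual c. \<forall>v\<in>car c. nonneg (star_form (cform \<Phi>) c f v c f v)"
  note m = cform_nat[OF nt]
  have mb: "bilin_family (cform \<Phi>)" using nat_form_bilin[OF m] by blast
  have "ucp C F \<Phi> \<longleftrightarrow> (\<forall>a. \<forall>f\<in>fdual a. \<Phi> (bar C a) (gj C F a f) = gj C F a (\<Phi> a f)) \<and>
      \<Phi> (unt C) (fone F) = fone F \<and> ?pos"
    unfolding ucp_def preserves_positive_iff[OF nt] by (simp add: gob_def)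
  also have "\<dots> \<longleftrightarrow> \<Phi> (unt C) (fone F) = fone F \<and> ?pos"
    using commutes_with_gj[OF nt] by blast
  also have "\<dots> \<longleftrightarrow> cg_state C F (corr_functional F \<Phi>)"
    unfolding cg_state_def corr_functional_one[OF nt] positivity_on_coefficients[OF m, of nonneg, folded corr_functional_eq, symmetric]
    using cg_ext_add[OF mb] cg_ext_scale[OF mb] by (simp add: corr_functional_eq)
  finally show ?thesis .
qed

end

theorem proposition5p40:
  fixes C :: "('o, 'm::ab_group_add) tensor_cat"
    and F :: "('o, 'm, 'v::ab_group_add) hfunctor"
    and \<Phi> :: "'o \<Rightarrow> ('v \<Rightarrow> complex) \<Rightarrow> ('v \<Rightarrow> complex)"
  assumes "dagger_tensor_functor C F"
    and "nat_trans C F \<Phi>"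
  shows "ucp C F \<Phi> \<longleftrightarrow> cg_state C F (corr_functional F \<Phi>)"
proof -
  interpret dagger_tensor_functor C F by (rule assms(1))
  show ?thesis by (rule ucp_iff_state[OF assms(2)])
qed

end
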